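(* Let $k$ be a field, $T$ an indeterminate, $G$ a finite group, $L$ a finite Galois extension of the rational function field $k(T)$, and $\alpha : G \rightarrow \mathrm{Aut}(L/k(T))$ an epimorphism that has a section, i.e., there exists an embedding (injective group homomorphism) $\alpha' : \mathrm{Aut}(L/k(T)) \rightarrow G$ such that $\alpha \circ \alpha' = \mathrm{id}_{\mathrm{Aut}(L/k(T))}$. Then there are a finite separable extension $E/k(T)$ (not necessarily normal) with $L \subseteq E$ and $E \cap \overline{k} = L \cap \overline{k}$, and an isomorphism $\beta : \mathrm{Aut}(E/k(T)) \rightarrow G$ such that $\alpha \circ \beta$ is the restriction map $\mathrm{Aut}(E/k(T)) \rightarrow \mathrm{Aut}(L/k(T))$, $\sigma \mapsto \sigma|_L$.
   Context: For a field extension $F/K$, $\mathrm{Aut}(F/K)$ denotes the group of all field automorphisms of $F$ fixing $K$ pointwise. $\overline{k}$ denotes an algebraic closure of $k$ (inside a fixed algebraic closure of $k(T)$ containing all the fields involved), so that $E\cap\overline{k}$ is the algebraic closure of $k$ in $E$. Since $L/k(T)$ is Galois, every element of $\mathrm{Aut}(E/k(T))$ maps $L$ onto itself, so the restriction map is well defined. *)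

theory Defs
  imports "HOL-Algebra.Algebraic_Closure_Type" "HOL-Algebra.Bij"
begin

text \<open>
  Extensions of a field \<open>'f\<close> are taken inside the fixed algebraic closure \<open>'f alg_closure\<close>,
  as subsets containing the copy \<open>range to_ac\<close> of \<open>'f\<close>.
\<close>

abbreviation ac_ring :: "'f::field alg_closure ring" where
  "ac_ring \<equiv> ring_of_type_algebra"

abbreviation base_field :: "'f::field alg_closure set" where
  "base_field \<equiv> range to_ac"

definition extension_field :: "'f::field alg_closure set \<Rightarrow> bool" where
  "extension_field E \<longleftrightarrow> subfield E ac_ring \<and> base_field \<subseteq> E"

definition finite_ext :: "'f::field alg_closure set \<Rightarrow> bool" where
  "finite_ext E \<longleftrightarrow> extension_field E \<and> ring.finite_dimension ac_ring base_field E"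

text \<open>
  The irreducible polynomial \<open>p\<close> below is, up to a unit, the minimal polynomial of \<open>x\<close> over \<open>'f\<close>.
  It is separable iff it has no multiple root in the algebraic closure, which is what
  \<^const>\<open>rsquarefree\<close> says of its image under \<^const>\<open>to_ac\<close>. (Square-freeness of \<open>p\<close>
  over \<open>'f\<close> itself would be automatic.)
\<close>

definition separable_element :: "'f::field alg_closure \<Rightarrow> bool" where
  "separable_element x \<longleftrightarrow>
     (\<exists>p :: 'f poly. Factorial_Ring.irreducible p \<and> poly (map_poly to_ac p) x = 0 \<and>
        rsquarefree (map_poly to_ac p))"

definition separable_ext :: "'f::field alg_closure set \<Rightarrow> bool" where
  "separable_ext E \<longleftrightarrow> extension_field E \<and> (\<forall>x\<in>E. separable_element x)"

text \<open>
  A polynomial over \<open>'f\<close> splits in \<open>L\<close> iff all its roots in the algebraic closure lie in \<open>L\<close>.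
\<close>

definition normal_ext :: "'f::field alg_closure set \<Rightarrow> bool" where
  "normal_ext L \<longleftrightarrow> extension_field L \<and>
     (\<forall>p :: 'f poly. Factorial_Ring.irreducible p \<longrightarrow> (\<exists>x\<in>L. poly (map_poly to_ac p) x = 0) \<longrightarrow>
        {x. poly (map_poly to_ac p) x = 0} \<subseteq> L)"

definition galois_ext :: "'f::field alg_closure set \<Rightarrow> bool" where
  "galois_ext L \<longleftrightarrow> normal_ext L \<and> separable_ext L"

text \<open>
  The automorphism group of \<open>E\<close> over \<open>'f\<close>. As for \<^const>\<open>BijGroup\<close>, only extensional functions
  are admitted, so that an element is determined by its values on \<open>E\<close>; the group law
  inherited from \<^const>\<open>BijGroup\<close> is composition.
\<close>

definition field_aut :: "'f::field alg_closure set \<Rightarrow> ('f alg_closure \<Rightarrow> 'f alg_closure) set" where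
  "field_aut E = {\<sigma> \<in> extensional E.
     \<sigma> \<in> ring_iso (ac_ring\<lparr>carrier := E\<rparr>) (ac_ring\<lparr>carrier := E\<rparr>) \<and> (\<forall>x\<in>base_field. \<sigma> x = x)}"

definition FieldAut :: "'f::field alg_closure set \<Rightarrow> ('f alg_closure \<Rightarrow> 'f alg_closure) monoid" where
  "FieldAut E = BijGroup E\<lparr>carrier := field_aut E\<rparr>"

text \<open>The rational function field \<open>k(T)\<close> is \<open>'k poly fract\<close>, with \<open>T = to_fract [:0, 1:]\<close>.\<close>

definition constant_field :: "'k::field poly fract alg_closure set" where
  "constant_field = range (\<lambda>c. to_ac (to_fract [:c:]))"

definition constant_closure :: "'k::field poly fract alg_closure set" where
  "constant_closure = {x. ring.algebraic ac_ring constant_field x}"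

end

theory Submission
  imports Defs
begin

text \<open>
  Write \<open>K = k(T)\<close>. With \<open>n = |G|\<close>, choose \<open>f = (X - a\<^sub>1) \<cdots> (X - a\<^sub>n) + a\<^sub>n\<close> with \<open>a\<^sub>i\<close> in \<open>k[T]\<close> such
  that for every \<open>j < n\<close> there is a place, unramified in \<open>L\<close>, at which \<open>a\<^sub>1, \<dots>, a\<^sub>j\<close> are distinct
  units and \<open>a\<^sub>j\<^sub>+\<^sub>1, \<dots>, a\<^sub>n\<close> have simple zeros. There \<open>f\<close> has exactly \<open>j\<close> power series roots and
  the others are the roots of an Eisenstein polynomial. By induction on \<open>j\<close>, the automorphisms over
  the compositum of \<open>L\<close> and the algebraic closure of \<open>k\<close> act \<open>j\<close>-fold transitively on the set \<open>R\<close>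
  of roots of \<open>f\<close>. Hence \<open>G\<close>, acting on \<open>L\<close> through \<open>\<alpha>\<close> and on \<open>R\<close> (indexed by \<open>G\<close>) by translations,
  acts on \<open>F = L(R)\<close>.

  The other automorphisms of \<open>F\<close> are destroyed as follows. For a primitive element \<open>\<theta>\<close> of \<open>F\<close> there
  are \<open>r\<close> in \<open>k[T]\<close> and a place at which \<open>\<theta> - r\<close> vanishes, to some order \<open>m\<close>, while its other
  conjugates do not. Let \<open>Y\<close> be the product of the \<open>G\<close>-conjugates of \<open>\<theta> - r\<close>, let \<open>N\<close> in \<open>k[T]\<close> be
  the norm of \<open>\<theta> - r\<close> up to a factor that is a unit at the place, and let \<open>p\<close> in \<open>k[T]\<close> have a
  simple zero at another place and be prime to \<open>N\<close>. Then \<open>s = p N / Y\<^sup>2\<close> is \<open>G\<close>-invariant and has a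
  pole of order \<open>m\<close>, while all conjugates \<open>\<psi> s\<close> with \<open>\<psi>\<close> not in \<open>G\<close> have a zero there. With
  \<open>d = 2 m + 1\<close>, the polynomial \<open>s Z\<^sup>d + Z - 1\<close> is irreducible at the pole, whereas it has a Laurent
  series root where \<open>s\<close> vanishes. Hence if \<open>z\<close> is one of its roots, then every automorphism of
  \<open>E = F(z)\<close> restricts to an element of \<open>G\<close> on \<open>F\<close>. The simple zero of \<open>p\<close> is a place at which only
  one of the \<open>d\<close> roots is unramified; taking it for \<open>z\<close>, no other root lies in \<open>E\<close>, so that the
  restriction is injective. Since the irreducibility holds over the algebraic closure of \<open>k\<close>, no
  constants are added.
\<close>

section \<open>Homomorphisms and subfields\<close>

text \<open>The field \<open>k\<close> may be finite or imperfect. The points \<open>c\<close>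
  therefore range over its algebraic closure, simple zeros are those of polynomials with
  nonvanishing derivative there, and in characteristic \<open>p\<close> the separability of
  \<open>E\<close> is deduced from \<open>E = K(E^p)\<close>. Series at a point have coefficients in
  the algebraic closure of \<open>k\<close>, so that algebraic constants become constant series.
  Irreducibility over the Laurent series field thus governs every compositum of unramified fields
  and constants, which gives both the conjugations and the equality of the constants. The order of a
  conjugate of \<open>s\<close> is that of \<open>N\<close>, namely \<open>m\<close>, minus twice
  that of the conjugate of \<open>Y\<close>, which is \<open>m\<close> or \<open>0\<close>: the
  square turns the presence of \<open>\<theta> - r\<close> among the factors into the sign of the
  order. The exponent \<open>2 m + 1\<close> is prime to \<open>m\<close>, as irreducibility at the
  pole requires, and at least 3, which excludes Laurent series roots with a pole at a simple zero of
  \<open>s\<close>. All permutations of \<open>R\<close> are called for because an extension of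
  \<open>\<alpha> g\<close> permutes \<open>R\<close> in an unknown way and has to be corrected to a
  translation.\<close>

locale rhom =
  fixes f :: "'a::idom \<Rightarrow> 'b::idom"
  assumes one [simp]: "f 1 = 1"
    and add [simp]: "f (x + y) = f x + f y"
    and mult [simp]: "f (x * y) = f x * f y"
begin

lemma zero [simp]: "f 0 = 0"
  by (metis add add_0 add_cancel_right_left)

lemma minus [simp]: "f (- x) = - f x"
  by (metis add add.right_inverse add_eq_0_iff zero)

lemma diff [simp]: "f (x - y) = f x - f y"
  using add[of x "- y"] by simp

lemma power [simp]: "f (x ^ n) = f x ^ n"
  by (induction n) auto

lemma of_nat [simp]: "f (of_nat n) = of_nat n"
  by (induction n) auto

lemma sum: "f (sum g A) = (\<Sum>x\<in>A. f (g x))"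
  by (induction A rule: infinite_finite_induct) auto

lemma prod: "f (prod g A) = (\<Prod>x\<in>A. f (g x))"
  by (induction A rule: infinite_finite_induct) auto

lemma coeff_map [simp]: "coeff (map_poly f p) n = f (coeff p n)"
  by (simp add: coeff_map_poly)

lemma map_pCons [simp]: "map_poly f (pCons a p) = pCons (f a) (map_poly f p)"
  by (rule poly_eqI) (auto simp: coeff_pCons split: nat.splits)

lemma rhom_map_poly: "rhom (map_poly f)"
proof
  show "map_poly f 1 = 1"
    by (simp add: map_poly_1')
  show "map_poly f (p + q) = map_poly f p + map_poly f q" for p q
    by (rule poly_eqI) simp
  show "map_poly f (p * q) = map_poly f p * map_poly f q" for p q
    by (rule poly_eqI) (simp add: coeff_mult sum)
qed

lemma poly_map: "poly (map_poly f p) (f x) = f (poly p x)"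
  by (induction p) auto

lemma map_pderiv: "map_poly f (pderiv p) = pderiv (map_poly f p)"
  by (rule poly_eqI) (simp add: coeff_pderiv)

end

lemma rhom_comp: "rhom f \<Longrightarrow> rhom g \<Longrightarrow> rhom (\<lambda>x. g (f x))"
  by (simp add: rhom_def)

lemma rhom_id: "rhom (\<lambda>x. x)"
  by (simp add: rhom_def)

lemma rhom_to_ac: "rhom to_ac"
  by standard auto

locale fhom = rhom f for f :: "'a::field \<Rightarrow> 'b::field"
begin

lemma inverse [simp]: "f (inverse x) = inverse (f x)"
proof (cases "x = 0")
  case False
  hence "f x * f (inverse x) = 1"
    by (simp flip: mult)
  thus ?thesis
    by (metis inverse_unique)
qed auto

lemma divide [simp]: "f (x / y) = f x / f y"
  by (simp add: divide_inverse)

lemma eq_0_iff [simp]: "f x = 0 \<longleftrightarrow> x = 0"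
proof
  assume "f x = 0"
  show "x = 0"
  proof (rule ccontr)
    assume "x \<noteq> 0"
    hence "f x * f (Fields.inverse x) = 1"
      by (metis mult one right_inverse)
    with \<open>f x = 0\<close> show False by simp
  qed
qed auto

lemma eq_iff [simp]: "f x = f y \<longleftrightarrow> x = y"
  using eq_0_iff[of "x - y"] by (simp del: eq_0_iff)

lemma inj: "inj f"
  by (auto intro: injI)

lemma map_eq_0_iff [simp]: "map_poly f p = 0 \<longleftrightarrow> p = 0"
  by (simp add: poly_eq_iff)

lemma map_eq_iff [simp]: "map_poly f p = map_poly f q \<longleftrightarrow> p = q"
  by (simp add: poly_eq_iff)

lemma degree_map [simp]: "degree (map_poly f p) = degree p"
  by (intro degree_map_poly) auto

lemma lead_coeff_map [simp]: "lead_coeff (map_poly f p) = f (lead_coeff p)"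
  by simp

end

lemma fhom_comp: "fhom f \<Longrightarrow> fhom g \<Longrightarrow> fhom (\<lambda>x. g (f x))"
  by (simp add: fhom_def rhom_comp)

lemma fhom_id: "fhom (\<lambda>x. x)"
  by (simp add: fhom_def rhom_id)

lemma fhom_to_ac: "fhom to_ac"
  by (simp add: fhom_def rhom_to_ac)

text \<open>Type-class counterpart of \<open>subfield\<close>, linked to it by
  \<open>subfield_ac_ring_iff\<close>. Since \<open>inverse 0 = 0\<close>, closure under inverses
  needs no exception for zero.\<close>

definition subfld :: "'a::field set \<Rightarrow> bool" where
  "subfld F \<longleftrightarrow> 0 \<in> F \<and> 1 \<in> F \<and> (\<forall>x\<in>F. \<forall>y\<in>F. x + y \<in> F \<and> x * y \<in> F) \<and>
     (\<forall>x\<in>F. - x \<in> F \<and> inverse x \<in> F)"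

lemma subfldD:
  assumes "subfld F"
  shows "0 \<in> F" "1 \<in> F" "x \<in> F \<Longrightarrow> y \<in> F \<Longrightarrow> x + y \<in> F" "x \<in> F \<Longrightarrow> y \<in> F \<Longrightarrow> x * y \<in> F"
    "x \<in> F \<Longrightarrow> - x \<in> F" "x \<in> F \<Longrightarrow> inverse x \<in> F" "x \<in> F \<Longrightarrow> y \<in> F \<Longrightarrow> x - y \<in> F"
    "x \<in> F \<Longrightarrow> y \<in> F \<Longrightarrow> x / y \<in> F" "x \<in> F \<Longrightarrow> x ^ n \<in> F"
proof -
  have m: "\<And>x y. x \<in> F \<Longrightarrow> y \<in> F \<Longrightarrow> x * y \<in> F" and o: "1 \<in> F"
    and i: "\<And>x. x \<in> F \<Longrightarrow> inverse x \<in> F" and n: "\<And>x. x \<in> F \<Longrightarrow> - x \<in> F"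
    and a: "\<And>x y. x \<in> F \<Longrightarrow> y \<in> F \<Longrightarrow> x + y \<in> F" and z: "0 \<in> F"
    using assms by (auto simp: subfld_def)
  show "0 \<in> F" "1 \<in> F" "x \<in> F \<Longrightarrow> y \<in> F \<Longrightarrow> x + y \<in> F" "x \<in> F \<Longrightarrow> y \<in> F \<Longrightarrow> x * y \<in> F"
    "x \<in> F \<Longrightarrow> - x \<in> F" "x \<in> F \<Longrightarrow> inverse x \<in> F"
    by (fact z o a m n i)+
  show "x \<in> F \<Longrightarrow> y \<in> F \<Longrightarrow> x - y \<in> F"
    using a[of x "- y"] n[of y] by simp
  show "x \<in> F \<Longrightarrow> y \<in> F \<Longrightarrow> x / y \<in> F"
    using m[of x "inverse y"] i[of y] by (simp add: divide_inverse)
  show "x \<in> F \<Longrightarrow> x ^ n \<in> F"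
    by (induction n) (auto simp: o m)
qed

lemma subfld_sum: "subfld F \<Longrightarrow> (\<And>i. i \<in> A \<Longrightarrow> g i \<in> F) \<Longrightarrow> sum g A \<in> F"
  by (induction A rule: infinite_finite_induct) (auto simp: subfldD)

lemma subfld_prod: "subfld F \<Longrightarrow> (\<And>i. i \<in> A \<Longrightarrow> g i \<in> F) \<Longrightarrow> prod g A \<in> F"
  by (induction A rule: infinite_finite_induct) (auto simp: subfldD)

lemma subfld_vimage:
  assumes "fhom f" "subfld F"
  shows "subfld (f -` F)"
proof -
  interpret fhom f by fact
  show ?thesis
    using assms(2) by (auto simp: subfld_def)
qed

lemma subfld_range:
  assumes "fhom f"
  shows "subfld (range f)"
proof -
  interpret fhom f by fact
  show ?thesis
    unfolding subfld_def by (metis (no_types, opaque_lifting) rangeE rangeI add mult minus inverse zero one)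
qed

section \<open>Polynomials with coefficients in a subfield\<close>

definition polys_over :: "'a::field set \<Rightarrow> 'a poly set" where
  "polys_over F = {p. \<forall>i. coeff p i \<in> F}"

lemma polys_overD: "p \<in> polys_over F \<Longrightarrow> coeff p i \<in> F"
  by (simp add: polys_over_def)

lemma polys_over_mono: "F \<subseteq> F' \<Longrightarrow> polys_over F \<subseteq> polys_over F'"
  by (auto simp: polys_over_def)

context
  fixes F :: "'a::field set"
  assumes F: "subfld F"
begin

lemma polys_over_0: "0 \<in> polys_over F"
  and polys_over_add: "p \<in> polys_over F \<Longrightarrow> q \<in> polys_over F \<Longrightarrow> p + q \<in> polys_over F"
  and polys_over_diff: "p \<in> polys_over F \<Longrightarrow> q \<in> polys_over F \<Longrightarrow> p - q \<in> polys_over F"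
  and polys_over_mult: "p \<in> polys_over F \<Longrightarrow> q \<in> polys_over F \<Longrightarrow> p * q \<in> polys_over F"
  and polys_over_smult: "a \<in> F \<Longrightarrow> p \<in> polys_over F \<Longrightarrow> smult a p \<in> polys_over F"
  and polys_over_monom: "a \<in> F \<Longrightarrow> monom a n \<in> polys_over F"
  and polys_over_pCons: "a \<in> F \<Longrightarrow> p \<in> polys_over F \<Longrightarrow> pCons a p \<in> polys_over F"
  by (auto simp: polys_over_def subfldD[OF F] coeff_mult coeff_pCons split: nat.splits
      intro!: subfld_sum[OF F] subfldD(4)[OF F])

lemma poly_in_subfld: "p \<in> polys_over F \<Longrightarrow> x \<in> F \<Longrightarrow> poly p x \<in> F"
  by (auto simp: poly_altdef polys_over_def intro!: subfld_sum[OF F] subfldD[OF F])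

lemma polys_over_div:
  assumes "m \<in> polys_over F" "lead_coeff m = 1" "degree m > 0" "h \<in> polys_over F"
  shows "\<exists>q\<in>polys_over F. \<exists>r\<in>polys_over F. h = m * q + r \<and> degree r < degree m"
  using assms(4)
proof (induction "degree h" arbitrary: h rule: less_induct)
  case less
  show ?case
  proof (cases "degree h < degree m")
    case True
    thus ?thesis
      using less.prems by (intro bexI[of _ 0] bexI[of _ h]) (auto simp: polys_over_0)
  next
    case False
    define u where "u = monom (lead_coeff h) (degree h - degree m)"
    have u: "u \<in> polys_over F"
      unfolding u_def using less.prems by (intro polys_over_monom) (auto simp: polys_over_def)
    define h' where "h' = h - m * u"
    have h': "h' \<in> polys_over F"
      unfolding h'_def using u less.prems assms by (intro polys_over_diff polys_over_mult)
    have "h \<noteq> 0"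
      using False assms by auto
    hence lc: "lead_coeff h \<noteq> 0" by simp
    have "m \<noteq> 0" "u \<noteq> 0" "degree u = degree h - degree m" "lead_coeff u = lead_coeff h"
      using assms(3) lc by (auto simp: u_def degree_monom_eq monom_eq_0_iff)
    hence "degree (m * u) = degree h" "lead_coeff (m * u) = lead_coeff h"
      using assms(2) False lead_coeff_mult[of m u] by (simp_all add: degree_mult_eq)
    have dh: "degree h > 0" using False assms(3) by linarith
    have "coeff h' (degree h) = 0"
      unfolding h'_def using \<open>degree (m * u) = degree h\<close> \<open>lead_coeff (m * u) = lead_coeff h\<close>
      by simp
    moreover have "degree h' \<le> degree h"
      unfolding h'_def using \<open>degree (m * u) = degree h\<close> by (intro degree_diff_le) auto
    ultimately have "degree h' < degree h"
      using dh by (metis degree_0 le_neq_implies_less leading_coeff_0_iff)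
    then obtain q r where "q \<in> polys_over F" "r \<in> polys_over F" "h' = m * q + r"
      "degree r < degree m"
      using less.hyps[OF _ h'] by auto
    thus ?thesis
      by (intro bexI[of _ "q + u"] bexI[of _ r])
        (auto simp: h'_def algebra_simps polys_over_add u)
  qed
qed

text \<open>Instead of irreducibility, the divisibility property is recorded, with the quotient
  again over \<open>F\<close>: it carries every relation of \<open>x\<close> over \<open>F\<close>
  to the other roots of \<open>m\<close>, also after a homomorphism has been applied to the
  coefficients.\<close>

lemma minimal_polynomial:
  assumes "p \<in> polys_over F" "p \<noteq> 0" "poly p x = 0"
  obtains m where "m \<in> polys_over F" "lead_coeff m = 1" "degree m > 0" "poly m x = 0"
    "\<And>h. h \<in> polys_over F \<Longrightarrow> poly h x = 0 \<Longrightarrow> \<exists>q\<in>polys_over F. h = m * q"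
proof -
  define P where "P = (\<lambda>q. q \<in> polys_over F \<and> q \<noteq> 0 \<and> poly q x = 0)"
  define m0 where "m0 = (ARG_MIN degree q. P q)"
  have Pp: "P p" using assms by (simp add: P_def)
  have m0: "P m0" and min: "\<And>q. P q \<Longrightarrow> degree m0 \<le> degree q"
    unfolding m0_def using arg_min_natI[of P p degree, OF Pp] arg_min_nat_le[of P _ degree] by auto
  define m where "m = smult (inverse (lead_coeff m0)) m0"
  have m: "m \<in> polys_over F" "lead_coeff m = 1" "poly m x = 0" "degree m = degree m0"
    using m0 by (auto simp: m_def P_def polys_over_smult subfldD[OF F] polys_overD)
  have deg: "degree m > 0"
  proof (rule ccontr)
    assume "\<not> degree m > 0"
    then obtain c where "m = [:c:]" by (auto elim: degree_eq_zeroE)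
    thus False using m(2,3) by simp
  qed
  have "\<exists>q\<in>polys_over F. h = m * q" if h: "h \<in> polys_over F" "poly h x = 0" for h
  proof -
    obtain q r where qr: "q \<in> polys_over F" "r \<in> polys_over F" "h = m * q + r" "degree r < degree m"
      using polys_over_div[OF m(1,2) deg h(1)] by auto
    have "poly r x = 0" using qr h m by simp
    hence "r = 0" using min[of r] qr m unfolding P_def by force
    thus ?thesis using qr by auto
  qed
  thus ?thesis using that m deg by blast
qed

end

section \<open>Homomorphisms defined on a subfield\<close>

definition hom_on :: "'a::field set \<Rightarrow> ('a \<Rightarrow> 'b::field) \<Rightarrow> bool" where
  "hom_on F f \<longleftrightarrow> f 1 = 1 \<and> (\<forall>x\<in>F. \<forall>y\<in>F. f (x + y) = f x + f y \<and> f (x * y) = f x * f y)"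

lemma fhom_hom_on: "fhom f \<Longrightarrow> hom_on F f"
  by (simp add: fhom_def rhom_def hom_on_def)

lemma hom_on_UNIV: "hom_on UNIV f \<longleftrightarrow> fhom f"
  by (simp add: fhom_def rhom_def hom_on_def) blast

context
  fixes F :: "'a::field set" and f :: "'a \<Rightarrow> 'b::field"
  assumes F: "subfld F" and f: "hom_on F f"
begin

lemma hom_on_1: "f 1 = 1"
  and hom_on_add: "x \<in> F \<Longrightarrow> y \<in> F \<Longrightarrow> f (x + y) = f x + f y"
  and hom_on_mult: "x \<in> F \<Longrightarrow> y \<in> F \<Longrightarrow> f (x * y) = f x * f y"
  using f by (auto simp: hom_on_def)

lemma hom_on_0: "f 0 = 0"
  using hom_on_add[of 0 0] subfldD(1)[OF F] by (metis add_0 add_cancel_right_left)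

lemma hom_on_minus: "x \<in> F \<Longrightarrow> f (- x) = - f x"
  using hom_on_add[of x "- x"] hom_on_0 by (simp add: subfldD[OF F] add_eq_0_iff)

lemma hom_on_sum: "(\<And>i. i \<in> A \<Longrightarrow> g i \<in> F) \<Longrightarrow> f (sum g A) = (\<Sum>i\<in>A. f (g i))"
  by (induction A rule: infinite_finite_induct) (auto simp: hom_on_0 hom_on_add subfld_sum[OF F])

lemma hom_on_coeff: "coeff (map_poly f p) n = f (coeff p n)"
  by (simp add: coeff_map_poly hom_on_0)

lemma hom_on_map_poly:
  assumes "p \<in> polys_over F" "q \<in> polys_over F"
  shows "map_poly f (p + q) = map_poly f p + map_poly f q"
    and "map_poly f (p - q) = map_poly f p - map_poly f q"
    and "map_poly f (p * q) = map_poly f p * map_poly f q"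
proof -
  note c = polys_overD[OF assms(1)] polys_overD[OF assms(2)]
  show "map_poly f (p + q) = map_poly f p + map_poly f q"
    by (rule poly_eqI) (simp add: hom_on_coeff hom_on_add c)
  show "map_poly f (p - q) = map_poly f p - map_poly f q"
  proof (rule poly_eqI)
    fix n
    have "f (coeff p n + (- coeff q n)) = f (coeff p n) - f (coeff q n)"
      by (subst hom_on_add) (auto simp: c hom_on_minus subfldD[OF F])
    thus "coeff (map_poly f (p - q)) n = coeff (map_poly f p - map_poly f q) n"
      by (simp add: hom_on_coeff)
  qed
  show "map_poly f (p * q) = map_poly f p * map_poly f q"
    by (rule poly_eqI)
      (simp add: hom_on_coeff coeff_mult hom_on_sum hom_on_mult c subfldD[OF F])
qed

lemma hom_on_conj_exists:
  fixes x :: 'a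
  assumes "p \<in> polys_over F" "p \<noteq> 0" "poly p x = 0"
    and closed: "\<And>q :: 'b poly. degree q > 0 \<Longrightarrow> \<exists>y. poly q y = 0"
  shows "\<exists>y. \<forall>h\<in>polys_over F. poly h x = 0 \<longrightarrow> poly (map_poly f h) y = 0"
proof -
  obtain m where m: "m \<in> polys_over F" "lead_coeff m = 1" "degree m > 0" "poly m x = 0"
    "\<And>h. h \<in> polys_over F \<Longrightarrow> poly h x = 0 \<Longrightarrow> \<exists>q\<in>polys_over F. h = m * q"
    using minimal_polynomial[OF F assms(1-3)] by blast
  have "coeff (map_poly f m) (degree m) \<noteq> 0"
    using m(2) hom_on_1 by (simp add: hom_on_coeff)
  hence "degree (map_poly f m) > 0"
    using m(3) le_degree[of "map_poly f m" "degree m"] by linarith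
  then obtain y where y: "poly (map_poly f m) y = 0"
    using closed by blast
  show ?thesis
  proof (intro exI[of _ y] ballI impI)
    fix h assume h: "h \<in> polys_over F" "poly h x = 0"
    then obtain q where "q \<in> polys_over F" "h = m * q"
      using m(5) by blast
    thus "poly (map_poly f h) y = 0"
      using hom_on_map_poly(3)[OF m(1)] y by simp
  qed
qed

end

section \<open>Extension of homomorphisms\<close>

text \<open>In the minimal polynomial \<open>a + X r\<close> of \<open>u\<close> the constant term
  is nonzero, since otherwise \<open>r\<close> would be a smaller annihilator; hence
  \<open>- r / a\<close> takes the value \<open>inverse u\<close> at \<open>u\<close>.\<close>

lemma inverse_of_algebraic:
  fixes u :: "'a::field"
  assumes F: "subfld F" and "p \<in> polys_over F" "p \<noteq> 0" "poly p u = 0" "u \<noteq> 0"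
  obtains q where "q \<in> polys_over F" "inverse u = poly q u"
proof -
  obtain m where m: "m \<in> polys_over F" "lead_coeff m = 1" "degree m > 0" "poly m u = 0"
    "\<And>h. h \<in> polys_over F \<Longrightarrow> poly h u = 0 \<Longrightarrow> \<exists>q\<in>polys_over F. h = m * q"
    using minimal_polynomial[OF assms(1-4)] by blast
  obtain a r where ar: "m = pCons a r"
    by (cases m)
  have r: "r \<in> polys_over F"
    unfolding polys_over_def using polys_overD[OF m(1), of "Suc _"] ar by auto
  have a: "a \<in> F"
    using polys_overD[OF m(1), of 0] ar by simp
  have "a \<noteq> 0"
  proof
    assume "a = 0"
    hence "poly r u = 0" using m(4) ar \<open>u \<noteq> 0\<close> by simp
    then obtain q where "r = m * q" using m(5) r by blast
    moreover have "r \<noteq> 0" using m(3) ar by auto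
    ultimately have "degree r \<ge> degree m" by (auto simp: degree_mult_eq)
    thus False using ar \<open>r \<noteq> 0\<close> by simp
  qed
  show ?thesis
  proof (rule that)
    show "smult (- inverse a) r \<in> polys_over F"
      by (intro polys_over_smult F r subfldD[OF F] a)
    have "a + u * poly r u = 0" using m(4) ar by simp
    hence "u * poly r u = - a" by (simp add: add_eq_0_iff)
    hence "u * (- inverse a * poly r u) = 1"
      using \<open>a \<noteq> 0\<close> by (simp add: field_simps)
    thus "inverse u = poly (smult (- inverse a) r) u"
      using inverse_unique by force
  qed
qed

lemma poly_over_closed:
  assumes "\<And>x y. x \<in> D \<Longrightarrow> y \<in> D \<Longrightarrow> x + y \<in> D \<and> x * y \<in> D" "F \<subseteq> D" "0 \<in> D"
    "p \<in> polys_over F" "u \<in> D"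
  shows "poly p u \<in> D"
  using assms(4)
proof (induction p)
  case (pCons a p)
  have "a \<in> F" using polys_overD[OF pCons.prems, of 0] by simp
  moreover have "p \<in> polys_over F"
    unfolding polys_over_def using polys_overD[OF pCons.prems, of "Suc _"] by auto
  ultimately show ?case using pCons assms by auto
qed (use assms in auto)

lemma subfld_of_algebraic_ring:
  assumes "subfld F" "F \<subseteq> D" "\<And>x y. x \<in> D \<Longrightarrow> y \<in> D \<Longrightarrow> x + y \<in> D \<and> x * y \<in> D"
    and alg: "\<And>x. x \<in> D \<Longrightarrow> \<exists>p\<in>polys_over F. p \<noteq> 0 \<and> poly p x = 0"
  shows "subfld D"
  unfolding subfld_def
proof (intro conjI ballI)
  show D0: "0 \<in> D" "1 \<in> D"
    using assms(2) subfldD[OF assms(1)] by auto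
  fix x assume x: "x \<in> D"
  show "- x \<in> D"
    using assms(3)[of "-1" x] x assms(2) subfldD(5)[OF assms(1), of 1] subfldD(2)[OF assms(1)]
    by auto
  show "inverse x \<in> D"
  proof (cases "x = 0")
    case False
    obtain p where "p \<in> polys_over F" "p \<noteq> 0" "poly p x = 0" using alg[OF x] by blast
    then obtain q where "q \<in> polys_over F" "inverse x = poly q x"
      using inverse_of_algebraic[OF assms(1)] False by metis
    thus ?thesis using poly_over_closed[OF assms(3,2) D0(1)] x by simp
  qed (use D0 in auto)
qed (use assms(3) in auto)

text \<open>
  Zorn's lemma is applied to the graphs of partial homomorphisms, which are the single-valued
  subrings of the product ring.
\<close>

definition hom_graph :: "('a::field \<times> 'b::field) set \<Rightarrow> bool" where
  "hom_graph R \<longleftrightarrow> (1, 1) \<in> R \<and> (\<forall>x y x' y'. (x, y) \<in> R \<longrightarrow> (x', y') \<in> R \<longrightarrow>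
     (x + x', y + y') \<in> R \<and> (x * x', y * y') \<in> R) \<and> (\<forall>x y y'. (x, y) \<in> R \<longrightarrow> (x, y') \<in> R \<longrightarrow> y = y')"

text \<open>The graph is the image of the ring \<open>F[X]\<close> under
  \<open>h \<mapsto> (h(x), h(y))\<close>, the coefficients of \<open>h\<close> being mapped by
  \<open>f\<close> in the second entry. It is single-valued exactly because relations of
  \<open>x\<close> pass to \<open>y\<close>.\<close>

lemma hom_graph_adjoin:
  fixes f :: "'a::field \<Rightarrow> 'b::field"
  assumes F: "subfld F" and f: "hom_on F f"
    and xy: "\<forall>h\<in>polys_over F. poly h x = 0 \<longrightarrow> poly (map_poly f h) y = 0"
  defines "R \<equiv> (\<lambda>h. (poly h x, poly (map_poly f h) y)) ` polys_over F"
  shows "hom_graph R" "(x, y) \<in> R" "\<And>a. a \<in> F \<Longrightarrow> (a, f a) \<in> R"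
proof -
  note hm = hom_on_map_poly[OF F f]
  show c: "(a, f a) \<in> R" if "a \<in> F" for a
    unfolding R_def using that
    by (intro image_eqI[of _ _ "[:a:]"])
      (auto simp: polys_over_pCons[OF F] polys_over_0[OF F] map_poly_pCons hom_on_0[OF F f])
  have "map_poly f [:0, 1:] = [:0, 1:]"
    by (simp add: map_poly_pCons hom_on_0[OF F f] hom_on_1[OF F f])
  thus "(x, y) \<in> R"
    unfolding R_def
    by (intro image_eqI[of _ _ "[:0, 1:]"])
      (auto simp: polys_over_pCons[OF F] polys_over_0[OF F] subfldD[OF F])
  show "hom_graph R"
    unfolding hom_graph_def
  proof (intro conjI allI impI)
    show "(1, 1) \<in> R"
      using c[of 1] subfldD[OF F] by (simp add: hom_on_1[OF F f])
  next
    fix u v u' v' assume "(u, v) \<in> R" "(u', v') \<in> R"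
    then obtain h h' where h: "h \<in> polys_over F" "u = poly h x" "v = poly (map_poly f h) y"
      and h': "h' \<in> polys_over F" "u' = poly h' x" "v' = poly (map_poly f h') y"
      unfolding R_def by auto
    show "(u + u', v + v') \<in> R"
      unfolding R_def
      by (intro image_eqI[of _ _ "h + h'"]) (auto simp: h h' hm polys_over_add[OF F])
    show "(u * u', v * v') \<in> R"
      unfolding R_def
      by (intro image_eqI[of _ _ "h * h'"]) (auto simp: h h' hm polys_over_mult[OF F])
  next
    fix u v v' assume "(u, v) \<in> R" "(u, v') \<in> R"
    then obtain h h' where h: "h \<in> polys_over F" "u = poly h x" "v = poly (map_poly f h) y"
      and h': "h' \<in> polys_over F" "u = poly h' x" "v' = poly (map_poly f h') y"
      unfolding R_def by auto
    have "h - h' \<in> polys_over F" "poly (h - h') x = 0"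
      using h h' by (auto simp: polys_over_diff[OF F])
    hence "poly (map_poly f (h - h')) y = 0" using xy by blast
    thus "v = v'" using h h' hm(2)[of h h'] by simp
  qed
qed

text \<open>The domain of a maximal graph is a field, since every element is algebraic over
  \<open>F\<close>; an element outside it could be adjoined with a root as its image. Zorn's lemma
  starts at \<open>R0\<close> rather than at the graph of \<open>f\<close>, so that one value
  outside \<open>F\<close> can be prescribed.\<close>

lemma hom_extend_maximal:
  fixes F :: "'a::field set" and f :: "'a \<Rightarrow> 'b::field"
  assumes F: "subfld F"
    and alg: "\<And>x. \<exists>p\<in>polys_over F. p \<noteq> 0 \<and> poly p x = 0"
    and closed: "\<And>q :: 'b poly. degree q > 0 \<Longrightarrow> \<exists>y. poly q y = 0"
    and R0: "hom_graph R0" "\<And>a. a \<in> F \<Longrightarrow> (a, f a) \<in> R0"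
  shows "\<exists>g. fhom g \<and> (\<forall>(x, y)\<in>R0. g x = y)"
proof -
  define A where "A = {R :: ('a \<times> 'b) set. hom_graph R \<and> R0 \<subseteq> R}"
  have "\<exists>M\<in>A. \<forall>Z\<in>A. M \<subseteq> Z \<longrightarrow> Z = M"
  proof (rule subset_Zorn_nonempty)
    show "A \<noteq> {}" using R0 by (auto simp: A_def)
  next
    fix C assume C: "C \<noteq> {}" "subset.chain A C"
    hence hg: "hom_graph R" "R0 \<subseteq> R" if "R \<in> C" for R
      using that by (auto simp: subset.chain_def A_def)
    have two: "\<exists>R\<in>C. u \<in> R \<and> v \<in> R" if "u \<in> \<Union>C" "v \<in> \<Union>C" for u v
    proof -
      obtain Z Y where "Z \<in> C" "Y \<in> C" "u \<in> Z" "v \<in> Y" using \<open>u \<in> \<Union>C\<close> \<open>v \<in> \<Union>C\<close> by blast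
      moreover have "Z \<subseteq> Y \<or> Y \<subseteq> Z"
        using C(2) \<open>Z \<in> C\<close> \<open>Y \<in> C\<close> unfolding subset_chain_def by blast
      ultimately show ?thesis by blast
    qed
    have "hom_graph (\<Union>C)"
      unfolding hom_graph_def
    proof (intro conjI allI impI)
      show "(1, 1) \<in> \<Union>C" using C(1) hg unfolding hom_graph_def by blast
    next
      fix x y x' y' assume "(x, y) \<in> \<Union>C" "(x', y') \<in> \<Union>C"
      then obtain R where R: "R \<in> C" "(x, y) \<in> R" "(x', y') \<in> R" using two by blast
      thus "(x + x', y + y') \<in> \<Union>C" "(x * x', y * y') \<in> \<Union>C"
        using hg(1)[OF R(1)] unfolding hom_graph_def by blast+
    next
      fix x y y' assume "(x, y) \<in> \<Union>C" "(x, y') \<in> \<Union>C"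
      then obtain R where R: "R \<in> C" "(x, y) \<in> R" "(x, y') \<in> R" using two by blast
      thus "y = y'" using hg(1)[OF R(1)] unfolding hom_graph_def by blast
    qed
    thus "\<Union>C \<in> A" using C(1) hg(2) by (auto simp: A_def)
  qed
  then obtain M where "M \<in> A" and max': "\<forall>Z\<in>A. M \<subseteq> Z \<longrightarrow> Z = M"
    by (elim bexE)
  hence M: "hom_graph M" "R0 \<subseteq> M"
    by (auto simp: A_def)
  have max: "Z = M" if "hom_graph Z" "R0 \<subseteq> Z" "M \<subseteq> Z" for Z
    using max' that by (simp add: A_def)
  define D where "D = fst ` M"
  define g where "g = (\<lambda>x. THE y. (x, y) \<in> M)"
  have M1: "(1, 1) \<in> M"
    and Madd: "\<And>x y x' y'. (x, y) \<in> M \<Longrightarrow> (x', y') \<in> M \<Longrightarrow> (x + x', y + y') \<in> M"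
    and Mmult: "\<And>x y x' y'. (x, y) \<in> M \<Longrightarrow> (x', y') \<in> M \<Longrightarrow> (x * x', y * y') \<in> M"
    and Muniq: "\<And>x y y'. (x, y) \<in> M \<Longrightarrow> (x, y') \<in> M \<Longrightarrow> y = y'"
    using M(1) unfolding hom_graph_def by blast+
  have g: "g x = y" if "(x, y) \<in> M" for x y
    unfolding g_def using that Muniq by blast
  have gD: "(x, g x) \<in> M" if "x \<in> D" for x
    using that g unfolding D_def by force
  have D: "subfld D"
  proof (rule subfld_of_algebraic_ring[OF F])
    show "F \<subseteq> D" using R0(2) M(2) unfolding D_def by force
    show "x + y \<in> D \<and> x * y \<in> D" if "x \<in> D" "y \<in> D" for x y
      using that Madd Mmult unfolding D_def by force
  qed (use alg in blast)
  have "hom_on D g"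
    unfolding hom_on_def using g[OF M1] g[OF Madd[OF gD gD]] g[OF Mmult[OF gD gD]] by blast
  moreover have "D = UNIV"
  proof (rule ccontr)
    assume "D \<noteq> UNIV"
    then obtain x where x: "x \<notin> D" by blast
    have "F \<subseteq> D" using R0(2) M(2) unfolding D_def by force
    then obtain p where "p \<in> polys_over D" "p \<noteq> 0" "poly p x = 0"
      using alg[of x] polys_over_mono by blast
    then obtain y where y: "\<forall>h\<in>polys_over D. poly h x = 0 \<longrightarrow> poly (map_poly g h) y = 0"
      using hom_on_conj_exists[OF D \<open>hom_on D g\<close> _ _ _ closed] by blast
    define R where "R = (\<lambda>h. (poly h x, poly (map_poly g h) y)) ` polys_over D"
    have R: "hom_graph R" "(x, y) \<in> R" "\<And>a. a \<in> D \<Longrightarrow> (a, g a) \<in> R"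
      unfolding R_def using hom_graph_adjoin[OF D \<open>hom_on D g\<close> y] by auto
    have "M \<subseteq> R"
      using R(3) g unfolding D_def by force
    hence "R = M" using max[OF R(1)] M(2) by blast
    thus False using R(2) x unfolding D_def by force
  qed
  ultimately have "fhom g" by (simp add: hom_on_UNIV)
  thus ?thesis using g M(2) by blast
qed

theorem hom_extend_conj:
  fixes F :: "'a::field set" and f :: "'a \<Rightarrow> 'b::alg_closed_field"
  assumes F: "subfld F" and f: "hom_on F f"
    and alg: "\<And>x. \<exists>p\<in>polys_over F. p \<noteq> 0 \<and> poly p x = 0"
    and xy: "\<And>h. h \<in> polys_over F \<Longrightarrow> poly h x = 0 \<Longrightarrow> poly (map_poly f h) y = 0"
  obtains g where "fhom g" "\<And>a. a \<in> F \<Longrightarrow> g a = f a" "g x = y"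
proof -
  have "\<forall>h\<in>polys_over F. poly h x = 0 \<longrightarrow> poly (map_poly f h) y = 0" using xy by blast
  note G = hom_graph_adjoin[OF F f this]
  have "\<exists>g. fhom g \<and>
    (\<forall>(u, v)\<in>(\<lambda>h. (poly h x, poly (map_poly f h) y)) ` polys_over F. g u = v)"
    by (rule hom_extend_maximal[OF F alg alg_closed_imp_poly_has_root G(1,3)])
  then obtain g where g: "fhom g"
    "\<forall>(u, v)\<in>(\<lambda>h. (poly h x, poly (map_poly f h) y)) ` polys_over F. g u = v"
    by blast
  show ?thesis
  proof (rule that[OF g(1)])
    show "g a = f a" if "a \<in> F" for a
      using bspec[OF g(2) G(3)[OF that]] by simp
    show "g x = y"
      using bspec[OF g(2) G(2)] by simp
  qed
qed

corollary hom_extend: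
  fixes F :: "'a::field set" and f :: "'a \<Rightarrow> 'b::alg_closed_field"
  assumes F: "subfld F" and f: "hom_on F f"
    and alg: "\<And>x. \<exists>p\<in>polys_over F. p \<noteq> 0 \<and> poly p x = 0"
  obtains g where "fhom g" "\<And>a. a \<in> F \<Longrightarrow> g a = f a"
proof -
  \<comment> \<open>Prescribing \<open>0 \<mapsto> 0\<close> is no restriction.\<close>
  have "poly (map_poly f h) 0 = 0" if "h \<in> polys_over F" "poly h 0 = 0" for h
  proof -
    have "coeff h 0 = 0" using that(2) by (simp add: poly_0_coeff_0)
    hence "coeff (map_poly f h) 0 = 0"
      using hom_on_coeff[OF F f] hom_on_0[OF F f] by simp
    thus ?thesis by (simp add: poly_0_coeff_0)
  qed
  then obtain g where "fhom g" "\<And>a. a \<in> F \<Longrightarrow> g a = f a"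
    using hom_extend_conj[OF F f alg, of 0 0] by metis
  thus ?thesis by (rule that)
qed

section \<open>Formal power series\<close>

lemma dvd_poly_diff: "(x - y :: 'a::comm_ring_1) dvd poly p x - poly p y"
proof (induction p)
  case (pCons a p)
  have "poly (pCons a p) x - poly (pCons a p) y = (x - y) * poly p x + y * (poly p x - poly p y)"
    by (simp add: algebra_simps)
  thus ?case using pCons by (simp del: poly_pCons)
qed auto

lemma poly_taylor2: "\<exists>c. poly p (x + h :: 'a::idom) = poly p x + h * poly (pderiv p) x + h\<^sup>2 * c"
proof (induction p)
  case 0
  show ?case by (intro exI[of _ 0]) auto
next
  case (pCons a p)
  then obtain c where "poly p (x + h) = poly p x + h * poly (pderiv p) x + h\<^sup>2 * c" by blast
  thus ?case
    by (intro exI[of _ "poly (pderiv p) x + (x + h) * c"])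
      (simp add: pderiv_pCons algebra_simps power2_eq_square)
qed

lemma fps_X_power_dvd_iff: "fps_X ^ n dvd (f :: 'a::comm_ring_1 fps) \<longleftrightarrow> (\<forall>i<n. f $ i = 0)"
proof
  assume "fps_X ^ n dvd f"
  then obtain g where "f = fps_X ^ n * g" by blast
  thus "\<forall>i<n. f $ i = 0" by (simp add: fps_X_power_mult_nth)
next
  assume "\<forall>i<n. f $ i = 0"
  hence "f = fps_X ^ n * fps_shift n f"
    by (intro fps_ext) (auto simp: fps_X_power_mult_nth)
  thus "fps_X ^ n dvd f" by (metis dvd_triv_left)
qed

lemma rhom_fps_nth_0: "rhom (\<lambda>f :: 'a::idom fps. f $ 0)"
  by standard auto

abbreviation residue_poly :: "'a::idom fps poly \<Rightarrow> 'a poly" where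
  "residue_poly \<equiv> map_poly (\<lambda>f. f $ 0)"

lemma poly_nth_0: "poly p u $ 0 = poly (residue_poly p) (u $ 0)" for p :: "'a::idom fps poly"
  by (simp add: rhom.poly_map[OF rhom_fps_nth_0])

lemma pderiv_residue_poly: "residue_poly (pderiv p) = pderiv (residue_poly p)"
  by (simp add: rhom.map_pderiv[OF rhom_fps_nth_0])

text \<open>One coefficient per step: \<open>u\<close> modulo \<open>X^(n+1)\<close> is corrected at
  the next exponent, and the limit is read off the diagonal of the approximations.\<close>

lemma hensel:
  fixes p :: "'a::field fps poly"
  assumes root: "poly (residue_poly p) a = 0" and simple: "poly (pderiv (residue_poly p)) a \<noteq> 0"
  obtains u where "poly p u = 0" "u $ 0 = a"
proof -
  define P where "P = (\<lambda>n u. u $ 0 = a \<and> fps_X ^ Suc n dvd poly p u)"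
  have "\<exists>s. \<forall>n. P n (s n) \<and> fps_X ^ Suc n dvd s (Suc n) - s n"
  proof (rule dependent_nat_choice)
    show "\<exists>u. P 0 u"
      by (rule exI[of _ "fps_const a"]) (simp add: P_def fps_X_power_dvd_iff poly_nth_0 root del: power_Suc power_one_right)
  next
    fix u n assume u: "P n u"
    define d where "d = poly (pderiv p) u $ 0"
    have d: "d \<noteq> 0"
      using simple u by (simp add: d_def poly_nth_0 pderiv_residue_poly P_def)
    \<comment> \<open>By Taylor's formula, adding \<open>e X^(n+1)\<close> changes the coefficient
      of index \<open>Suc n\<close> in \<open>poly p u\<close> by \<open>e * d\<close> and leaves
      the lower ones unchanged.\<close>
    define e where "e = - (poly p u $ Suc n) / d"
    define h where "h = fps_X ^ Suc n * fps_const e"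
    obtain c where c: "poly p (u + h) = poly p u + h * poly (pderiv p) u + h\<^sup>2 * c"
      using poly_taylor2 by blast
    have hnth: "(h * g) $ i = (if i < Suc n then 0 else e * g $ (i - Suc n))" for g i
      unfolding h_def mult.assoc by (subst fps_X_power_mult_nth) auto
    have "poly p (u + h) $ i = 0" if "i < Suc (Suc n)" for i
    proof (cases "i < Suc n")
      case True
      hence "poly p u $ i = 0"
        using u unfolding P_def fps_X_power_dvd_iff by blast
      with True show ?thesis
        by (simp only: c fps_add_nth power2_eq_square mult.assoc hnth) simp
    next
      case False
      hence i: "i = Suc n" using that by simp
      have "(h * (h * c)) $ Suc n = 0"
        by (simp only: hnth) simp
      moreover have "(h * poly (pderiv p) u) $ Suc n = e * d"
        by (simp only: hnth d_def) simp
      ultimately show ?thesis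
        using d by (simp add: i c power2_eq_square mult.assoc e_def)
    qed
    hence "P (Suc n) (u + h)"
      using u unfolding P_def fps_X_power_dvd_iff by (auto simp: h_def fps_X_power_mult_nth simp del: power_Suc)
    thus "\<exists>v. P (Suc n) v \<and> fps_X ^ Suc n dvd v - u"
      by (intro exI[of _ "u + h"]) (auto simp: h_def)
  qed
  then obtain s where s: "\<And>n. P n (s n)" "\<And>n. fps_X ^ Suc n dvd s (Suc n) - s n" by blast
  have stable: "s (n + k) $ i = s n $ i" if "i \<le> n" for i n k
  proof (induction k)
    case (Suc k)
    have "(s (Suc (n + k)) - s (n + k)) $ i = 0"
      using s(2)[of "n + k"] that unfolding fps_X_power_dvd_iff by auto
    thus ?case using Suc by simp
  qed auto
  \<comment> \<open>From index \<open>i\<close> on, the approximations agree in coefficient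
    \<open>i\<close>, so the diagonal agrees with \<open>s n\<close> modulo
    \<open>X^(n+1)\<close>.\<close>
  define w where "w = Abs_fps (\<lambda>i. s i $ i)"
  have w: "fps_X ^ Suc n dvd w - s n" for n
    unfolding fps_X_power_dvd_iff
  proof (intro allI impI)
    fix i assume "i < Suc n"
    thus "(w - s n) $ i = 0"
      using stable[of i i "n - i"] by (simp add: w_def)
  qed
  have "poly p w $ n = 0" for n
  proof -
    have "fps_X ^ Suc n dvd poly p w - poly p (s n)"
      using w dvd_poly_diff dvd_trans by blast
    hence "fps_X ^ Suc n dvd poly p w"
      using s(1)[of n] unfolding P_def by (metis diff_add_cancel dvd_add)
    thus ?thesis unfolding fps_X_power_dvd_iff by auto
  qed
  hence "poly p w = 0" by (auto simp: fps_eq_iff)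
  moreover have "w $ 0 = a"
    using s(1)[of 0] by (simp add: w_def P_def)
  ultimately show ?thesis by (rule that)
qed

text \<open>By Taylor's formula \<open>h\<close> times \<open>p'(u) + h c\<close> vanishes, and the
  second factor is a unit because \<open>h\<close> has no constant term.\<close>

lemma hensel_unique:
  fixes p :: "'a::field fps poly"
  assumes "poly p u = 0" "poly p v = 0" "u $ 0 = v $ 0"
    and simple: "poly (pderiv (residue_poly p)) (u $ 0) \<noteq> 0"
  shows "u = v"
proof -
  define h where "h = v - u"
  obtain c where "poly p (u + h) = poly p u + h * poly (pderiv p) u + h\<^sup>2 * c"
    using poly_taylor2 by blast
  hence "h * (poly (pderiv p) u + h * c) = 0"
    using assms by (simp add: h_def algebra_simps power2_eq_square)
  moreover have "(poly (pderiv p) u + h * c) $ 0 \<noteq> 0"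
    using simple assms(3) by (simp add: poly_nth_0 pderiv_residue_poly h_def)
  hence "poly (pderiv p) u + h * c \<noteq> 0" by force
  ultimately have "h = 0" by simp
  thus ?thesis by (simp add: h_def)
qed

section \<open>Factorization over the Laurent series field\<close>

lemma rhom_fps_to_fls: "rhom (fps_to_fls :: 'a::field fps \<Rightarrow> 'a fls)"
  by standard (auto simp: fls_times_fps_to_fls fps_to_fls_eq_iff)

lemma map_fps_to_fls_eq_iff:
  "map_poly fps_to_fls p = map_poly fps_to_fls (q :: 'a::field fps poly) \<longleftrightarrow> p = q"
  by (simp add: poly_eq_iff rhom.coeff_map[OF rhom_fps_to_fls])

lemma fps_to_fls_regpart: "fls_subdegree g \<ge> 0 \<Longrightarrow> fps_to_fls (fls_regpart g) = g"
  by (simp add: fls_regpart_to_fls_trivial)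

text \<open>Multiplication by \<open>X^n\<close>, where \<open>-n\<close> is the least order of a
  coefficient, makes all coefficients integral and at least one of them a unit.\<close>

lemma fls_poly_primitive:
  fixes h :: "'a::field fls poly"
  assumes "h \<noteq> 0"
  obtains n H where "smult (fls_X_intpow n) h = map_poly fps_to_fls H" "residue_poly H \<noteq> 0"
proof -
  define S where "S = (\<lambda>i. fls_subdegree (coeff h i)) ` {i. i \<le> degree h \<and> coeff h i \<noteq> 0}"
  have S: "finite S" "S \<noteq> {}"
    using assms by (auto simp: S_def intro!: exI[of _ "degree h"])
  define n where "n = - Min S"
  define H where "H = Poly (map (\<lambda>i. fls_regpart (fls_X_intpow n * coeff h i)) [0..<Suc (degree h)])"
  have sub: "fls_subdegree (fls_X_intpow n * coeff h i) = n + fls_subdegree (coeff h i)"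
    if "coeff h i \<noteq> 0" for i
    using that by simp
  have nonneg: "fls_subdegree (fls_X_intpow n * coeff h i) \<ge> 0" for i
  proof (cases "coeff h i = 0")
    case False
    hence "fls_subdegree (coeff h i) \<in> S"
      by (auto simp: S_def le_degree)
    hence "Min S \<le> fls_subdegree (coeff h i)" using S by simp
    thus ?thesis using sub[OF False] by (simp add: n_def)
  qed auto
  have cH: "coeff H i = fls_regpart (fls_X_intpow n * coeff h i)" for i
    by (auto simp: H_def nth_default_def coeff_eq_0 simp del: upt_Suc)
  have 1: "smult (fls_X_intpow n) h = map_poly fps_to_fls H"
    by (rule poly_eqI)
      (simp add: rhom.coeff_map[OF rhom_fps_to_fls] cH fps_to_fls_regpart[OF nonneg])
  obtain i where i: "coeff h i \<noteq> 0" "fls_subdegree (coeff h i) = Min S"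
    using Min_in[OF S] by (auto simp: S_def)
  have "fls_subdegree (fls_X_intpow n * coeff h i) = 0"
    using sub[OF i(1)] i(2) by (simp add: n_def)
  moreover have "fls_X_intpow n * coeff h i \<noteq> 0" using i(1) by simp
  ultimately have "fls_nth (fls_X_intpow n * coeff h i) 0 \<noteq> 0"
    by (metis nth_fls_subdegree_nonzero)
  hence "coeff (residue_poly H) i \<noteq> 0"
    by (simp add: rhom.coeff_map[OF rhom_fps_nth_0] cH)
  hence "residue_poly H \<noteq> 0" by force
  with 1 show ?thesis by (rule that)
qed

text \<open>Gauss's lemma for the ring of power series. Scaled to be primitive, both factors have
  nonzero residues, and residues are multiplied in an integral domain; so the product is not
  divisible by \<open>X\<close>. Monic factors can only be scaled by nonnegative powers of
  \<open>X\<close>, hence by none.\<close>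

lemma monic_factors_integral:
  fixes g h :: "'a::field fls poly"
  assumes gh: "g * h = map_poly fps_to_fls P" and "lead_coeff g = 1" "lead_coeff h = 1"
  obtains G H where "g = map_poly fps_to_fls G" "h = map_poly fps_to_fls H" "G * H = P"
proof -
  have *: "\<exists>n\<ge>0. \<exists>H. smult (fls_X_intpow n) h = map_poly fps_to_fls H \<and> residue_poly H \<noteq> 0"
    if "lead_coeff h = 1" for h :: "'a fls poly"
  proof -
    have "h \<noteq> 0" using that by force
    then obtain n H where H: "smult (fls_X_intpow n) h = map_poly fps_to_fls H" "residue_poly H \<noteq> 0"
      using fls_poly_primitive by blast
    have "fls_X_intpow n = fps_to_fls (coeff H (degree h))"
      using arg_cong[OF H(1), of "\<lambda>p. coeff p (degree h)"] that
      by (simp add: rhom.coeff_map[OF rhom_fps_to_fls])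
    hence "fls_subdegree (fls_X_intpow n :: 'a fls) \<ge> 0"
      by (metis fls_subdegree_fls_to_fps_gt0)
    hence "n \<ge> 0" by simp
    thus ?thesis using H by blast
  qed
  obtain n H where H: "n \<ge> 0" "smult (fls_X_intpow n) h = map_poly fps_to_fls H" "residue_poly H \<noteq> 0"
    using *[OF assms(3)] by blast
  obtain m G where G: "m \<ge> 0" "smult (fls_X_intpow m) g = map_poly fps_to_fls G" "residue_poly G \<noteq> 0"
    using *[OF assms(2)] by blast
  interpret F: rhom "fps_to_fls :: 'a fps \<Rightarrow> 'a fls" by (rule rhom_fps_to_fls)
  interpret FP: rhom "map_poly (fps_to_fls :: 'a fps \<Rightarrow> 'a fls)" by (rule F.rhom_map_poly)
  interpret R: rhom "residue_poly :: 'a fps poly \<Rightarrow> 'a poly"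
    by (rule rhom.rhom_map_poly[OF rhom_fps_nth_0])
  define k where "k = nat (m + n)"
  have k: "fls_X_intpow m * fls_X_intpow n = (fps_to_fls (fps_X ^ k) :: 'a fls)"
    using G(1) H(1) by (simp only: fls_X_intpow_times_fls_X_intpow fps_to_fls_power fps_X_to_fls
        fls_X_power_conv_shift_1) (simp add: k_def)
  have "map_poly fps_to_fls (G * H) = smult (fls_X_intpow m * fls_X_intpow n) (g * h)"
    by (simp add: FP.mult flip: G(2) H(2)) (simp add: mult.commute)
  also have "\<dots> = map_poly fps_to_fls (smult (fps_X ^ k) P)"
    unfolding gh k by (rule poly_eqI) simp
  finally have GH: "G * H = smult (fps_X ^ k) P"
    by (simp only: map_fps_to_fls_eq_iff)
  have "k = 0"
  proof (rule ccontr)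
    assume "k \<noteq> 0"
    hence "residue_poly (smult (fps_X ^ k) P) = 0"
      by (intro poly_eqI) (simp add: rhom.coeff_map[OF rhom_fps_nth_0] fps_X_power_nth del: fps_X_power_iff)
    thus False using R.mult[of G H] G(3) H(3) by (simp add: GH)
  qed
  hence "m = 0" "n = 0" using G(1) H(1) by (auto simp: k_def)
  thus ?thesis using that G(2) H(2) GH \<open>k = 0\<close> by simp
qed

lemma irreducible_monicI:
  fixes p :: "'a::field poly"
  assumes "degree p > 0"
    and "\<And>g h. p = g * h \<Longrightarrow> lead_coeff g = 1 \<Longrightarrow> degree g > 0 \<Longrightarrow> degree h > 0 \<Longrightarrow> lead_coeff h = lead_coeff p \<Longrightarrow> False"
  shows "irreducible p"
proof (rule irreducibleI)
  show "p \<noteq> 0" using assms(1) by auto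
  thus "\<not> p dvd 1" using assms(1) by (auto simp: is_unit_iff_degree)
  fix a b assume ab: "p = a * b"
  show "a dvd 1 \<or> b dvd 1"
  proof (rule ccontr)
    assume n: "\<not> (a dvd 1 \<or> b dvd 1)"
    have ab0: "a \<noteq> 0" "b \<noteq> 0" using ab \<open>p \<noteq> 0\<close> by auto
    hence deg: "degree a > 0" "degree b > 0" using n by (auto simp: is_unit_iff_degree)
    define c where "c = lead_coeff a"
    have c: "c \<noteq> 0" using ab0 by (simp add: c_def)
    have "p = smult (inverse c) a * smult c b" using c ab by simp
    moreover have "lead_coeff (smult c b) = lead_coeff p"
      by (simp only: ab lead_coeff_mult lead_coeff_smult c_def)
    ultimately show False
      using assms(2)[of "smult (inverse c) a" "smult c b"] deg c by (simp add: c_def)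
  qed
qed

text \<open>The minimal polynomial of \<open>\<zeta>\<close> over the image of \<open>f\<close> has
  a preimage that divides \<open>p\<close> and \<open>h\<close>; it is not a unit, hence associated
  to the irreducible \<open>p\<close>. This lets irreducibility over a small field act on roots in a
  larger one.\<close>

lemma irreducible_dvd_if_common_root:
  fixes p h :: "'a::field poly" and f :: "'a \<Rightarrow> 'b::field"
  assumes f: "fhom f" and "irreducible p"
    and "poly (map_poly f p) \<zeta> = 0" "poly (map_poly f h) \<zeta> = 0"
  shows "p dvd h"
proof -
  interpret fhom f by fact
  interpret M: rhom "map_poly f" by (rule rhom_map_poly)
  have mem: "map_poly f q \<in> polys_over (range f)" for q
    by (simp add: polys_over_def)
  have lift: "\<exists>q'. q = map_poly f q'" if "q \<in> polys_over (range f)" for q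
  proof (intro exI poly_eqI)
    fix n
    have "coeff q n \<in> range f" using polys_overD[OF that] by simp
    thus "coeff q n = coeff (map_poly f (map_poly (inv_into UNIV f) q)) n"
      using inv_into_f_f[OF inj UNIV_I, of 0] by (simp add: coeff_map_poly f_inv_into_f)
  qed
  have "map_poly f p \<noteq> 0"
    using assms(2) by auto
  then obtain m where m: "m \<in> polys_over (range f)" "degree m > 0"
    "\<And>h. h \<in> polys_over (range f) \<Longrightarrow> poly h \<zeta> = 0 \<Longrightarrow> \<exists>q\<in>polys_over (range f). h = m * q"
    using minimal_polynomial[OF subfld_range[OF f] mem _ assms(3)] by metis
  obtain m' where m': "m = map_poly f m'" using lift[OF m(1)] by blast
  have dvd: "m' dvd q" if root: "poly (map_poly f q) \<zeta> = 0" for q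
  proof -
    obtain r where "r \<in> polys_over (range f)" "map_poly f q = m * r"
      using m(3)[OF mem root] by blast
    moreover then obtain r' where "r = map_poly f r'" using lift by blast
    ultimately have "map_poly f q = map_poly f (m' * r')" by (simp add: m')
    thus ?thesis by (simp only: map_eq_iff) simp
  qed
  obtain r where r: "p = m' * r" using dvd[OF assms(3)] by blast
  have "\<not> m' dvd 1"
    using m(2) m' by (cases "m' = 0") (auto simp: is_unit_iff_degree)
  hence "r dvd 1"
    using assms(2) r irreducibleD by blast
  hence "p dvd m'" by (simp add: r mult_unit_dvd_iff')
  thus ?thesis using dvd[OF assms(4)] by (rule dvd_trans)
qed

lemma prod_mset_power:
  "(\<Prod>x\<in>#A. f x) ^ d = (\<Prod>x\<in>#A. f x ^ d)" for f :: "'a \<Rightarrow> 'b::comm_monoid_mult"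
  by (induction A) (simp_all add: power_mult_distrib)

text \<open>Both factors would be monic and integral, and their residues would divide a power of the
  variable; so both constant terms would have positive order and their product order at least 2. The
  algebraically closed coefficient field provides a root of the residue of a factor, which must be
  0.\<close>

lemma eisenstein_fps:
  fixes e :: "'a::alg_closed_field fps poly"
  assumes monic: "lead_coeff e = 1" and "degree e > 0"
    and res: "residue_poly e = monom 1 (degree e)" and const: "coeff e 0 $ 1 \<noteq> 0"
  shows "irreducible (map_poly fps_to_fls e)"
proof -
  interpret F: rhom "fps_to_fls :: 'a fps \<Rightarrow> 'a fls" by (rule rhom_fps_to_fls)
  interpret R: rhom "residue_poly :: 'a fps poly \<Rightarrow> 'a poly"
    by (rule rhom.rhom_map_poly[OF rhom_fps_nth_0])
  have deg[simp]: "degree (map_poly fps_to_fls p) = degree p" for p :: "'a fps poly"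
    by (rule degree_map_poly) simp
  show ?thesis
  proof (rule irreducible_monicI)
    fix g h :: "'a fls poly"
    assume gh: "map_poly fps_to_fls e = g * h" and g: "lead_coeff g = 1" "degree g > 0" "degree h > 0"
      and lc: "lead_coeff h = lead_coeff (map_poly fps_to_fls e)"
    have "lead_coeff (map_poly fps_to_fls e) = 1" using monic by simp
    note h = trans[OF lc this]
    obtain G H where GH: "g = map_poly fps_to_fls G" "h = map_poly fps_to_fls H" "G * H = e"
      using monic_factors_integral[OF gh[symmetric] g(1) h] by blast
    have const0: "coeff P 0 $ 0 = 0"
      if "lead_coeff P = 1" "degree P > 0" "P * Q = e" for P Q :: "'a fps poly"
    proof -
      have "coeff (residue_poly P) (degree P) = 1"
        using that by (simp add: rhom.coeff_map[OF rhom_fps_nth_0])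
      hence "degree (residue_poly P) > 0"
        using that(2) le_degree[of "residue_poly P" "degree P"] by simp
      then obtain r where r: "poly (residue_poly P) r = 0"
        using alg_closed_imp_poly_has_root by blast
      hence "poly (residue_poly e) r = 0" by (simp flip: that(3) add: R.mult)
      hence "r = 0" unfolding res by (simp add: poly_monom)
      thus ?thesis using r by (simp add: poly_0_coeff_0 rhom.coeff_map[OF rhom_fps_nth_0])
    qed
    have "lead_coeff G = 1" "lead_coeff H = 1" "degree G > 0" "degree H > 0"
      using g h unfolding GH by auto
    hence "coeff G 0 $ 0 = 0" "coeff H 0 $ 0 = 0"
      using const0[of G H] const0[of H G] GH(3) by (auto simp: mult.commute)
    moreover have "coeff e 0 = coeff G 0 * coeff H 0"
      by (simp flip: GH(3) add: coeff_mult_0)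
    ultimately show False using const by (simp add: fps_mult_nth)
  qed (use assms in auto)
qed

text \<open>A case of Dumas's criterion: for \<open>w = 1/s\<close> this is
  \<open>s Z^d + Z - 1\<close> made monic, and its Newton polygon is a single segment of slope
  \<open>-m/d\<close> in lowest terms. No valuation of the roots is used; their product over a
  factor is compared with powers of \<open>w\<close>.\<close>

lemma dumas_fps:
  fixes w :: "'a::field fps"
  assumes "d \<ge> 2" "subdegree w = m" "m > 0" "coprime d m"
  shows "irreducible (map_poly fps_to_fls (monom 1 d + monom w 1 - [:w:]))"
proof -
  define q where "q = monom 1 d + monom w 1 - [:w:]"
  have cq: "coeff q n = (if n = d then 1 else 0) + (if n = 1 then w else 0) - (if n = 0 then w else 0)" for n
    by (auto simp: q_def coeff_pCons split: nat.splits)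
  have dq: "degree q = d"
  proof (rule antisym)
    show "degree q \<le> d" by (rule degree_le) (use assms in \<open>auto simp: cq\<close>)
    show "d \<le> degree q" by (rule le_degree) (use assms in \<open>auto simp: cq\<close>)
  qed
  have lq: "lead_coeff q = 1" using assms(1) unfolding dq by (simp add: cq)
  interpret F: rhom "fps_to_fls :: 'a fps \<Rightarrow> 'a fls" by (rule rhom_fps_to_fls)
  interpret T: fhom "to_ac :: 'a fls \<Rightarrow> 'a fls alg_closure" by (rule fhom_to_ac)
  interpret TM: rhom "map_poly (to_ac :: 'a fls \<Rightarrow> 'a fls alg_closure)" by (rule T.rhom_map_poly)
  have deg[simp]: "degree (map_poly fps_to_fls p) = degree p" for p :: "'a fps poly"
    by (rule degree_map_poly) simp
  have "irreducible (map_poly fps_to_fls q)"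
  proof (rule irreducible_monicI)
    fix g h :: "'a fls poly"
    assume gh: "map_poly fps_to_fls q = g * h" and g: "lead_coeff g = 1" "degree g > 0" "degree h > 0"
      and lc: "lead_coeff h = lead_coeff (map_poly fps_to_fls q)"
    have "lead_coeff (map_poly fps_to_fls q) = 1" using lq by simp
    note h = trans[OF lc this]
    obtain G H where GH: "g = map_poly fps_to_fls G" "h = map_poly fps_to_fls H" "G * H = q"
      using monic_factors_integral[OF gh[symmetric] g(1) h] by blast
    \<comment> \<open>The value of \<open>q\<close> at 1 is 1, so every integral factor takes a unit
      there.\<close>
    have "poly G 1 * poly H 1 = poly q 1"
      by (simp flip: GH(3))
    also have "\<dots> = 1" by (simp add: q_def poly_monom)
    finally have G1: "subdegree (poly G 1) = 0"
      by (metis add_is_0 mult_eq_0_iff one_neq_zero subdegree_1 subdegree_mult)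
    \<comment> \<open>With \<open>e = degree g\<close>, the equation \<open>x\<^sup>d = w (1 - x)\<close> of the roots of \<open>g\<close> multiplies up to
      \<open>g(0)\<^sup>d = \<plusminus> w\<^sup>e g(1)\<close>, and \<open>g(1)\<close> is a unit; hence \<open>d\<close> divides \<open>e m\<close>.\<close>
    define e where "e = degree G"
    have gne: "map_poly to_ac g \<noteq> 0" using g by auto
    obtain A where A: "size A = degree (map_poly to_ac g)"
      "map_poly to_ac g = smult (lead_coeff (map_poly to_ac g)) (\<Prod>x\<in>#A. [:- x, 1:])"
      using alg_closed_imp_factorization[OF gne] by blast
    have A': "map_poly to_ac g = (\<Prod>x\<in>#A. [:- x, 1:])" "size A = e"
      using A g(1) by (simp_all add: e_def GH(1))
    define \<omega> where "\<omega> = to_ac (fps_to_fls w)"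
    have root: "x ^ d = \<omega> * (1 - x)" if "x \<in># A" for x
    proof -
      have "poly (map_poly to_ac g) x = 0"
        using that unfolding A'(1) by (auto simp: poly_prod_mset prod_mset_zero_iff image_iff intro!: bexI[of _ x])
      hence "poly (map_poly to_ac (map_poly fps_to_fls q)) x = 0"
        unfolding gh by simp
      also have "map_poly to_ac (map_poly fps_to_fls q) = monom 1 d + monom \<omega> 1 - [:\<omega>:]"
        by (rule poly_eqI) (auto simp: cq \<omega>_def coeff_pCons split: nat.splits)
      finally show ?thesis by (simp add: poly_monom algebra_simps)
    qed
    have ev: "to_ac (fps_to_fls (poly G u)) = (\<Prod>x\<in>#A. to_ac (fps_to_fls u) - x)" for u
    proof -
      have "to_ac (fps_to_fls (poly G u)) = poly (map_poly to_ac g) (to_ac (fps_to_fls u))"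
        unfolding GH(1) by (simp add: T.poly_map F.poly_map)
      thus ?thesis by (simp add: A'(1) poly_prod_mset)
    qed
    have "to_ac (fps_to_fls (poly G 0 ^ d)) = (\<Prod>x\<in>#A. - x) ^ d"
      using ev[of 0] by (simp add: fps_to_fls_power)
    also have "\<dots> = (\<Prod>x\<in>#A. ((-1) ^ d * \<omega>) * (1 - x))"
    proof -
      have "(\<Prod>x\<in>#A. - x) ^ d = (\<Prod>x\<in>#A. (- x) ^ d)"
        by (rule prod_mset_power)
      also have "\<dots> = (\<Prod>x\<in>#A. ((-1) ^ d * \<omega>) * (1 - x))"
      proof (intro arg_cong[of _ _ prod_mset] image_mset_cong)
        fix x assume "x \<in># A"
        show "(- x) ^ d = (- 1) ^ d * \<omega> * (1 - x)"
          unfolding power_minus[of x d] root[OF \<open>x \<in># A\<close>] by (simp only: mult.assoc)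
      qed
      finally show ?thesis .
    qed
    also have "\<dots> = ((-1) ^ d * \<omega>) ^ e * (\<Prod>x\<in>#A. 1 - x)"
      by (simp add: prod_mset.distrib A'(2))
    also have "\<dots> = to_ac (fps_to_fls (((-1) ^ d * w) ^ e * poly G 1))"
      using ev[of 1] by (simp add: \<omega>_def fps_to_fls_power)
    finally have eq: "poly G 0 ^ d = ((-1) ^ d * w) ^ e * poly G 1"
      by (simp only: to_ac_eq_iff fps_to_fls_eq_iff)
    have w0: "w \<noteq> 0" using assms by auto
    have pG: "poly G 1 \<noteq> 0" using \<open>poly G 1 * poly H 1 = poly q 1\<close> \<open>poly q 1 = 1\<close> by auto
    have "subdegree (poly G 0 ^ d) = d * subdegree (poly G 0)"
      by (simp add: subdegree_power)
    moreover have "subdegree (((-1) ^ d * w) ^ e * poly G 1) = e * m"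
    proof -
      have "subdegree ((-1) ^ d * w) = m"
        using assms(2) w0 by (subst subdegree_mult) (auto simp: subdegree_power)
      thus ?thesis using w0 pG G1 by (simp add: subdegree_power)
    qed
    ultimately have "d * subdegree (poly G 0) = e * m" using eq by simp
    hence "d dvd e * m" by (metis dvd_triv_left)
    hence "d dvd e" using assms(4) by (simp add: coprime_dvd_mult_left_iff)
    moreover have "0 < e" "e < d"
    proof -
      have "q \<noteq> 0" using lq by force
      hence "degree q = degree G + degree H"
        using GH(3) by (auto simp: degree_mult_eq)
      thus "0 < e" "e < d" using g dq by (auto simp: e_def GH)
    qed
    ultimately show False by (auto dest: dvd_imp_le)
  qed (use assms dq in auto)
  thus ?thesis by (simp add: q_def)
qed

section \<open>Places of the rational function field\<close>

lemma fract_hom_exists: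
  fixes f :: "'a::idom \<Rightarrow> 'b::field"
  assumes f: "rhom f" and inj: "\<And>x. f x = 0 \<Longrightarrow> x = 0"
  obtains g where "fhom g" "\<And>a. g (to_fract a) = f a"
proof -
  interpret rhom f by fact
  have "\<forall>x :: 'a fract. \<exists>a b. x = Fract a b \<and> b \<noteq> 0" by (meson Fract_cases)
  then obtain n d where nd: "x = Fract (n x) (d x)" "d x \<noteq> 0" for x :: "'a fract" by metis
  define g where "g = (\<lambda>x. f (n x) / f (d x))"
  have g: "g (Fract a b) = f a / f b" if "b \<noteq> 0" for a b
  proof -
    have "Fract a b = Fract (n (Fract a b)) (d (Fract a b))" by (rule nd(1))
    hence "f (a * d (Fract a b)) = f (n (Fract a b) * b)"
      by (subst (asm) eq_fract) (use nd(2) that in auto)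
    moreover have "f b \<noteq> 0" "f (d (Fract a b)) \<noteq> 0" using inj that nd(2) by blast+
    ultimately show ?thesis by (simp add: g_def field_simps)
  qed
  have "fhom g"
  proof (unfold fhom_def, standard)
    show "g 1 = 1" using g[of 1 1] by (simp add: One_fract_def)
    fix x y :: "'a fract"
    obtain a b where x: "x = Fract a b" "b \<noteq> 0" by (cases x)
    obtain a' b' where y: "y = Fract a' b'" "b' \<noteq> 0" by (cases y)
    have nz: "f b \<noteq> 0" "f b' \<noteq> 0" using inj x y by blast+
    show "g (x + y) = g x + g y"
      using x y nz by (simp add: g field_simps)
    show "g (x * y) = g x * g y"
      using x y nz by (simp add: g)
  qed
  moreover have "g (to_fract a) = f a" for a
    using g[of 1 a] by (simp add: to_fract_def)
  ultimately show ?thesis using that by blast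
qed

lemma rhom_to_fract: "rhom (to_fract :: 'a::idom \<Rightarrow> 'a fract)"
  by standard (auto simp: to_fract_def One_fract_def)

text \<open>Taylor expansion at \<open>T = c\<close>. The point is taken in the algebraic closure of
  \<open>k\<close>, so that every nonconstant polynomial has a zero to expand at.\<close>

definition expand_at :: "'k::field alg_closure \<Rightarrow> 'k poly \<Rightarrow> 'k alg_closure fps" where
  "expand_at c p = fps_of_poly (pcompose (map_poly to_ac p) [:c, 1:])"

lemma rhom_expand_at: "rhom (expand_at c)"
proof -
  interpret M: rhom "map_poly (to_ac :: 'a::field \<Rightarrow> _)" by (rule rhom.rhom_map_poly[OF rhom_to_ac])
  show ?thesis
    by standard (simp_all add: expand_at_def M.one M.add M.mult pcompose_add pcompose_mult
        fps_of_poly_add fps_of_poly_mult pcompose_1)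
qed

lemma expand_at_eq_0_iff [simp]: "expand_at c p = 0 \<longleftrightarrow> p = 0"
  using fhom.map_eq_0_iff[OF fhom_to_ac, of p]
  by (auto simp: expand_at_def pcompose_eq_0_iff)

lemma expand_at_nth_0: "expand_at c p $ 0 = poly (map_poly to_ac p) c"
  by (simp add: expand_at_def poly_pcompose flip: poly_0_coeff_0)

lemma expand_at_nth_1: "expand_at c p $ 1 = poly (map_poly to_ac (pderiv p)) c"
proof -
  define q where "q = pcompose (map_poly to_ac p) [:c, 1:]"
  have "coeff q 1 = poly (pderiv q) 0" by (simp add: poly_0_coeff_0 coeff_pderiv)
  also have "\<dots> = poly (pderiv (map_poly to_ac p)) c"
    by (simp add: q_def pderiv_pcompose poly_pcompose pderiv_pCons)
  finally show ?thesis
    by (simp add: expand_at_def q_def rhom.map_pderiv[OF rhom_to_ac])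
qed

lemma expand_at_const [simp]: "expand_at c [:a:] = fps_const (to_ac a)"
  by (simp add: expand_at_def map_poly_pCons fps_of_poly_const)

text \<open>
  A place of the algebraic closure of \<open>k(T)\<close> above \<open>T = c\<close> is presented as an embedding into the
  algebraic closure of the Laurent series field over the algebraic closure of \<open>k\<close>, with
  \<open>T \<mapsto> c + t\<close>.
\<close>

definition place :: "'k::field alg_closure \<Rightarrow>
    ('k poly fract alg_closure \<Rightarrow> 'k alg_closure fls alg_closure) \<Rightarrow> bool" where
  "place c \<iota> \<longleftrightarrow> fhom \<iota> \<and> (\<forall>p. \<iota> (to_ac (to_fract p)) = to_ac (fps_to_fls (expand_at c p)))"

lemma base_algebraic:
  "\<exists>p\<in>polys_over (range to_ac). p \<noteq> 0 \<and> poly p (x :: 'f::field alg_closure) = 0"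
proof -
  obtain p :: "'f poly" where "p \<noteq> 0" "poly (map_poly to_ac p) x = 0"
    by (rule alg_closure_algebraic)
  thus ?thesis
    by (intro bexI[of _ "map_poly to_ac p"])
      (auto simp: polys_over_def coeff_map_poly fhom.map_eq_0_iff[OF fhom_to_ac])
qed

lemma over_base_algebraic:
  assumes "range to_ac \<subseteq> F"
  shows "\<exists>p\<in>polys_over F. p \<noteq> 0 \<and> poly p (x :: 'f::field alg_closure) = 0"
  using base_algebraic[of x] polys_over_mono[OF assms] by blast

lemma place_exists: "\<exists>\<iota>. place (c :: 'k::field alg_closure) \<iota>"
proof -
  interpret E: rhom "expand_at c" by (rule rhom_expand_at)
  interpret L: rhom "fps_to_fls :: 'k alg_closure fps \<Rightarrow> _" by (rule rhom_fps_to_fls)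
  obtain g where g: "fhom g" "\<And>a. g (to_fract a) = fps_to_fls (expand_at c a)"
  proof (rule fract_hom_exists)
    show "rhom (\<lambda>a. fps_to_fls (expand_at c a))" by standard simp_all
  qed auto
  interpret g: fhom g by fact
  \<comment> \<open>\<open>of_ac\<close> inverts \<open>to_ac\<close> on the base field; the values
    of \<open>f\<close> elsewhere do not matter.\<close>
  define f :: "'k poly fract alg_closure \<Rightarrow> 'k alg_closure fls alg_closure"
    where "f = (\<lambda>x. to_ac (g (of_ac x)))"
  have "hom_on (range to_ac) f"
    unfolding hom_on_def
  proof (intro conjI ballI)
    show "f 1 = 1" by (simp add: f_def)
    fix x y :: "'k poly fract alg_closure" assume "x \<in> range to_ac" "y \<in> range to_ac"
    then obtain a b where "x = to_ac a" "y = to_ac b" by blast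
    thus "f (x + y) = f x + f y" "f (x * y) = f x * f y"
      by (simp_all add: f_def flip: to_ac_add to_ac_mult del: to_ac_add to_ac_mult)
  qed
  then obtain \<iota> where \<iota>: "fhom \<iota>" "\<And>a. a \<in> range to_ac \<Longrightarrow> \<iota> a = f a"
    using hom_extend[OF subfld_range[OF fhom_to_ac] _ base_algebraic] by metis
  have "place c \<iota>"
    unfolding place_def using \<iota> by (simp add: f_def g)
  thus ?thesis by blast
qed

text \<open>Twisting by a conjugation gives another place above the same point; this is how a given
  root is brought into a prescribed position.\<close>

lemma place_comp:
  assumes "place c \<iota>" "fhom \<psi>" "\<And>a. \<psi> (to_ac a) = to_ac a"
  shows "place c (\<lambda>x. \<iota> (\<psi> x))"
  using assms fhom_comp[of \<psi> \<iota>] by (simp add: place_def)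

section \<open>Translation between \<open>ac_ring\<close> and the field operations\<close>

lemma ac_ring_simps:
  "carrier ac_ring = UNIV" "x \<oplus>\<^bsub>ac_ring\<^esub> y = x + y" "x \<otimes>\<^bsub>ac_ring\<^esub> y = x * y"
  "\<zero>\<^bsub>ac_ring\<^esub> = 0" "\<one>\<^bsub>ac_ring\<^esub> = 1"
  by (auto simp: ring_of_type_algebra_def)

lemma ring_ac_ring:
  "ring (ac_ring :: 'f::field alg_closure ring)" "cring (ac_ring :: 'f alg_closure ring)"
  "field (ac_ring :: 'f alg_closure ring)" "domain (ac_ring :: 'f alg_closure ring)"
proof -
  show "ring (ac_ring :: 'f alg_closure ring)" by (rule ring_from_type_algebra)
  show "cring (ac_ring :: 'f alg_closure ring)" by (rule cring_from_type_algebra)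
  show f: "field (ac_ring :: 'f alg_closure ring)" by (rule field_from_type_algebra)
  thus "domain (ac_ring :: 'f alg_closure ring)" by (simp add: field_def)
qed

lemma ac_ring_neg: "\<ominus>\<^bsub>ac_ring\<^esub> x = - (x :: 'f::field alg_closure)"
proof -
  interpret field "ac_ring :: 'f alg_closure ring" by (rule ring_ac_ring)
  show ?thesis using minus_equality[of "- x" x] by (simp add: ac_ring_simps)
qed

lemma ac_ring_inv: "x \<noteq> 0 \<Longrightarrow> inv\<^bsub>ac_ring\<^esub> x = inverse (x :: 'f::field alg_closure)"
proof -
  interpret field "ac_ring :: 'f alg_closure ring" by (rule ring_ac_ring)
  show "x \<noteq> 0 \<Longrightarrow> ?thesis" using comm_inv_char[of x "inverse x"] by (simp add: ac_ring_simps)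
qed

lemma subfield_ac_ring_iff: "subfield F ac_ring \<longleftrightarrow> subfld (F :: 'f::field alg_closure set)"
proof -
  interpret field "ac_ring :: 'f alg_closure ring" by (rule ring_ac_ring)
  show ?thesis
  proof
    assume F: "subfield F ac_ring"
    note sr = subringE[OF subfieldE(1)[OF F]]
    have "inverse x \<in> F" if "x \<in> F" for x
      using subfield_m_inv(1)[OF F, of x] that sr(2) ac_ring_inv[of x]
      by (cases "x = 0") (auto simp: ac_ring_simps)
    thus "subfld F"
      using sr unfolding subfld_def by (auto simp: ac_ring_simps ac_ring_neg)
  next
    assume F: "subfld F"
    have "subring F ac_ring"
      by (rule subringI) (use subfldD[OF F] in \<open>auto simp: ac_ring_simps ac_ring_neg\<close>)
    thus "subfield F ac_ring"
      by (rule subfieldI') (use subfldD[OF F] in \<open>auto simp: ac_ring_simps ac_ring_inv\<close>)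
  qed
qed

lemma ac_ring_pow: "x [^]\<^bsub>ac_ring\<^esub> (n::nat) = x ^ n" for x :: "'a::field alg_closure"
proof -
  interpret ring "ac_ring :: 'a alg_closure ring" by (rule ring_ac_ring)
  show ?thesis by (induction n) (auto simp: ac_ring_simps mult.commute)
qed

lemma ac_ring_eval: "ring.eval ac_ring p x = poly (Poly (rev p)) x" for x :: "'a::field alg_closure"
proof -
  interpret ring "ac_ring :: 'a alg_closure ring" by (rule ring_ac_ring)
  show ?thesis
    by (induction p) (auto simp: ac_ring_simps ac_ring_pow Poly_append poly_monom)
qed

text \<open>Polynomials in HOL-Algebra are coefficient lists with the leading coefficient first,
  hence \<open>rev\<close>; the coefficients are pulled back to \<open>k\<close> along the embedding
  \<open>c\<close>.\<close>

lemma constant_closure_polynomial: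
  assumes "x \<in> (constant_closure :: 'k::field poly fract alg_closure set)"
  obtains p where "p \<noteq> 0" "poly (map_poly (\<lambda>a :: 'k. to_ac (to_fract [:a:])) p) x = 0"
proof -
  interpret D: domain "ac_ring :: 'k poly fract alg_closure ring" by (rule ring_ac_ring)
  define c where "c = (\<lambda>a :: 'k. to_ac (to_fract [:a:]))"
  have "rhom (\<lambda>a :: 'k. [:a:])"
    by standard (simp_all add: one_pCons)
  hence "rhom c"
    unfolding c_def by (intro rhom_comp[OF _ rhom_to_ac] rhom_comp[OF _ rhom_to_fract])
  then interpret c: fhom c by (simp add: fhom_def)
  have cf: "constant_field = range c" by (simp add: constant_field_def c_def)
  have "subring constant_field (ac_ring :: 'k poly fract alg_closure ring)"
    unfolding cf using subfld_range[OF c.fhom_axioms] subfieldE(1) subfield_ac_ring_iff by blast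
  moreover have "D.algebraic constant_field x" using assms by (simp add: constant_closure_def)
  ultimately obtain p where p: "p \<in> carrier (constant_field[X]\<^bsub>ac_ring\<^esub>)" "p \<noteq> []"
    "D.eval p x = \<zero>\<^bsub>ac_ring\<^esub>"
    using D.algebraicE[of constant_field x] by (auto simp: over_def ac_ring_simps)
  have sub: "set p \<subseteq> range c" and hd: "hd p \<noteq> 0"
    using p(1,2) by (auto simp: univ_poly_def polynomial_def cf ac_ring_simps)
  define q where "q = map (inv_into UNIV c) p"
  have "map c q = map (\<lambda>x. x) p"
    unfolding q_def map_map by (intro map_cong) (use sub in \<open>auto simp: f_inv_into_f\<close>)
  hence pq: "p = map c q" by simp
  have map_Poly: "map_poly c (Poly xs) = Poly (map c xs)" for xs
    by (induction xs) auto
  have "poly (map_poly c (Poly (rev q))) x = 0"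
    using p(3) unfolding ac_ring_eval ac_ring_simps map_Poly by (simp add: pq rev_map)
  moreover have "Poly (rev q) \<noteq> 0"
  proof
    assume "Poly (rev q) = 0"
    hence "Poly (rev p) = 0" using map_Poly[of "rev q"] by (simp add: pq rev_map)
    then obtain n where "rev p = replicate n 0" by (auto simp: Poly_eq_0)
    hence "p = replicate n 0" by (metis rev_replicate rev_rev_ident)
    thus False using hd p(2) by (cases n) auto
  qed
  ultimately show ?thesis using that by (simp add: c_def)
qed

section \<open>Separable elements\<close>

lemma double_root_dvd:
  fixes p :: "'a::field poly"
  assumes "poly p a = 0" "poly (pderiv p) a = 0"
  shows "[:- a, 1:] ^ 2 dvd p"
proof -
  obtain q where q: "p = [:- a, 1:] * q" using assms(1) by (auto simp: poly_eq_0_iff_dvd)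
  have "poly q a = 0" using assms(2) by (simp add: q pderiv_mult pderiv_pCons del: mult_pCons_left)
  then obtain r where "q = [:- a, 1:] * r" by (auto simp: poly_eq_0_iff_dvd)
  hence "p = [:- a, 1:] ^ 2 * r" using q by (simp only: power2_eq_square mult.assoc)
  thus ?thesis by (metis dvd_triv_left)
qed

lemma rsquarefree_iff_simple_roots:
  fixes p :: "'a::field poly"
  shows "rsquarefree p \<longleftrightarrow> p \<noteq> 0 \<and> (\<forall>a. poly p a = 0 \<longrightarrow> poly (pderiv p) a \<noteq> 0)"
proof (cases "p = 0")
  case False
  have *: "order a p \<ge> 2 \<longleftrightarrow> poly p a = 0 \<and> poly (pderiv p) a = 0" for a
  proof
    assume "order a p \<ge> 2"
    hence "[:- a, 1:] ^ 2 dvd p" using order_divides by blast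
    then obtain q where "p = [:- a, 1:] ^ 2 * q" by blast
    hence "p = [:- a, 1:] * ([:- a, 1:] * q)"
      by (simp only: power2_eq_square mult.assoc)
    thus "poly p a = 0 \<and> poly (pderiv p) a = 0"
      by (simp add: pderiv_mult pderiv_pCons del: mult_pCons_left)
  next
    assume "poly p a = 0 \<and> poly (pderiv p) a = 0"
    hence "[:- a, 1:] ^ 2 dvd p" using double_root_dvd by blast
    thus "order a p \<ge> 2" using order_divides False by blast
  qed
  have "order a p = 0 \<or> order a p = 1 \<longleftrightarrow> \<not> order a p \<ge> 2" for a by linarith
  thus ?thesis using False unfolding rsquarefree_def * by blast
qed (simp add: rsquarefree_def)

lemma card_roots_simple:
  fixes p :: "'a::alg_closed_field poly"
  assumes "p \<noteq> 0" "\<And>a. poly p a = 0 \<Longrightarrow> poly (pderiv p) a \<noteq> 0"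
  shows "card {a. poly p a = 0} = degree p"
  using assms
proof (induction "degree p" arbitrary: p)
  case 0
  then obtain c where "p = [:c:]" by (metis degree_eq_zeroE)
  thus ?case using 0 by simp
next
  case (Suc n)
  then obtain a where a: "poly p a = 0" using alg_closed_imp_poly_has_root[of p] by auto
  then obtain q where q: "p = [:- a, 1:] * q" by (auto simp: poly_eq_0_iff_dvd)
  have "q \<noteq> 0" using q Suc.prems by auto
  hence dq: "n = degree q" using Suc.hyps(2) by (simp add: q degree_mult_eq del: mult_pCons_left)
  have pd: "poly (pderiv p) x = poly q x + (x - a) * poly (pderiv q) x" for x
    by (simp add: q pderiv_mult pderiv_pCons del: mult_pCons_left)
  have "poly (pderiv q) x \<noteq> 0" if "poly q x = 0" for x
    using Suc.prems(2)[of x] that pd[of x] by (auto simp: q)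
  hence "card {x. poly q x = 0} = n" using Suc.hyps(1)[OF dq] \<open>q \<noteq> 0\<close> dq by simp
  moreover have "{x. poly p x = 0} = insert a {x. poly q x = 0}" by (auto simp: q)
  moreover have "poly q a \<noteq> 0" using Suc.prems(2)[OF a] pd[of a] by simp
  ultimately show ?case using Suc.hyps(2) poly_roots_finite[OF \<open>q \<noteq> 0\<close>] by simp
qed

text \<open>Conjugations are total endomorphisms of the algebraic closure over the base field, so
  composing and comparing them needs no domains. They are automatically bijective, by
  \<open>Khom_surj\<close>.\<close>

definition Khom :: "('f::field alg_closure \<Rightarrow> 'f alg_closure) \<Rightarrow> bool" where
  "Khom \<psi> \<longleftrightarrow> fhom \<psi> \<and> (\<forall>a. \<psi> (to_ac a) = to_ac a)"

lemma KhomD: "Khom \<psi> \<Longrightarrow> fhom \<psi>" "Khom \<psi> \<Longrightarrow> \<psi> (to_ac a) = to_ac a"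
  by (auto simp: Khom_def)

lemma Khom_id: "Khom (\<lambda>x. x)"
  by (simp add: Khom_def fhom_id)

lemma Khom_comp: "Khom \<phi> \<Longrightarrow> Khom \<psi> \<Longrightarrow> Khom (\<lambda>x. \<psi> (\<phi> x))"
  by (auto simp: Khom_def intro: fhom_comp)

lemma Khom_map_poly: "Khom \<psi> \<Longrightarrow> map_poly \<psi> (map_poly to_ac p) = map_poly to_ac p"
  by (rule poly_eqI) (simp add: coeff_map_poly KhomD fhom.axioms rhom.zero[OF fhom.axioms(1)])

lemma Khom_root:
  assumes "Khom \<psi>" "poly (map_poly to_ac p) x = 0"
  shows "poly (map_poly to_ac p) (\<psi> x) = 0"
proof -
  interpret fhom \<psi> using assms(1) by (rule KhomD)
  show ?thesis using poly_map[of "map_poly to_ac p" x] assms by (simp add: Khom_map_poly)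
qed

lemma Khom_conj:
  fixes x :: "'f::field alg_closure"
  assumes F: "subfld F" "range to_ac \<subseteq> F"
    and xy: "\<And>h. h \<in> polys_over F \<Longrightarrow> poly h x = 0 \<Longrightarrow> poly h y = 0"
  obtains \<psi> where "Khom \<psi>" "\<And>a. a \<in> F \<Longrightarrow> \<psi> a = a" "\<psi> x = y"
proof -
  have m: "map_poly (\<lambda>x. x) h = h" for h :: "'f alg_closure poly"
    by (simp add: poly_eq_iff coeff_map_poly)
  have xy': "poly (map_poly (\<lambda>x. x) h) y = 0" if "h \<in> polys_over F" "poly h x = 0" for h
    using xy[OF that] by (simp add: m)
  obtain \<psi> where \<psi>: "fhom \<psi>" "\<And>a. a \<in> F \<Longrightarrow> \<psi> a = a" "\<psi> x = y"
    using hom_extend_conj[OF F(1) fhom_hom_on[OF fhom_id] over_base_algebraic[OF F(2)] xy'] by metis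
  show ?thesis using that[of \<psi>] \<psi> F(2) unfolding Khom_def by blast
qed

lemma irreducible_conj:
  fixes p :: "'f::field poly"
  assumes "irreducible p" "poly (map_poly to_ac p) x = 0" "poly (map_poly to_ac p) y = 0"
  obtains \<psi> where "Khom \<psi>" "\<psi> x = y"
proof -
  have "poly h y = 0" if "h \<in> polys_over (range to_ac)" "poly h x = 0" for h
  proof -
    have "h = map_poly to_ac (map_poly of_ac h)"
    proof (rule poly_eqI)
      fix n
      have "coeff h n \<in> range to_ac" using polys_overD[OF that(1)] by simp
      thus "coeff h n = coeff (map_poly to_ac (map_poly of_ac h)) n"
        by (auto simp: coeff_map_poly)
    qed
    then obtain q where q: "h = map_poly to_ac q" by blast
    have "p dvd q"
      using irreducible_dvd_if_common_root[OF fhom_to_ac assms(1,2)] that(2) q by simp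
    then obtain r where "q = p * r" by blast
    thus ?thesis
      using assms(3) q by (simp add: rhom.mult[OF rhom.rhom_map_poly[OF rhom_to_ac]])
  qed
  thus ?thesis using Khom_conj[OF subfld_range[OF fhom_to_ac]] that by (metis subset_refl)
qed

lemma separable_elementE:
  fixes x :: "'f::field alg_closure"
  assumes "separable_element x"
  obtains p :: "'f poly" where "irreducible p" "poly (map_poly to_ac p) x = 0" "pderiv p \<noteq> 0"
    "\<And>y. poly (map_poly to_ac p) y = 0 \<Longrightarrow> poly (pderiv (map_poly to_ac p)) y \<noteq> 0"
proof -
  obtain p :: "'f poly" where p: "irreducible p" "poly (map_poly to_ac p) x = 0"
    "rsquarefree (map_poly to_ac p)"
    using assms by (auto simp: separable_element_def)
  have *: "\<And>y. poly (map_poly to_ac p) y = 0 \<Longrightarrow> poly (pderiv (map_poly to_ac p)) y \<noteq> 0"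
    using p(3) by (auto simp: rsquarefree_iff_simple_roots)
  have "pderiv p \<noteq> 0"
    using *[OF p(2)] rhom.map_pderiv[OF rhom_to_ac, of p] by auto
  thus ?thesis using that p * by blast
qed

lemma not_dvd_nonzero_pderiv:
  fixes p :: "'a::field poly"
  assumes "pderiv p \<noteq> 0"
  shows "\<not> p dvd pderiv p"
proof
  assume "p dvd pderiv p"
  hence "degree p \<le> degree (pderiv p)" using assms by (rule dvd_imp_degree_le)
  moreover have "degree (pderiv p) \<le> degree p - 1"
    by (rule degree_le) (auto simp: coeff_pderiv intro!: coeff_eq_0)
  ultimately have "degree p = 0" by linarith
  then obtain c where "p = [:c:]" by (metis degree_eq_zeroE)
  thus False using assms by (simp add: pderiv_pCons)
qed

lemma separable_elementI:
  fixes p :: "'f::field poly"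
  assumes p: "irreducible p" "poly (map_poly to_ac p) x = 0" "pderiv p \<noteq> 0"
  shows "separable_element x"
proof -
  have "poly (pderiv (map_poly to_ac p)) y \<noteq> 0" if y: "poly (map_poly to_ac p) y = 0" for y
  proof
    assume "poly (pderiv (map_poly to_ac p)) y = 0"
    hence "poly (map_poly to_ac (pderiv p)) y = 0" by (simp add: rhom.map_pderiv[OF rhom_to_ac])
    hence "p dvd pderiv p" by (rule irreducible_dvd_if_common_root[OF fhom_to_ac p(1) y])
    thus False using not_dvd_nonzero_pderiv[OF p(3)] by blast
  qed
  moreover have "map_poly to_ac p \<noteq> 0"
    using p(1) by (auto simp: fhom.map_eq_0_iff[OF fhom_to_ac])
  ultimately have "rsquarefree (map_poly to_ac p)"
    by (simp add: rsquarefree_iff_simple_roots)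
  thus ?thesis using p unfolding separable_element_def by blast
qed

section \<open>Reduction of separable minimal polynomials at a point\<close>

lemma clear_denominators:
  fixes p :: "'a::idom fract poly"
  obtains b P where "b \<noteq> 0" "smult (to_fract b) p = map_poly to_fract P"
proof -
  interpret R: rhom "to_fract :: 'a \<Rightarrow> _" by (rule rhom_to_fract)
  have "\<exists>b P. b \<noteq> 0 \<and> smult (to_fract b) p = map_poly to_fract P"
  proof (induction p)
    case 0
    show ?case by (intro exI[of _ 1] exI[of _ 0]) auto
  next
    case (pCons a p)
    then obtain b P where b: "b \<noteq> 0" "smult (to_fract b) p = map_poly to_fract P" by blast
    obtain n d where a: "a = Fract n d" "d \<noteq> 0" by (cases a)
    have "to_fract d * a = to_fract n"
      using a by (simp add: to_fract_def eq_fract)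
    hence "smult (to_fract (d * b)) (pCons a p) = pCons (to_fract (b * n)) (smult (to_fract d) (map_poly to_fract P))"
      by (simp add: algebra_simps flip: b(2))
    also have "\<dots> = map_poly to_fract (pCons (b * n) (smult d P))"
      by (rule poly_eqI) (auto simp: R.coeff_map coeff_pCons split: nat.splits)
    finally have "smult (to_fract (d * b)) (pCons a p) = \<dots>" .
    moreover have "d * b \<noteq> 0" using a b by simp
    ultimately show ?case by blast
  qed
  thus ?thesis using that by blast
qed

lemma irreducible_bezout:
  fixes p q :: "'a::field poly"
  assumes "irreducible p" "\<not> p dvd q"
  obtains a b where "a * p + b * q = 1"
proof -
  define P where "P = (\<lambda>r. r \<noteq> 0 \<and> (\<exists>a b. r = a * p + b * q))"
  define m where "m = (ARG_MIN degree r. P r)"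
  have "p \<noteq> 0" "p = 1 * p + 0 * q" using assms(1) by auto
  hence "P p" unfolding P_def by blast
  hence m: "P m" and min: "\<And>r. P r \<Longrightarrow> degree m \<le> degree r"
    unfolding m_def using arg_min_natI[of P p degree] arg_min_nat_le[of P _ degree] by auto
  obtain a b where ab: "m = a * p + b * q" and "m \<noteq> 0" using m by (auto simp: P_def)
  have dvd: "m dvd r" if r: "r = a' * p + b' * q" for r a' b'
  proof -
    have "r mod m = r - (r div m) * m" by (simp add: minus_div_mult_eq_mod)
    also have "\<dots> = (a' - (r div m) * a) * p + (b' - (r div m) * b) * q"
      by (subst (1) r) (simp add: ab algebra_simps)
    finally have "r mod m = 0 \<or> P (r mod m)" unfolding P_def by blast
    hence "r mod m = 0"
      using min[of "r mod m"] degree_mod_less[OF \<open>m \<noteq> 0\<close>, of r] by auto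
    thus ?thesis by (simp add: mod_eq_0_iff_dvd)
  qed
  have "m dvd p" "m dvd q" using dvd[of p 1 0] dvd[of q 0 1] by auto
  then obtain r where "p = m * r" by blast
  hence "m dvd 1 \<or> r dvd 1" using assms(1) irreducibleD by blast
  moreover have "\<not> r dvd 1"
    using assms(2) \<open>m dvd q\<close> \<open>p = m * r\<close> mult_unit_dvd_iff by blast
  ultimately obtain s where "1 = m * s" by blast
  hence "(s * a) * p + (s * b) * q = 1" by (simp add: ab algebra_simps)
  thus ?thesis by (rule that)
qed

abbreviation eval_at :: "'k::field alg_closure \<Rightarrow> 'k poly \<Rightarrow> 'k alg_closure" where
  "eval_at c p \<equiv> poly (map_poly to_ac p) c"

lemma rhom_eval_at: "rhom (eval_at c)"
proof -
  interpret rhom "map_poly (to_ac :: 'a::field \<Rightarrow> _)" by (rule rhom.rhom_map_poly[OF rhom_to_ac])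
  show ?thesis by standard auto
qed

text \<open>\<open>P\<close> is to be the minimal polynomial of \<open>x\<close> with denominators
  cleared, described by its roots; \<open>D\<close> plays the role of its discriminant times its
  leading coefficient. Away from the zeros of \<open>D\<close>, reducing the coefficients at
  \<open>T = c\<close> keeps the degree and the simplicity of the roots.\<close>

definition defining_pair :: "'k::field poly fract alg_closure \<Rightarrow> 'k poly poly \<Rightarrow> 'k poly \<Rightarrow> bool" where
  "defining_pair x P D \<longleftrightarrow> D \<noteq> 0 \<and> P \<noteq> 0 \<and>
     (\<forall>y. poly (map_poly (\<lambda>a. to_ac (to_fract a)) P) y = 0 \<longleftrightarrow> (\<exists>\<psi>. Khom \<psi> \<and> y = \<psi> x)) \<and>
     (\<forall>c. eval_at c D \<noteq> 0 \<longrightarrow> degree (map_poly (eval_at c) P) = degree P \<and>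
       (\<forall>a. poly (map_poly (eval_at c) P) a = 0 \<longrightarrow> poly (pderiv (map_poly (eval_at c) P)) a \<noteq> 0))"

text \<open>Clearing denominators in a Bezout identity between \<open>p\<close> and its derivative
  leaves an identity over \<open>k[T]\<close> with right-hand side \<open>D0\<close>. It survives
  evaluation at \<open>c\<close>, so a double root there forces \<open>D0(c) = 0\<close>.\<close>

lemma separable_defining_pair:
  fixes x :: "'k::field poly fract alg_closure"
  assumes "separable_element x"
  shows "\<exists>P D. defining_pair x P D"
proof -
  interpret R: rhom "to_fract :: 'k poly \<Rightarrow> _" by (rule rhom_to_fract)
  interpret RM: rhom "map_poly (to_fract :: 'k poly \<Rightarrow> _)" by (rule R.rhom_map_poly)
  interpret T: fhom "to_ac :: 'k poly fract \<Rightarrow> _" by (rule fhom_to_ac)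
  interpret TM: rhom "map_poly (to_ac :: 'k poly fract \<Rightarrow> _)" by (rule T.rhom_map_poly)
  obtain p where p: "irreducible p" "poly (map_poly to_ac p) x = 0" "pderiv p \<noteq> 0"
    using separable_elementE[OF assms] by metis
  obtain b0 P where P: "b0 \<noteq> 0" "smult (to_fract b0) p = map_poly to_fract P"
    by (rule clear_denominators)
  have "\<not> p dvd pderiv p" by (rule not_dvd_nonzero_pderiv[OF p(3)])
  then obtain a b where ab: "a * p + b * pderiv p = 1"
    using irreducible_bezout[OF p(1)] by blast
  obtain a1 A where A: "a1 \<noteq> 0" "smult (to_fract a1) a = map_poly to_fract A"
    by (rule clear_denominators)
  obtain b1 B where B: "b1 \<noteq> 0" "smult (to_fract b1) b = map_poly to_fract B"
    by (rule clear_denominators)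
  define D0 where "D0 = a1 * b1 * b0"
  have map_smult: "map_poly to_fract (smult c q) = smult (to_fract c) (map_poly to_fract q)" for c :: "'k poly" and q
    by (rule poly_eqI) simp
  have inj: "map_poly to_fract q = map_poly to_fract q' \<longleftrightarrow> q = q'" for q q' :: "'k poly poly"
    by (simp add: poly_eq_iff)
  have "map_poly to_fract (smult b1 A * P + smult a1 B * pderiv P) =
      smult (to_fract (a1 * b1 * b0)) (a * p + b * pderiv p)"
    by (simp add: R.map_pderiv map_smult pderiv_smult smult_add_right algebra_simps flip: A(2) B(2) P(2))
  also have "\<dots> = map_poly to_fract [:D0:]" unfolding ab by (simp add: D0_def)
  finally have bez: "smult b1 A * P + smult a1 B * pderiv P = [:D0:]" unfolding inj .
  have "P \<noteq> 0" using P p(1) by auto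
  have "D0 \<noteq> 0" using A B P by (simp add: D0_def)
  have roots: "poly (map_poly (\<lambda>a. to_ac (to_fract a)) P) y = 0 \<longleftrightarrow> poly (map_poly to_ac p) y = 0" for y
  proof -
    have "map_poly (\<lambda>a. to_ac (to_fract a)) P = map_poly to_ac (smult (to_fract b0) p)"
      unfolding P(2) by (rule poly_eqI) (simp add: coeff_map_poly)
    also have "\<dots> = smult (to_ac (to_fract b0)) (map_poly to_ac p)"
      by (rule poly_eqI) simp
    finally show ?thesis using P(1) by simp
  qed
  have "defining_pair x P (D0 * lead_coeff P)"
    unfolding defining_pair_def
  proof (intro conjI allI impI)
    show "D0 * lead_coeff P \<noteq> 0" "P \<noteq> 0" using \<open>P \<noteq> 0\<close> \<open>D0 \<noteq> 0\<close> by auto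
    show "poly (map_poly (\<lambda>a. to_ac (to_fract a)) P) y = 0 \<longleftrightarrow> (\<exists>\<psi>. Khom \<psi> \<and> y = \<psi> x)" for y
      unfolding roots using irreducible_conj[OF p(1,2)] Khom_root p(2) by metis
    fix c :: "'k alg_closure" assume c: "eval_at c (D0 * lead_coeff P) \<noteq> 0"
    interpret E: rhom "eval_at c" by (rule rhom_eval_at)
    interpret EM: rhom "map_poly (eval_at c)" by (rule E.rhom_map_poly)
    have c': "eval_at c D0 \<noteq> 0" "eval_at c (lead_coeff P) \<noteq> 0" using c by (auto simp: E.mult)
    show "degree (map_poly (eval_at c) P) = degree P"
      using c'(2) by (rule map_poly_degree_eq)
    fix r assume r: "poly (map_poly (eval_at c) P) r = 0"
    show "poly (pderiv (map_poly (eval_at c) P)) r \<noteq> 0"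
    proof
      assume "poly (pderiv (map_poly (eval_at c) P)) r = 0"
      hence "poly (map_poly (eval_at c) (smult b1 A * P + smult a1 B * pderiv P)) r = 0"
        using r by (simp add: E.map_pderiv del: mult_smult_left)
      thus False using c'(1) unfolding bez by simp
    qed
  qed
  thus ?thesis by blast
qed

text \<open>Hensel's lemma lifts each of the \<open>degree P\<close> simple roots of the residue
  polynomial; the lifts are distinct, so they exhaust the roots of \<open>P\<close> in any larger
  field.\<close>

lemma fps_polynomial_splits:
  fixes P :: "'a::alg_closed_field fps poly"
  assumes deg: "degree (residue_poly P) = degree P" and "P \<noteq> 0"
    and simple: "\<And>a. poly (residue_poly P) a = 0 \<Longrightarrow> poly (pderiv (residue_poly P)) a \<noteq> 0"
    and f: "rhom (f :: 'a fps \<Rightarrow> 'b::field)" and inj: "\<And>a. f a = 0 \<Longrightarrow> a = 0"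
    and y: "poly (map_poly f P) y = 0"
  obtains u where "y = f u" "poly P u = 0"
proof -
  interpret f: rhom f by fact
  have finj: "inj f" 
  proof (rule injI)
    fix a b assume "f a = f b"
    hence "f (a - b) = 0" by simp
    from inj[OF this] show "a = b" by simp
  qed
  have R: "residue_poly P \<noteq> 0"
  proof
    assume "residue_poly P = 0"
    hence 0: "degree P = 0" using deg by simp
    then obtain c where c: "P = [:c:]" by (metis degree_eq_zeroE)
    hence "poly (residue_poly P) 0 = 0" using \<open>residue_poly P = 0\<close> by simp
    thus False using simple[of 0] \<open>residue_poly P = 0\<close> by simp
  qed
  have "\<exists>u. poly P u = 0 \<and> u $ 0 = a" if "poly (residue_poly P) a = 0" for a
    using hensel[OF that simple[OF that]] by metis
  then obtain u where u: "\<And>a. poly (residue_poly P) a = 0 \<Longrightarrow> poly P (u a) = 0 \<and> u a $ 0 = a"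
    by metis
  define S where "S = {a. poly (residue_poly P) a = 0}"
  have "inj_on (\<lambda>a. f (u a)) S"
  proof (rule inj_onI)
    fix a b assume "a \<in> S" "b \<in> S" "f (u a) = f (u b)"
    hence "u a = u b" using finj by (simp add: inj_eq)
    thus "a = b" using u \<open>a \<in> S\<close> \<open>b \<in> S\<close> unfolding S_def by (metis mem_Collect_eq)
  qed
  hence "card ((\<lambda>a. f (u a)) ` S) = degree P"
    using card_roots_simple[OF R simple] deg by (simp add: card_image S_def)
  moreover have sub: "(\<lambda>a. f (u a)) ` S \<subseteq> {y. poly (map_poly f P) y = 0}"
    using u by (auto simp: S_def f.poly_map)
  moreover have fP: "map_poly f P \<noteq> 0"
  proof
    assume "map_poly f P = 0"
    hence "f (lead_coeff P) = 0" by (metis f.coeff_map coeff_0)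
    from inj[OF this] show False using \<open>P \<noteq> 0\<close> by simp
  qed
  hence "card {y. poly (map_poly f P) y = 0} \<le> degree (map_poly f P)"
    by (intro card_poly_roots_bound) 
  moreover have "degree (map_poly f P) \<le> degree P" by (rule map_poly_degree_leq)
  ultimately have "(\<lambda>a. f (u a)) ` S = {y. poly (map_poly f P) y = 0}"
    using poly_roots_finite[OF fP] card_mono[OF poly_roots_finite[OF fP] sub]
    by (intro card_subset_eq) auto
  then obtain a where "a \<in> S" "y = f (u a)" using y by blast
  thus ?thesis using that u unfolding S_def by blast
qed

section \<open>Generated fields and elements fixed by conjugations\<close>

definition adj :: "'f::field alg_closure set \<Rightarrow> 'f alg_closure set" where
  "adj S = \<Inter>{F. subfld F \<and> range to_ac \<subseteq> F \<and> S \<subseteq> F}"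

lemma adj_least: "subfld F \<Longrightarrow> range to_ac \<subseteq> F \<Longrightarrow> S \<subseteq> F \<Longrightarrow> adj S \<subseteq> F"
  by (auto simp: adj_def)

lemma base_subset_adj: "range to_ac \<subseteq> adj S"
  and subset_adj: "S \<subseteq> adj S"
  by (auto simp: adj_def)

lemma subfld_adj: "subfld (adj S)"
  unfolding subfld_def adj_def by (auto intro: subfldD)

lemma adj_mono: "S \<subseteq> S' \<Longrightarrow> adj S \<subseteq> adj S'"
  by (intro adj_least subfld_adj base_subset_adj) (use subset_adj in blast)

lemma hom_eq_on_adj:
  assumes "fhom f" "fhom g" "\<And>a. f (to_ac a) = g (to_ac a)" "\<And>s. s \<in> S \<Longrightarrow> f s = g s" "x \<in> adj S"
  shows "f x = g x"
proof -
  interpret f: fhom f by fact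
  interpret g: fhom g by fact
  have "subfld {x. f x = g x}"
    by (auto simp: subfld_def)
  hence "adj S \<subseteq> {x. f x = g x}"
    by (rule adj_least) (use assms in auto)
  thus ?thesis using assms(5) by blast
qed

lemma Khom_eq_on_adj:
  assumes "Khom f" "Khom g" "\<And>s. s \<in> S \<Longrightarrow> f s = g s" "x \<in> adj S"
  shows "f x = g x"
  using hom_eq_on_adj[of f g S x] assms by (auto simp: KhomD)

lemma Khom_adj_into:
  assumes "Khom \<psi>" "subfld F" "range to_ac \<subseteq> F" "\<And>s. s \<in> S \<Longrightarrow> \<psi> s \<in> F" "x \<in> adj S"
  shows "\<psi> x \<in> F"
proof -
  have "adj S \<subseteq> \<psi> -` F"
    using assms by (intro adj_least subfld_vimage) (auto simp: KhomD)
  thus ?thesis using assms(5) by blast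
qed

text \<open>A conjugation permutes the finite root set of any nonzero polynomial over the base
  field.\<close>

lemma Khom_surj:
  assumes "Khom \<psi>"
  shows "\<exists>x. \<psi> x = y"
proof -
  interpret fhom \<psi> using assms by (rule KhomD)
  obtain p where p: "p \<noteq> 0" "poly (map_poly to_ac p) y = 0" by (rule alg_closure_algebraic)
  define S where "S = {x. poly (map_poly to_ac p) x = 0}"
  have "finite S"
    using p(1) by (auto simp: S_def fhom.map_eq_0_iff[OF fhom_to_ac] intro!: poly_roots_finite)
  moreover have "\<psi> ` S \<subseteq> S" using Khom_root[OF assms] by (auto simp: S_def)
  moreover have "inj_on \<psi> S" using inj by (rule inj_on_subset) auto
  ultimately have "\<psi> ` S = S" by (simp add: endo_inj_surj)
  moreover have "y \<in> S" using p(2) by (simp add: S_def)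
  ultimately show ?thesis by (metis imageE)
qed

text \<open>The minimal polynomial over \<open>F\<close> divides \<open>h\<close>, so
  \<open>x\<close> is a simple root of it; as it has no other root, it is linear and its constant
  term is \<open>- x\<close>.\<close>

lemma mem_if_no_conj:
  fixes x :: "'a::alg_closed_field"
  assumes F: "subfld F" and h: "h \<in> polys_over F" "poly h x = 0" "poly (pderiv h) x \<noteq> 0"
    and only: "\<And>y. (\<And>g. g \<in> polys_over F \<Longrightarrow> poly g x = 0 \<Longrightarrow> poly g y = 0) \<Longrightarrow> y = x"
  shows "x \<in> F"
proof -
  have "h \<noteq> 0" using h(3) by auto
  then obtain m where m: "m \<in> polys_over F" "lead_coeff m = 1" "degree m > 0" "poly m x = 0"
    "\<And>g. g \<in> polys_over F \<Longrightarrow> poly g x = 0 \<Longrightarrow> \<exists>q\<in>polys_over F. g = m * q"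
    using minimal_polynomial[OF F h(1) _ h(2)] by blast
  have root: "y = x" if "poly m y = 0" for y
    using only[of y] m(5) that by fastforce
  obtain r where r: "h = m * r" using m(5)[OF h(1,2)] by blast
  obtain q where q: "m = [:- x, 1:] * q" using m(4) by (auto simp: poly_eq_0_iff_dvd)
  have "degree q = 0"
  proof (rule ccontr)
    assume "degree q \<noteq> 0"
    then obtain y where "poly q y = 0" using alg_closed_imp_poly_has_root[of q] by auto
    moreover from this have "y = x" by (intro root) (simp add: q)
    ultimately have "poly (pderiv m) x = 0"
      by (simp add: q pderiv_mult pderiv_pCons del: mult_pCons_left)
    hence "poly (pderiv h) x = 0"
      using m(4) by (simp add: r pderiv_mult)
    thus False using h(3) by blast
  qed
  then obtain c where c: "q = [:c:]" by (metis degree_eq_zeroE)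
  hence "c = 1" using m(2) by (auto simp: q split: if_splits)
  hence "coeff m 0 = - x" by (simp add: q c)
  hence "- x \<in> F" using polys_overD[OF m(1), of 0] by simp
  thus "x \<in> F" using subfldD(5)[OF F, of "- x"] by simp
qed

lemma Khom_fixed_imp_mem:
  assumes F: "subfld F" "range to_ac \<subseteq> F" and sep: "separable_element x"
    and fixed: "\<And>\<psi>. Khom \<psi> \<Longrightarrow> (\<And>a. a \<in> F \<Longrightarrow> \<psi> a = a) \<Longrightarrow> \<psi> x = x"
  shows "x \<in> F"
proof -
  obtain p where p: "irreducible p" "poly (map_poly to_ac p) x = 0"
    "\<And>y. poly (map_poly to_ac p) y = 0 \<Longrightarrow> poly (pderiv (map_poly to_ac p)) y \<noteq> 0"
    using separable_elementE[OF sep] by metis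
  have pF: "map_poly to_ac p \<in> polys_over F"
    using F(2) by (auto simp: polys_over_def coeff_map_poly)
  show ?thesis
  proof (rule mem_if_no_conj[OF F(1) pF p(2) p(3)[OF p(2)]])
    fix y assume "\<And>g. g \<in> polys_over F \<Longrightarrow> poly g x = 0 \<Longrightarrow> poly g y = 0"
    then obtain \<psi> where "Khom \<psi>" "\<And>a. a \<in> F \<Longrightarrow> \<psi> a = a" "\<psi> x = y"
      using Khom_conj[OF F] by metis
    thus "y = x" using fixed by metis
  qed
qed

section \<open>Unramified elements at a place\<close>

text \<open>
  No valuation is extended to the algebraic closure: an element is unramified at \<open>\<iota>\<close> iff its image
  is a Laurent series.
\<close>

definition unram :: "('k::field poly fract alg_closure \<Rightarrow> 'k alg_closure fls alg_closure) \<Rightarrow>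
    'k poly fract alg_closure set" where
  "unram \<iota> = \<iota> -` range to_ac"

lemma subfld_unram: "place c \<iota> \<Longrightarrow> subfld (unram \<iota>)"
  unfolding unram_def place_def by (intro subfld_vimage subfld_range fhom_to_ac) auto

lemma place_hom: "place c \<iota> \<Longrightarrow> fhom \<iota>"
  and place_poly: "place c \<iota> \<Longrightarrow> \<iota> (to_ac (to_fract p)) = to_ac (fps_to_fls (expand_at c p))"
  by (auto simp: place_def)

lemma base_subset_unram:
  assumes "place c \<iota>"
  shows "range to_ac \<subseteq> unram \<iota>"
proof -
  have "to_ac a \<in> unram \<iota>" for a :: "'a poly fract"
  proof -
    obtain n d where "a = Fract n d" "d \<noteq> 0" by (cases a)
    hence "to_ac a = to_ac (to_fract n) / to_ac (to_fract d)"
      by (simp add: to_fract_def flip: to_ac_divide)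
    moreover have "to_ac (to_fract p) \<in> unram \<iota>" for p
      using place_poly[OF assms] by (auto simp: unram_def)
    ultimately show ?thesis using subfldD(8)[OF subfld_unram[OF assms]] by metis
  qed
  thus ?thesis by blast
qed

text \<open>A polynomial over \<open>k\<close> splits into linear factors over the coefficient field
  of the series, so the image of \<open>x\<close> is one of its constant roots.\<close>

lemma constant_closure_unram:
  fixes \<iota> :: "'k::field poly fract alg_closure \<Rightarrow> _"
  assumes "place c \<iota>"
  shows "constant_closure \<subseteq> unram \<iota>"
proof
  interpret fhom \<iota> using assms by (rule place_hom)
  fix x :: "'k poly fract alg_closure" assume "x \<in> constant_closure"
  then obtain p where p: "p \<noteq> 0" "poly (map_poly (\<lambda>a :: 'k. to_ac (to_fract [:a:])) p) x = 0"
    by (rule constant_closure_polynomial)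
  define q where "q = map_poly to_ac p"
  have "q \<noteq> 0" using p by (simp add: q_def fhom.map_eq_0_iff[OF fhom_to_ac])
  have "rhom (\<lambda>b :: 'k alg_closure. to_ac (fls_const b))"
    by standard (simp_all flip: fls_plus_const fls_const_mult_const)
  then interpret C: fhom "\<lambda>b :: 'k alg_closure. to_ac (fls_const b)" by (simp add: fhom_def)
  interpret CM: rhom "map_poly (\<lambda>b :: 'k alg_closure. to_ac (fls_const b))" by (rule C.rhom_map_poly)
  have "map_poly \<iota> (map_poly (\<lambda>a :: 'k. to_ac (to_fract [:a:])) p) = map_poly (\<lambda>b. to_ac (fls_const b)) q"
    by (rule poly_eqI) (simp add: q_def coeff_map_poly place_poly[OF assms] C.zero[simplified])
  hence root: "poly (map_poly (\<lambda>b. to_ac (fls_const b)) q) (\<iota> x) = 0"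
    using poly_map[of "map_poly (\<lambda>a :: 'k. to_ac (to_fract [:a:])) p" x] p(2) by simp
  obtain A where A: "q = smult (lead_coeff q) (\<Prod>r\<in>#A. [:- r, 1:])"
    using alg_closed_imp_factorization[OF \<open>q \<noteq> 0\<close>] by blast
  have "poly (map_poly (\<lambda>b. to_ac (fls_const b)) (\<Prod>r\<in>#A. [:- r, 1:])) y =
      (\<Prod>r\<in>#A. y - to_ac (fls_const r))" for y
    by (induction A) (simp_all add: CM.mult algebra_simps del: mult_pCons_left)
  moreover have "poly (map_poly (\<lambda>b. to_ac (fls_const b)) q) y =
      to_ac (fls_const (lead_coeff q)) * poly (map_poly (\<lambda>b. to_ac (fls_const b)) (\<Prod>r\<in>#A. [:- r, 1:])) y" for y
  proof -
    have "map_poly (\<lambda>b. to_ac (fls_const b)) q =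
        smult (to_ac (fls_const (lead_coeff q))) (map_poly (\<lambda>b. to_ac (fls_const b)) (\<Prod>r\<in>#A. [:- r, 1:]))"
      by (subst A, rule poly_eqI) (simp only: C.coeff_map coeff_smult C.mult)
    thus ?thesis by simp
  qed
  ultimately have "(\<Prod>r\<in>#A. \<iota> x - to_ac (fls_const r)) = 0"
    using root \<open>q \<noteq> 0\<close> by simp
  hence "\<exists>r. \<iota> x = to_ac (fls_const r)" by (auto simp: prod_mset_zero_iff)
  thus "x \<in> unram \<iota>" by (auto simp: unram_def)
qed

text \<open>\<open>p\<close> already splits in \<open>'a\<close>. At a place this brings roots found
  among the series back to the algebraic closure of \<open>k(T)\<close>.\<close>

lemma roots_lift:
  fixes p :: "'a::alg_closed_field poly" and f :: "'a \<Rightarrow> 'b::field"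
  assumes f: "fhom f" and "p \<noteq> 0" "poly (map_poly f p) y = 0"
  obtains x where "poly p x = 0" "y = f x"
proof -
  interpret fhom f by fact
  interpret M: rhom "map_poly f" by (rule rhom_map_poly)
  obtain A where A: "p = smult (lead_coeff p) (\<Prod>r\<in>#A. [:- r, 1:])"
    using alg_closed_imp_factorization[OF assms(2)] by blast
  have 1: "poly (map_poly f (\<Prod>r\<in>#A. [:- r, 1:])) y = (\<Prod>r\<in>#A. y - f r)" for y
    by (induction A) (simp_all add: M.mult algebra_simps del: mult_pCons_left)
  have "map_poly f p = smult (f (lead_coeff p)) (map_poly f (\<Prod>r\<in>#A. [:- r, 1:]))"
    by (subst A, rule poly_eqI) (simp only: coeff_map coeff_smult mult)
  hence "(\<Prod>r\<in>#A. y - f r) = 0" using assms(2,3) by (simp add: 1)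
  then obtain r where r: "r \<in># A" "y = f r" by (auto simp: prod_mset_zero_iff)
  have "poly p r = lead_coeff p * (\<Prod>s\<in>#A. r - s)"
    by (subst A) (simp add: poly_prod_mset)
  also have "(\<Prod>s\<in>#A. r - s) = 0" using r(1) by (auto simp: prod_mset_zero_iff)
  finally show ?thesis using that r by simp
qed

text \<open>Away from the zeros of \<open>D\<close> the reduction of \<open>P\<close> has simple
  roots only; so at every place above \<open>c\<close> the conjugates of \<open>\<theta>\<close>
  correspond to the power series roots of the expanded polynomial, in both directions.\<close>

lemma defining_pair_local:
  fixes P :: "'k::field poly poly"
  assumes pair: "defining_pair \<theta> P D" and c: "eval_at c D \<noteq> 0"
  shows "degree (residue_poly (map_poly (expand_at c) P)) = degree (map_poly (expand_at c) P)"
    "map_poly (expand_at c) P \<noteq> 0"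
    "\<And>a. poly (residue_poly (map_poly (expand_at c) P)) a = 0 \<Longrightarrow>
       poly (pderiv (residue_poly (map_poly (expand_at c) P))) a \<noteq> 0"
    "\<And>\<iota> y. place c \<iota> \<Longrightarrow> poly (map_poly (\<lambda>a. to_ac (to_fract a)) P) y = 0 \<Longrightarrow>
       \<exists>u. \<iota> y = to_ac (fps_to_fls u) \<and> poly (map_poly (expand_at c) P) u = 0"
    "\<And>\<iota> u. place c \<iota> \<Longrightarrow> poly (map_poly (expand_at c) P) u = 0 \<Longrightarrow>
       \<exists>y. poly (map_poly (\<lambda>a. to_ac (to_fract a)) P) y = 0 \<and> \<iota> y = to_ac (fps_to_fls u)"
proof -
  note PD = pair[unfolded defining_pair_def]
  interpret E: rhom "expand_at c" by (rule rhom_expand_at)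
  define Q where "Q = map_poly (expand_at c) P"
  have res: "residue_poly Q = map_poly (eval_at c) P"
    by (rule poly_eqI) (simp add: Q_def coeff_map_poly expand_at_nth_0)
  have cQ: "coeff Q n = 0 \<longleftrightarrow> coeff P n = 0" for n by (simp add: Q_def)
  hence dQ: "degree Q = degree P" unfolding degree_def by simp
  have Q0: "Q \<noteq> 0" using PD cQ by (auto simp: poly_eq_iff)
  show 1: "degree (residue_poly (map_poly (expand_at c) P)) = degree (map_poly (expand_at c) P)"
    unfolding Q_def[symmetric] res dQ using PD c by blast
  show 2: "map_poly (expand_at c) P \<noteq> 0" using Q0 by (simp add: Q_def)
  show 3: "poly (pderiv (residue_poly (map_poly (expand_at c) P))) a \<noteq> 0"
    if "poly (residue_poly (map_poly (expand_at c) P)) a = 0" for a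
    using that PD c unfolding Q_def[symmetric] res by blast
  have f: "rhom (\<lambda>u :: 'k alg_closure fps. to_ac (fps_to_fls u))"
    by (intro rhom_comp[OF rhom_fps_to_fls rhom_to_ac])
  then interpret f: rhom "\<lambda>u :: 'k alg_closure fps. to_ac (fps_to_fls u)" .
  fix \<iota> assume \<iota>: "place c \<iota>"
  interpret fhom \<iota> using \<iota> by (rule place_hom)
  have map: "map_poly \<iota> (map_poly (\<lambda>a. to_ac (to_fract a)) P) = map_poly (\<lambda>u. to_ac (fps_to_fls u)) Q"
    by (rule poly_eqI) (simp add: Q_def coeff_map_poly place_poly[OF \<iota>])
  {
    fix y assume "poly (map_poly (\<lambda>a. to_ac (to_fract a)) P) y = 0"
    hence root: "poly (map_poly (\<lambda>u. to_ac (fps_to_fls u)) Q) (\<iota> y) = 0"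
      unfolding map[symmetric] poly_map by simp
    show "\<exists>u. \<iota> y = to_ac (fps_to_fls u) \<and> poly (map_poly (expand_at c) P) u = 0"
      using fps_polynomial_splits[OF 1 2 3 f _ root[unfolded Q_def]] by auto
  next
    fix u assume "poly (map_poly (expand_at c) P) u = 0"
    hence "poly (map_poly (\<lambda>u. to_ac (fps_to_fls u)) Q) (to_ac (fps_to_fls u)) = 0"
      unfolding f.poly_map by (simp add: Q_def)
    hence "poly (map_poly \<iota> (map_poly (\<lambda>a. to_ac (to_fract a)) P)) (to_ac (fps_to_fls u)) = 0"
      unfolding map .
    moreover have "map_poly (\<lambda>a. to_ac (to_fract a)) P \<noteq> (0 :: 'k poly fract alg_closure poly)"
      using PD by (auto simp: poly_eq_iff coeff_map_poly)
    ultimately show "\<exists>y. poly (map_poly (\<lambda>a. to_ac (to_fract a)) P) y = 0 \<and> \<iota> y = to_ac (fps_to_fls u)"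
      using roots_lift[OF fhom_axioms] by metis
  }
qed

lemma separable_unram:
  fixes x :: "'k::field poly fract alg_closure"
  assumes "separable_element x"
  obtains D :: "'k poly" where "D \<noteq> 0" "\<And>c \<iota>. place c \<iota> \<Longrightarrow> eval_at c D \<noteq> 0 \<Longrightarrow> x \<in> unram \<iota>"
proof -
  obtain P D where pair: "defining_pair x P D"
    using separable_defining_pair[OF assms] by blast
  hence D: "D \<noteq> 0" and root: "poly (map_poly (\<lambda>a. to_ac (to_fract a)) P) x = 0"
    unfolding defining_pair_def using Khom_id by blast+
  have "x \<in> unram \<iota>" if \<iota>: "place c \<iota>" and c: "eval_at c D \<noteq> 0" for c \<iota>
  proof -
    obtain u where "\<iota> x = to_ac (fps_to_fls u)"
      using defining_pair_local(4)[OF pair c \<iota> root] by blast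
    thus ?thesis by (simp add: unram_def)
  qed
  thus ?thesis using that D by blast
qed

text \<open>Generators suffice, since \<open>unram \<iota>\<close> is a field; the product of their
  exceptional polynomials serves all of them.\<close>

lemma finite_separable_unram:
  fixes S :: "'k::field poly fract alg_closure set"
  assumes "finite S" "\<And>x. x \<in> S \<Longrightarrow> separable_element x"
  shows "\<exists>D :: 'k poly. D \<noteq> 0 \<and> (\<forall>c \<iota>. place c \<iota> \<longrightarrow> eval_at c D \<noteq> 0 \<longrightarrow> adj S \<subseteq> unram \<iota>)"
proof -
  have "\<exists>D :: 'k poly. D \<noteq> 0 \<and> (\<forall>c \<iota>. place c \<iota> \<longrightarrow> eval_at c D \<noteq> 0 \<longrightarrow> S \<subseteq> unram \<iota>)"
    using assms
  proof (induction S rule: finite_induct)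
    case empty
    show ?case by (intro exI[of _ 1]) auto
  next
    case (insert x S)
    then obtain D :: "'k poly" where D: "D \<noteq> 0"
      "\<And>c \<iota>. place c \<iota> \<Longrightarrow> eval_at c D \<noteq> 0 \<Longrightarrow> S \<subseteq> unram \<iota>" by auto
    obtain D' where D': "D' \<noteq> 0" "\<And>c \<iota>. place c \<iota> \<Longrightarrow> eval_at c D' \<noteq> 0 \<Longrightarrow> x \<in> unram \<iota>"
      using separable_unram[of x] insert.prems by blast
    show ?case
    proof (intro exI[of _ "D * D'"] conjI allI impI)
      show "D * D' \<noteq> 0" using D D' by simp
      fix c \<iota> assume "place c \<iota>" "eval_at c (D * D') \<noteq> 0"
      thus "insert x S \<subseteq> unram \<iota>"
        using D(2)[of c \<iota>] D'(2)[of c \<iota>] by (simp add: rhom.mult[OF rhom_eval_at])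
    qed
  qed
  thus ?thesis using adj_least subfld_unram base_subset_unram by metis
qed

text \<open>If \<open>F\<close> consists of Laurent series at \<open>\<iota>\<close>, a relation of
  \<open>x\<close> over \<open>F\<close> becomes a polynomial over the Laurent series field with the
  root \<open>\<iota> x\<close>. It is a multiple of \<open>q\<close>, hence vanishes at
  \<open>\<iota> y\<close>. So irreducibility at one place yields conjugacy over all of
  \<open>F\<close>.\<close>

lemma place_conj:
  fixes x y :: "'k::field poly fract alg_closure"
  assumes \<iota>: "place c \<iota>" and F: "subfld F" "range to_ac \<subseteq> F" "F \<subseteq> unram \<iota>"
    and q: "irreducible q" "poly (map_poly to_ac q) (\<iota> x) = 0" "poly (map_poly to_ac q) (\<iota> y) = 0"
  obtains \<psi> where "Khom \<psi>" "\<And>a. a \<in> F \<Longrightarrow> \<psi> a = a" "\<psi> x = y"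
proof -
  interpret fhom \<iota> using \<iota> by (rule place_hom)
  have "poly h y = 0" if h: "h \<in> polys_over F" "poly h x = 0" for h
  proof -
    have "\<iota> (coeff h n) \<in> range to_ac" for n
      using polys_overD[OF h(1)] F(3) by (auto simp: unram_def)
    hence eq: "map_poly \<iota> h = map_poly to_ac (map_poly of_ac (map_poly \<iota> h))"
      by (intro poly_eqI) (simp add: coeff_map_poly to_ac_of_ac)
    define h' where "h' = map_poly of_ac (map_poly \<iota> h)"
    have "poly (map_poly \<iota> h) (\<iota> x) = 0" using h(2) by (simp add: poly_map)
    hence "q dvd h'"
      using irreducible_dvd_if_common_root[OF fhom_to_ac q(1,2), of h'] eq unfolding h'_def by metis
    then obtain r where "h' = q * r" by blast
    hence "poly (map_poly to_ac h') (\<iota> y) = 0"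
      using q(3) by (simp add: rhom.mult[OF rhom.rhom_map_poly[OF rhom_to_ac]])
    hence "poly (map_poly \<iota> h) (\<iota> y) = 0" using eq unfolding h'_def by metis
    thus ?thesis by (simp add: poly_map)
  qed
  thus ?thesis using Khom_conj[OF F(1,2)] that by metis
qed

lemma eval_at_root_exists:
  assumes "degree p > 0"
  shows "\<exists>c. eval_at c p = 0"
  using assms alg_closed_imp_poly_has_root[of "map_poly to_ac p"]
  by (simp add: fhom.degree_map[OF fhom_to_ac])

text \<open>In characteristic 0 the field \<open>k\<close> is infinite and some \<open>T - a\<close>
  with \<open>D(a) \<noteq> 0\<close> works. In characteristic \<open>q > 0\<close> take
  \<open>p = 1 + D^q T\<close>: it equals 1 at the zeros of \<open>D\<close>, and its derivative is
  \<open>D^q\<close>, so that all its zeros are simple.\<close>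

lemma simple_zero_avoiding:
  fixes D :: "'k::field poly"
  assumes "D \<noteq> 0"
  obtains p c where "p \<noteq> 0" "eval_at c p = 0" "eval_at c (pderiv p) \<noteq> 0"
    "\<And>c'. eval_at c' D = 0 \<Longrightarrow> eval_at c' p \<noteq> 0"
proof (cases "CHAR('k) = 0")
  case True
  have "infinite (UNIV :: 'k set)"
  proof
    assume "finite (UNIV :: 'k set)"
    hence "CHAR('k) > 0" by (rule finite_imp_CHAR_pos)
    thus False using True by simp
  qed
  moreover have "finite {a. poly D a = 0}" using assms by (rule poly_roots_finite)
  ultimately obtain a where a: "poly D a \<noteq> 0"
    by (metis (mono_tags, lifting) UNIV_eq_I mem_Collect_eq)
  show ?thesis
  proof (rule that[of "[:- a, 1:]" "to_ac a"])
    show "eval_at (to_ac a) [:- a, 1:] = 0" "eval_at (to_ac a) (pderiv [:- a, 1:]) \<noteq> 0"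
      by (simp_all add: map_poly_pCons pderiv_pCons)
    fix c' assume "eval_at c' D = 0"
    moreover have "eval_at (to_ac a) D \<noteq> 0"
      using a by (simp add: rhom.poly_map[OF rhom_to_ac])
    ultimately have "c' \<noteq> to_ac a" by blast
    thus "eval_at c' [:- a, 1:] \<noteq> 0" by (simp add: map_poly_pCons)
  qed auto
next
  case False
  define q where "q = CHAR('k)"
  define p where "p = 1 + D ^ q * [:0, 1:]"
  have "q > 0" using False by (simp add: q_def)
  have "of_nat q = (0 :: 'k)" by (simp add: q_def)
  have nz: "D ^ q * [:0, 1:] \<noteq> 0" using assms by simp
  have dp: "pderiv p = D ^ q"
  proof -
    have "pderiv (D ^ q) = 0" by (simp add: pderiv_power \<open>of_nat q = 0\<close>)
    thus ?thesis by (simp add: p_def pderiv_add pderiv_mult pderiv_pCons del: mult_pCons_right)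
  qed
  have "degree (D ^ q * [:0, 1:]) > 0"
    using assms by (subst degree_mult_eq) auto
  hence "degree p > 0" unfolding p_def by (subst degree_add_eq_right) auto
  then obtain c where c: "eval_at c p = 0" using eval_at_root_exists by blast
  interpret E: rhom "eval_at c'" for c' :: "'k alg_closure" by (rule rhom_eval_at)
  have avoid: "eval_at c' p \<noteq> 0" if "eval_at c' D = 0" for c'
    using that \<open>q > 0\<close> by (simp only: p_def E.add E.mult E.power E.one) (simp add: power_0_left)
  show ?thesis
  proof (rule that[of p c])
    show "p \<noteq> 0" using \<open>degree p > 0\<close> by auto
    show "eval_at c (pderiv p) \<noteq> 0"
      using avoid[of c] c unfolding dp by (auto simp: E.power)
  qed (use c avoid in auto)
qed

section \<open>Symmetric extensions\<close>

text \<open>The recursion is \<open>a (Suc n) = a n * p\<close>, where \<open>p\<close> has a simple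
  zero at the new point \<open>d\<close>. At each older point \<open>a n\<close> has a simple zero
  and \<open>p\<close> is a unit; at \<open>d\<close> the earlier entries are distinct
  units.\<close>

lemma zero_sequence_exists:
  fixes D :: "'k::field poly"
  assumes "D \<noteq> 0"
  shows "\<exists>a :: nat \<Rightarrow> 'k poly. \<exists>c. (\<forall>i\<le>n. a i \<noteq> 0) \<and> (\<forall>j<n. eval_at (c j) D \<noteq> 0 \<and>
     (\<forall>i\<in>{1..j}. eval_at (c j) (a i) \<noteq> 0) \<and> inj_on (\<lambda>i. eval_at (c j) (a i)) {1..j} \<and>
     (\<forall>i\<in>{j<..n}. eval_at (c j) (a i) = 0 \<and> eval_at (c j) (pderiv (a i)) \<noteq> 0))"
proof (induction n)
  case 0
  \<comment> \<open>No condition at a point involves \<open>a 0\<close>; it starts the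
    recursion.\<close>
  show ?case by (intro exI[of _ "\<lambda>_. 1"]) auto
next
  case (Suc n)
  interpret E: rhom "eval_at c'" for c' :: "'k alg_closure" by (rule rhom_eval_at)
  obtain a :: "nat \<Rightarrow> 'k poly" and c where H: "(\<forall>i\<le>n. a i \<noteq> 0) \<and> (\<forall>j<n. eval_at (c j) D \<noteq> 0 \<and>
     (\<forall>i\<in>{1..j}. eval_at (c j) (a i) \<noteq> 0) \<and> inj_on (\<lambda>i. eval_at (c j) (a i)) {1..j} \<and>
     (\<forall>i\<in>{j<..n}. eval_at (c j) (a i) = 0 \<and> eval_at (c j) (pderiv (a i)) \<noteq> 0))"
    using Suc.IH by (elim exE)
  have a0: "\<And>i. i \<le> n \<Longrightarrow> a i \<noteq> 0"
    and D: "\<And>j. j < n \<Longrightarrow> eval_at (c j) D \<noteq> 0"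
    and nz: "\<And>i j. j < n \<Longrightarrow> i \<in> {1..j} \<Longrightarrow> eval_at (c j) (a i) \<noteq> 0"
    and inj: "\<And>j. j < n \<Longrightarrow> inj_on (\<lambda>i. eval_at (c j) (a i)) {1..j}"
    and z: "\<And>i j. j < n \<Longrightarrow> i \<in> {j<..n} \<Longrightarrow> eval_at (c j) (a i) = 0"
    and z': "\<And>i j. j < n \<Longrightarrow> i \<in> {j<..n} \<Longrightarrow> eval_at (c j) (pderiv (a i)) \<noteq> 0"
    using H by simp_all
  define B where "B = {(u, v). u \<in> {1..n} \<and> v \<in> {1..n} \<and> u < v}"
  have "B \<subseteq> {1..n} \<times> {1..n}" by (auto simp: B_def)
  hence B: "finite B" by (rule finite_subset) auto
  \<comment> \<open>Avoiding the zeros of \<open>J\<close> keeps the zeros of \<open>p\<close> off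
    the older points, where \<open>a n\<close> vanishes, and makes the earlier entries nonzero and
    distinct at \<open>d\<close>.\<close>
  define J where "J = D * (\<Prod>i\<le>n. a i) * (\<Prod>(u, v)\<in>B. a u - a v)"
  \<comment> \<open>At the point \<open>c u\<close> the former is a unit and the latter is
    zero.\<close>
  have "a u \<noteq> a v" if "(u, v) \<in> B" for u v
    using nz[of u u] z[of u v] that by (auto simp: B_def)
  hence "J \<noteq> 0" using assms a0 B by (auto simp: J_def)
  then obtain p d where p: "p \<noteq> 0" "eval_at d p = 0" "eval_at d (pderiv p) \<noteq> 0"
    and avoid: "\<And>c'. eval_at c' J = 0 \<Longrightarrow> eval_at c' p \<noteq> 0"
    using simple_zero_avoiding by blast
  have "eval_at d J \<noteq> 0" using avoid p(2) by blast
  hence dD: "eval_at d D \<noteq> 0" and da: "\<And>i. i \<le> n \<Longrightarrow> eval_at d (a i) \<noteq> 0"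
    and dB: "\<And>u v. (u, v) \<in> B \<Longrightarrow> eval_at d (a u) \<noteq> eval_at d (a v)"
    using B by (auto simp: J_def E.prod split: prod.splits)
  have pc: "eval_at (c j) p \<noteq> 0" if "j < n" for j
  proof (rule avoid)
    have "(\<Prod>i\<le>n. eval_at (c j) (a i)) = 0"
      using z[OF that, of n] that by (intro prod_zero) auto
    thus "eval_at (c j) J = 0" by (simp add: J_def E.prod)
  qed
  define a' where "a' = a(Suc n := a n * p)"
  define c' where "c' = c(n := d)"
  have aS: "a' (Suc n) = a n * p" and ai: "\<And>i. i \<le> n \<Longrightarrow> a' i = a i" by (auto simp: a'_def)
  show ?case
  proof (rule exI[of _ a'], rule exI[of _ c'], intro conjI allI impI)
    show "a' i \<noteq> 0" if "i \<le> Suc n" for i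
      using that a0 p(1) by (auto simp: a'_def)
    fix j assume j: "j < Suc n"
    consider "j < n" "c' j = c j" | "j = n" "c' j = d" using j by (auto simp: c'_def less_Suc_eq)
    note cs = this
    show "eval_at (c' j) D \<noteq> 0" using cs D dD by cases auto
    show "\<forall>i\<in>{1..j}. eval_at (c' j) (a' i) \<noteq> 0" using cs nz da j by cases (auto simp: ai)
    show "inj_on (\<lambda>i. eval_at (c' j) (a' i)) {1..j}"
      using cs
    proof cases
      case 1
      thus ?thesis using inj[of j] by (subst inj_on_cong[of _ _ "\<lambda>i. eval_at (c j) (a i)"]) (auto simp: ai)
    next
      case 2
      have "u = v" if "u \<in> {1..n}" "v \<in> {1..n}" "eval_at d (a u) = eval_at d (a v)" for u v
        using dB[of u v] dB[of v u] that by (cases u v rule: linorder_cases) (auto simp: B_def)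
      thus ?thesis using 2 by (auto simp: ai inj_on_def)
    qed
    show "\<forall>i\<in>{j<..Suc n}. eval_at (c' j) (a' i) = 0 \<and> eval_at (c' j) (pderiv (a' i)) \<noteq> 0"
    proof
      fix i assume i: "i \<in> {j<..Suc n}"
      show "eval_at (c' j) (a' i) = 0 \<and> eval_at (c' j) (pderiv (a' i)) \<noteq> 0"
        using cs
      proof cases
        case 1
        show ?thesis
        proof (cases "i = Suc n")
          case True
          thus ?thesis using 1 z[of j n] z'[of j n] pc[of j]
            by (simp add: aS pderiv_mult)
        qed (use i 1 z z' in \<open>auto simp: ai\<close>)
      next
        case 2
        hence "i = Suc n" using i by auto
        thus ?thesis using 2 p(2,3) da[of n] by (simp add: aS pderiv_mult)
      qed
    qed
  qed
qed

lemma irreducible_degree_1: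
  fixes p :: "'a::field poly"
  assumes "degree p = 1"
  shows "irreducible p"
proof (rule irreducible_monicI)
  fix g h assume "p = g * h" "degree g > 0" "degree h > 0"
  moreover from this have "g \<noteq> 0" "h \<noteq> 0" by auto
  ultimately show False using assms by (simp add: degree_mult_eq)
qed (use assms in auto)

lemma prod_linear_dvd:
  fixes p :: "'a::idom poly"
  assumes "finite A" "inj_on b A" "\<And>i. i \<in> A \<Longrightarrow> poly p (b i) = 0"
  shows "(\<Prod>i\<in>A. [:- b i, 1:]) dvd p"
  using assms
proof (induction A rule: finite_induct)
  case (insert x A)
  then obtain q where q: "p = (\<Prod>i\<in>A. [:- b i, 1:]) * q" by auto
  have "poly (\<Prod>i\<in>A. [:- b i, 1:]) (b x) \<noteq> 0"
    using insert by (auto simp: poly_prod inj_on_def)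
  hence "poly q (b x) = 0" using insert.prems(2)[of x] by (simp add: q)
  then obtain r where "q = [:- b x, 1:] * r" by (auto simp: poly_eq_0_iff_dvd)
  hence "p = (\<Prod>i\<in>insert x A. [:- b i, 1:]) * r"
    using insert by (simp add: q mult_ac del: mult_pCons_left mult_pCons_right)
  thus ?case by (metis dvd_triv_left)
qed auto

lemma degree_prod_linear: "degree (\<Prod>i\<in>A. [:- b i, 1:: 'a::idom:]) = card A"
  by (induction A rule: infinite_finite_induct) (auto simp: degree_mult_eq simp del: mult_pCons_left)

lemma lead_coeff_prod_linear: "lead_coeff (\<Prod>i\<in>A. [:- b i, 1:: 'a::idom:]) = 1"
  by (induction A rule: infinite_finite_induct) (simp_all add: lead_coeff_mult del: mult_pCons_left)

text \<open>
  At a place where \<open>b 1, \<dots>, b j\<close> are distinct units and the remaining \<open>b i\<close> have simple zeros,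
  the polynomial \<open>(X - b 1) \<cdots> (X - b n) + b n\<close> is the product of \<open>j\<close> linear factors and an
  Eisenstein polynomial.
\<close>

lemma local_factorization:
  fixes b :: "nat \<Rightarrow> 'a::alg_closed_field fps"
  assumes j: "j < n"
    and unit: "\<And>i. i \<in> {1..j} \<Longrightarrow> b i $ 0 \<noteq> 0" and inj: "inj_on (\<lambda>i. b i $ 0) {1..j}"
    and zero: "\<And>i. i \<in> {j<..n} \<Longrightarrow> b i $ 0 = 0" and simple: "b n $ 1 \<noteq> 0"
  defines "F \<equiv> (\<Prod>i\<in>{1..n}. [:- b i, 1:]) + [:b n:]"
  obtains r e where "F = (\<Prod>i\<in>{1..j}. [:- r i, 1:]) * e" "\<And>i. i \<in> {1..j} \<Longrightarrow> r i $ 0 = b i $ 0"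
    "lead_coeff e = 1" "degree e = n - j" "residue_poly e = monom 1 (n - j)"
    "irreducible (map_poly fps_to_fls e)"
proof -
  interpret N: rhom "\<lambda>f :: 'a fps. f $ 0" by (rule rhom_fps_nth_0)
  interpret R: rhom "residue_poly :: 'a fps poly \<Rightarrow> 'a poly" by (rule N.rhom_map_poly)
  have split: "{1..n} = {1..j} \<union> {j<..n}" "{1..j} \<inter> {j<..n} = {}" using j by auto
  have res_lin: "residue_poly (\<Prod>i\<in>A. [:- u i, 1:]) = (\<Prod>i\<in>A. [:- (u i $ 0), 1:])" for A and u :: "nat \<Rightarrow> 'a fps"
    by (simp add: R.prod)
  have bn: "b n $ 0 = 0" using zero[of n] j by simp
  have "residue_poly F = (\<Prod>i\<in>{1..n}. [:- (b i $ 0), 1:])"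
    unfolding F_def R.add res_lin by (simp add: bn)
  also have "\<dots> = (\<Prod>i\<in>{1..j}. [:- (b i $ 0), 1:]) * (\<Prod>i\<in>{j<..n}. [:- (b i $ 0), 1:])"
    unfolding split(1) using split(2) by (intro prod.union_disjoint) auto
  also have "(\<Prod>i\<in>{j<..n}. [:- (b i $ 0), 1:]) = (\<Prod>i\<in>{j<..n}. monom 1 1)"
    by (intro prod.cong) (auto simp: zero monom_altdef)
  also have "\<dots> = monom 1 (n - j)" by (simp add: monom_power)
  finally have resF: "residue_poly F = (\<Prod>i\<in>{1..j}. [:- (b i $ 0), 1:]) * monom 1 (n - j)" .
  have hens: "\<exists>u. poly F u = 0 \<and> u $ 0 = b i $ 0" if i: "i \<in> {1..j}" for i
  proof -
    define a where "a = b i $ 0"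
    define g where "g = (\<Prod>k\<in>{1..j} - {i}. [:- (b k $ 0), 1:]) * monom 1 (n - j)"
    have "(\<Prod>i\<in>{1..j}. [:- (b i $ 0), 1:]) = [:- a, 1:] * (\<Prod>k\<in>{1..j} - {i}. [:- (b k $ 0), 1:])"
      unfolding a_def using i by (intro prod.remove) auto
    hence resF': "residue_poly F = [:- a, 1:] * g" unfolding resF g_def by (simp only: mult.assoc)
    have "a - b k $ 0 \<noteq> 0" if "k \<in> {1..j} - {i}" for k
    proof
      assume "a - b k $ 0 = 0"
      hence "b i $ 0 = b k $ 0" by (simp add: a_def)
      hence "i = k" using inj_onD[OF inj, of i k] that i by blast
      thus False using that by blast
    qed
    hence "(\<Prod>k\<in>{1..j} - {i}. a - b k $ 0) \<noteq> 0" by (simp add: prod_zero_iff)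
    hence "poly g a \<noteq> 0"
      using unit[OF i] by (simp add: g_def poly_prod poly_monom flip: a_def)
    moreover have "poly (pderiv (residue_poly F)) a = poly g a"
      unfolding resF' by (simp add: pderiv_mult pderiv_pCons del: mult_pCons_left)
    moreover have "poly (residue_poly F) a = 0" unfolding resF' by simp
    ultimately show ?thesis using hensel[of F a] unfolding a_def by metis
  qed
  then obtain r where r: "\<And>i. i \<in> {1..j} \<Longrightarrow> poly F (r i) = 0 \<and> r i $ 0 = b i $ 0" by metis
  have "inj_on r {1..j}" using inj r unfolding inj_on_def by metis
  hence "(\<Prod>i\<in>{1..j}. [:- r i, 1:]) dvd F" using r by (intro prod_linear_dvd) auto
  then obtain e where e: "F = (\<Prod>i\<in>{1..j}. [:- r i, 1:]) * e" by blast
  have dF0: "degree (\<Prod>i\<in>{1..n}. [:- b i, 1:]) = n" by (simp add: degree_prod_linear)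
  have dF: "degree F = n"
    unfolding F_def using j dF0 by (subst degree_add_eq_left) auto
  have lF: "lead_coeff F = 1"
    using lead_coeff_prod_linear[of b "{1..n}"] j unfolding dF unfolding F_def dF0
    by (simp add: coeff_pCons split: nat.splits)
  have "lead_coeff F = lead_coeff (\<Prod>i\<in>{1..j}. [:- r i, 1:]) * lead_coeff e"
    unfolding e by (rule lead_coeff_mult)
  hence le: "lead_coeff e = 1" using lF by (simp add: lead_coeff_prod_linear)
  hence "e \<noteq> 0" by force
  have P0: "(\<Prod>i\<in>{1..j}. [:- r i, 1:]) \<noteq> 0" using lead_coeff_prod_linear[of r "{1..j}"] by force
  have "degree F = j + degree e"
    unfolding e using P0 \<open>e \<noteq> 0\<close> by (subst degree_mult_eq) (simp_all add: degree_prod_linear)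
  hence de: "degree e = n - j" using dF by simp
  have "(\<Prod>i\<in>{1..j}. [:- (b i $ 0), 1:]) * residue_poly e = residue_poly F"
    unfolding e R.mult res_lin using r by (intro arg_cong2[of _ _ _ _ "(*)"] prod.cong) auto
  hence "(\<Prod>i\<in>{1..j}. [:- (b i $ 0), 1:]) * residue_poly e =
      (\<Prod>i\<in>{1..j}. [:- (b i $ 0), 1:]) * monom 1 (n - j)" by (simp only: resF)
  moreover have "(\<Prod>i\<in>{1..j}. [:- (b i $ 0), 1:]) \<noteq> 0"
    using lead_coeff_prod_linear[of "\<lambda>i. b i $ 0" "{1..j}"] by force
  ultimately have re: "residue_poly e = monom 1 (n - j)" by (rule mult_left_cancel[THEN iffD1, rotated])
  have irr: "irreducible (map_poly fps_to_fls e)"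
  \<comment> \<open>If \<open>b n\<close> is the only vanishing entry, the two terms of
    \<open>F(0)\<close> may cancel to higher order; but then \<open>e\<close> is linear.\<close>
  proof (cases "n - j = 1")
    case True
    have "degree (map_poly fps_to_fls e) = 1" using de True by (simp add: degree_map_poly)
    thus ?thesis by (rule irreducible_degree_1)
  next
    case False
    hence nj: "n - j \<ge> 2" using j by simp
    have e00: "coeff e 0 $ 0 = 0"
      using arg_cong[OF re, of "\<lambda>p. coeff p 0"] nj by (simp add: N.coeff_map)
    \<comment> \<open>Two entries vanish, so the product has order at least 2 and the added
      \<open>b n\<close> contributes its simple zero.\<close>
    have "poly F 0 $ 1 \<noteq> 0"
    proof -
      have n1: "n \<in> {1..n}" "n - 1 \<in> {1..n} - {n}" using nj by auto
      have "(\<Prod>i\<in>{1..n}. - b i) = - b n * (- b (n - 1) * (\<Prod>i\<in>{1..n} - {n} - {n - 1}. - b i))"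
        using prod.remove[OF _ n1(1), of "\<lambda>i. - b i"] prod.remove[OF _ n1(2), of "\<lambda>i. - b i"] by simp
      moreover have "b (n - 1) $ 0 = 0" using zero[of "n - 1"] nj by simp
      ultimately have "(\<Prod>i\<in>{1..n}. - b i) $ 1 = 0"
        using bn by (simp only: fps_mult_nth_1 fps_mult_nth_0 fps_neg_nth) simp
      thus ?thesis using simple by (simp add: F_def poly_prod)
    qed
    also have "poly F 0 = (\<Prod>i\<in>{1..j}. - r i) * coeff e 0"
      unfolding poly_0_coeff_0[symmetric] by (simp add: e poly_prod)
    finally have "coeff e 0 $ 1 \<noteq> 0" using e00 by (auto simp: fps_mult_nth_1)
    thus ?thesis using eisenstein_fps[of e] le de re nj by simp
  qed
  show ?thesis using that e r le de re irr by blast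
qed

lemma irreducible_annihilator_exists:
  fixes x :: "'f::field alg_closure"
  obtains m :: "'f poly" where "irreducible m" "poly (map_poly to_ac m) x = 0"
proof -
  interpret T: fhom "to_ac :: 'f \<Rightarrow> _" by (rule fhom_to_ac)
  interpret TM: rhom "map_poly (to_ac :: 'f \<Rightarrow> _)" by (rule T.rhom_map_poly)
  define P where "P = (\<lambda>q :: 'f poly. q \<noteq> 0 \<and> poly (map_poly to_ac q) x = 0)"
  define m where "m = (ARG_MIN degree q. P q)"
  obtain h :: "'f poly" where "h \<noteq> 0" "poly (map_poly to_ac h) x = 0" by (rule alg_closure_algebraic)
  hence "P h" by (simp add: P_def)
  hence m: "P m" and min: "\<And>q. P q \<Longrightarrow> degree m \<le> degree q"
    unfolding m_def using arg_min_natI[of P h degree] arg_min_nat_le[of P _ degree] by auto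
  have m0: "m \<noteq> 0" "poly (map_poly to_ac m) x = 0" using m by (auto simp: P_def)
  have "irreducible m"
  proof (rule irreducible_monicI)
    show "degree m > 0"
    proof (rule ccontr)
      assume "\<not> degree m > 0"
      then obtain c where "m = [:c:]" by (metis degree_eq_zeroE gr0I)
      thus False using m0 by simp
    qed
    fix g h assume gh: "m = g * h" "degree g > 0" "degree h > 0"
    hence "g \<noteq> 0" "h \<noteq> 0" by auto
    hence "degree g < degree m" "degree h < degree m" using gh by (auto simp: degree_mult_eq)
    hence "\<not> P g" "\<not> P h" using min by fastforce+
    moreover have "P g \<or> P h" using m0 \<open>g \<noteq> 0\<close> \<open>h \<noteq> 0\<close> by (auto simp: P_def gh(1))
    ultimately show False by blast
  qed
  thus ?thesis using m0(2) by (rule that)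
qed

lemma separable_if_simple_root:
  fixes h :: "'f::field poly"
  assumes "poly (map_poly to_ac h) x = 0" "poly (pderiv (map_poly to_ac h)) x \<noteq> 0"
  shows "separable_element x"
proof -
  interpret T: fhom "to_ac :: 'f \<Rightarrow> _" by (rule fhom_to_ac)
  interpret TM: rhom "map_poly (to_ac :: 'f \<Rightarrow> _)" by (rule T.rhom_map_poly)
  obtain m :: "'f poly" where m: "irreducible m" "poly (map_poly to_ac m) x = 0"
    by (rule irreducible_annihilator_exists)
  have "m dvd h" using irreducible_dvd_if_common_root[OF fhom_to_ac m assms(1)] .
  then obtain q where "h = m * q" by blast
  hence "poly (map_poly to_ac (pderiv m)) x \<noteq> 0"
    using assms(2) m(2) by (auto simp: pderiv_mult T.map_pderiv)
  hence "pderiv m \<noteq> 0" by auto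
  thus ?thesis using separable_elementI[OF m] by blast
qed

lemma simple_root_if_card_roots:
  fixes p :: "'a::field poly"
  assumes "p \<noteq> 0" "card {x. poly p x = 0} = degree p" "poly p a = 0"
  shows "poly (pderiv p) a \<noteq> 0"
proof
  assume "poly (pderiv p) a = 0"
  then obtain q where "p = [:- a, 1:] ^ 2 * q" using double_root_dvd[OF assms(3)] by blast
  hence q: "p = [:- a, 1:] * ([:- a, 1:] * q)" by (simp only: power2_eq_square mult.assoc)
  define r where "r = [:- a, 1:] * q"
  have "r \<noteq> 0" using q assms(1) unfolding r_def by force
  hence "degree p = Suc (degree r)"
    unfolding q r_def[symmetric] by (simp add: degree_mult_eq del: mult_pCons_left)
  moreover have "{x. poly p x = 0} = {x. poly r x = 0}"
    by (subst q) (auto simp: r_def)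
  moreover have "card {x. poly r x = 0} \<le> degree r"
    using \<open>r \<noteq> 0\<close> by (rule card_poly_roots_bound)
  ultimately show False using assms(2) by simp
qed

text \<open>Induction on the length. \<open>\<chi>1\<close> moves all but the last entry into place.
  Over \<open>F\<close> and \<open>ws\<close> the remaining roots are conjugate:
  \<open>\<chi>3\<close> carries \<open>ws\<close> to the set \<open>J\<close> of unramified roots,
  while all others are roots of one irreducible polynomial there. So \<open>\<chi>2\<close> moves
  the last entry without disturbing the rest.\<close>

lemma list_conj_by_places:
  fixes F :: "'k::field poly fract alg_closure set"
  assumes F: "subfld F" "range to_ac \<subseteq> F"
    and R: "finite R" "card R = n" "\<And>\<psi>. Khom \<psi> \<Longrightarrow> \<psi> ` R \<subseteq> R"
    and place: "\<And>j. j < n \<Longrightarrow> \<exists>c \<iota> J q. place c \<iota> \<and> J \<subseteq> R \<and> card J = j \<and> J \<subseteq> unram \<iota> \<and>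
        irreducible q \<and> (\<forall>x\<in>R - J. poly (map_poly to_ac q) (\<iota> x) = 0) \<and>
        (\<forall>\<psi>. Khom \<psi> \<longrightarrow> F \<subseteq> unram (\<lambda>x. \<iota> (\<psi> x)))"
    and "distinct us" "distinct vs" "set us \<subseteq> R" "set vs \<subseteq> R" "length us = length vs"
  shows "\<exists>\<chi>. Khom \<chi> \<and> (\<forall>a\<in>F. \<chi> a = a) \<and> map \<chi> us = vs"
  using assms(7-11)
proof (induction "length us" arbitrary: us vs)
  case 0
  thus ?case using Khom_id by (intro exI[of _ "\<lambda>x. x"]) auto
next
  case (Suc j)
  note ih = Suc.hyps(1)
  obtain us' u where us: "us = us' @ [u]" using Suc.hyps(2) by (cases us rule: rev_cases) auto
  obtain ws w where vs: "vs = ws @ [w]"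
    using Suc.hyps(2) Suc.prems(5) by (cases vs rule: rev_cases) auto
  have len: "length us' = j" "length ws = j" using Suc.prems(5) Suc.hyps(2) us vs by auto
  have dws: "distinct ws" "set ws \<subseteq> R" "card (set ws) = j" "w \<in> R" "w \<notin> set ws"
    using Suc.prems(2,4) len vs by (auto simp: distinct_card)
  have dus: "distinct us'" "set us' \<subseteq> R" "u \<in> R" "u \<notin> set us'"
    using Suc.prems(1,3) us by auto
  obtain \<chi>1 where \<chi>1: "Khom \<chi>1" "\<And>a. a \<in> F \<Longrightarrow> \<chi>1 a = a" "map \<chi>1 us' = ws"
    using ih[of us' ws] dus dws len by auto
  have "card (insert w (set ws)) \<le> card R"
    using dws R(1) by (intro card_mono) auto
  hence "j < n" using dws R(2) by simp
  then obtain c \<iota>0 J q where pl: "place c \<iota>0" "J \<subseteq> R" "card J = j" "J \<subseteq> unram \<iota>0"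
    "irreducible q" "\<And>x. x \<in> R - J \<Longrightarrow> poly (map_poly to_ac q) (\<iota>0 x) = 0"
    "\<And>\<psi>. Khom \<psi> \<Longrightarrow> F \<subseteq> unram (\<lambda>x. \<iota>0 (\<psi> x))"
    using place[of j] by blast
  have "finite J" using pl(2) R(1) finite_subset by blast
  then obtain xs where xs: "set xs = J" "distinct xs" using finite_distinct_list by blast
  have lxs: "length xs = j" using xs pl(3) distinct_card by fastforce
  obtain \<chi>3 where "Khom \<chi>3" "map \<chi>3 ws = xs"
    using ih[of ws xs] dws len xs lxs pl(2) by auto
  hence \<chi>3: "Khom \<chi>3" "\<chi>3 ` set ws = J" using xs(1) by auto
  interpret \<chi>3: fhom \<chi>3 using \<chi>3(1) by (rule KhomD)
  \<comment> \<open>The twist by \<open>\<chi>3\<close> lets \<open>set ws\<close> take the position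
    of \<open>J\<close>; \<open>F\<close> stays unramified since the hypothesis on places covers
    every twist.\<close>
  define \<iota> where "\<iota> = (\<lambda>x. \<iota>0 (\<chi>3 x))"
  have \<iota>: "place c \<iota>"
    unfolding \<iota>_def using place_comp[OF pl(1)] \<chi>3(1) by (simp add: KhomD)
  have "set ws \<subseteq> unram \<iota>"
    using pl(4) \<chi>3(2) by (auto simp: unram_def \<iota>_def)
  moreover have "F \<subseteq> unram \<iota>" using pl(7)[OF \<chi>3(1)] by (simp add: \<iota>_def)
  ultimately have sub: "adj (F \<union> set ws) \<subseteq> unram \<iota>"
    by (intro adj_least subfld_unram[OF \<iota>] base_subset_unram[OF \<iota>]) auto
  have root: "poly (map_poly to_ac q) (\<iota> x) = 0" if "x \<in> R" "x \<notin> set ws" for x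
  proof -
    have "\<chi>3 x \<notin> J" using that(2) by (auto simp flip: \<chi>3(2))
    moreover have "\<chi>3 x \<in> R" using R(3)[OF \<chi>3(1)] that(1) by blast
    ultimately show ?thesis using pl(6) by (simp add: \<iota>_def)
  qed
  interpret \<chi>1: fhom \<chi>1 using \<chi>1(1) by (rule KhomD)
  have "\<chi>1 u \<in> R" "\<chi>1 u \<notin> set ws"
    using R(3)[OF \<chi>1(1)] dus by (auto simp flip: \<chi>1(3))
  then obtain \<chi>2 where \<chi>2: "Khom \<chi>2" "\<And>a. a \<in> adj (F \<union> set ws) \<Longrightarrow> \<chi>2 a = a" "\<chi>2 (\<chi>1 u) = w"
    using place_conj[OF \<iota> subfld_adj base_subset_adj sub pl(5) root root, of "\<chi>1 u" w] dws by metis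
  have fix2: "\<chi>2 a = a" if "a \<in> F \<union> set ws" for a
    using \<chi>2(2) subset_adj[of "F \<union> set ws"] that by blast
  have "map (\<lambda>x. \<chi>2 (\<chi>1 x)) us' = map \<chi>2 (map \<chi>1 us')" by simp
  also have "\<dots> = ws" unfolding \<chi>1(3) by (rule map_idI) (use fix2 in auto)
  finally have "map (\<lambda>x. \<chi>2 (\<chi>1 x)) us = vs" using \<chi>2(3) vs us by simp
  thus ?case
    using Khom_comp[OF \<chi>1(1) \<chi>2(1)] fix2 \<chi>1(2)
    by (intro exI[of _ "\<lambda>x. \<chi>2 (\<chi>1 x)"]) auto
qed


text \<open>Every permutation of \<open>R\<close> is induced over every field that is unramified
  away from the zeros of \<open>D\<close>. The quantifier over \<open>F\<close> matters: the
  property serves over \<open>L\<close>, to define the action of \<open>G\<close>, and over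
  \<open>L\<close> with all algebraic constants, to control
  \<open>E \<inter> constant_closure\<close>.\<close>

definition symmetric_over :: "'k::field poly \<Rightarrow> 'k poly fract alg_closure set \<Rightarrow> bool" where
  "symmetric_over D R \<longleftrightarrow> finite R \<and> (\<forall>x\<in>R. separable_element x) \<and> (\<forall>\<psi>. Khom \<psi> \<longrightarrow> \<psi> ` R \<subseteq> R) \<and>
     (\<forall>F \<pi>. subfld F \<longrightarrow> range to_ac \<subseteq> F \<longrightarrow>
       (\<forall>c \<iota>. place c \<iota> \<longrightarrow> eval_at c D \<noteq> 0 \<longrightarrow> F \<subseteq> unram \<iota>) \<longrightarrow> inj_on \<pi> R \<longrightarrow> \<pi> ` R \<subseteq> R \<longrightarrow>
       (\<exists>\<chi>. Khom \<chi> \<and> (\<forall>a\<in>F. \<chi> a = a) \<and> (\<forall>x\<in>R. \<chi> x = \<pi> x)))"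

lemma symmetric_extension:
  fixes D :: "'k::field poly"
  assumes "D \<noteq> 0" "n > 0"
  shows "\<exists>R. card R = n \<and> symmetric_over D R"
proof -
  obtain a :: "nat \<Rightarrow> 'k poly" and c where H: "(\<forall>i\<le>n. a i \<noteq> 0) \<and> (\<forall>j<n. eval_at (c j) D \<noteq> 0 \<and>
     (\<forall>i\<in>{1..j}. eval_at (c j) (a i) \<noteq> 0) \<and> inj_on (\<lambda>i. eval_at (c j) (a i)) {1..j} \<and>
     (\<forall>i\<in>{j<..n}. eval_at (c j) (a i) = 0 \<and> eval_at (c j) (pderiv (a i)) \<noteq> 0))"
    using zero_sequence_exists[OF assms(1), of n] by (elim exE)
  have HD: "\<And>j. j < n \<Longrightarrow> eval_at (c j) D \<noteq> 0"
    and Hnz: "\<And>i j. j < n \<Longrightarrow> i \<in> {1..j} \<Longrightarrow> eval_at (c j) (a i) \<noteq> 0"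
    and Hinj: "\<And>j. j < n \<Longrightarrow> inj_on (\<lambda>i. eval_at (c j) (a i)) {1..j}"
    and Hz: "\<And>i j. j < n \<Longrightarrow> i \<in> {j<..n} \<Longrightarrow> eval_at (c j) (a i) = 0"
    and Hz': "\<And>i j. j < n \<Longrightarrow> i \<in> {j<..n} \<Longrightarrow> eval_at (c j) (pderiv (a i)) \<noteq> 0"
    using H by simp_all
  define u where "u = (\<lambda>p :: 'k poly. to_ac (to_fract p))"
  have "rhom u" unfolding u_def by (rule rhom_comp[OF rhom_to_fract rhom_to_ac])
  then interpret u: rhom u .
  define h where "h = (\<Prod>i\<in>{1..n}. [:- to_fract (a i), 1:]) + [:to_fract (a n):]"
  define f where "f = map_poly to_ac h"
  interpret T: fhom "to_ac :: 'k poly fract \<Rightarrow> _" by (rule fhom_to_ac)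
  interpret TM: rhom "map_poly (to_ac :: 'k poly fract \<Rightarrow> _)" by (rule T.rhom_map_poly)
  have f: "f = (\<Prod>i\<in>{1..n}. [:- u (a i), 1:]) + [:u (a n):]"
    by (simp add: f_def h_def u_def TM.prod)
  have dp: "degree (\<Prod>i\<in>{1..n}. [:- u (a i), 1:]) = n" by (simp add: degree_prod_linear)
  have df: "degree f = n"
    unfolding f using assms(2) dp by (subst degree_add_eq_left) auto
  hence f0: "f \<noteq> 0" using assms(2) by auto
  define R where "R = {x. poly f x = 0}"
  have finR: "finite R" unfolding R_def using f0 by (rule poly_roots_finite)
  have KR: "\<psi> ` R \<subseteq> R" if "Khom \<psi>" for \<psi>
    using Khom_root[OF that, of h] by (auto simp: R_def f_def)
  have local: "\<exists>r e. map_poly \<iota> f = map_poly (\<lambda>p. to_ac (fps_to_fls p)) ((\<Prod>i\<in>{1..j}. [:- r i, 1:]) * e) \<and>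
      inj_on r {1..j} \<and> (\<forall>i\<in>{1..j}. r i $ 0 \<noteq> 0) \<and> lead_coeff e = 1 \<and> degree e = n - j \<and>
      residue_poly e = monom 1 (n - j) \<and> irreducible (map_poly fps_to_fls e)"
    if j: "j < n" and \<iota>: "place (c j) \<iota>" for j \<iota>
  proof -
    define b where "b = (\<lambda>i. expand_at (c j) (a i))"
    have b0: "b i $ 0 = eval_at (c j) (a i)" for i by (simp add: b_def expand_at_nth_0)
    have b1: "b n $ 1 \<noteq> 0"
      unfolding b_def expand_at_nth_1 using Hz'[OF j] j by simp
    have u: "\<And>i. i \<in> {1..j} \<Longrightarrow> b i $ 0 \<noteq> 0" "inj_on (\<lambda>i. b i $ 0) {1..j}"
      "\<And>i. i \<in> {j<..n} \<Longrightarrow> b i $ 0 = 0"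
      using Hnz[OF j] Hinj[OF j] Hz[OF j] by (simp_all add: b0)
    obtain r e where re: "(\<Prod>i\<in>{1..n}. [:- b i, 1:]) + [:b n:] = (\<Prod>i\<in>{1..j}. [:- r i, 1:]) * e"
      "\<And>i. i \<in> {1..j} \<Longrightarrow> r i $ 0 = b i $ 0"
      "lead_coeff e = 1" "degree e = n - j" "residue_poly e = monom 1 (n - j)"
      "irreducible (map_poly fps_to_fls e)"
      using local_factorization[OF j u b1] by blast
    interpret \<iota>: fhom \<iota> using \<iota> by (rule place_hom)
    interpret IM: rhom "map_poly \<iota>" by (rule \<iota>.rhom_map_poly)
    have "rhom (\<lambda>p :: 'k alg_closure fps. to_ac (fps_to_fls p))"
      by (intro rhom_comp[OF rhom_fps_to_fls rhom_to_ac])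
    then interpret v: rhom "\<lambda>p :: 'k alg_closure fps. to_ac (fps_to_fls p)" .
    interpret VM: rhom "map_poly (\<lambda>p :: 'k alg_closure fps. to_ac (fps_to_fls p))"
      by (rule v.rhom_map_poly)
    have "map_poly \<iota> f = map_poly (\<lambda>p. to_ac (fps_to_fls p)) ((\<Prod>i\<in>{1..n}. [:- b i, 1:]) + [:b n:])"
      unfolding f IM.add VM.add IM.prod VM.prod by (simp add: b_def u_def place_poly[OF \<iota>])
    moreover have "inj_on r {1..j}"
      using Hinj[OF j] re(2) unfolding inj_on_def b0 by metis
    moreover have "r i $ 0 \<noteq> 0" if "i \<in> {1..j}" for i
      using re(2)[OF that] Hnz[OF j that] unfolding b0 by simp
    ultimately show ?thesis using re(3-) unfolding re(1) by blast
  qed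
  have place: "\<exists>J q. J \<subset> R \<and> card J = j \<and> J \<subseteq> unram \<iota> \<and> irreducible q \<and>
      (\<forall>x\<in>R - J. poly (map_poly to_ac q) (\<iota> x) = 0)"
    if j: "j < n" and \<iota>: "place (c j) \<iota>" for j \<iota>
  proof -
    interpret \<iota>: fhom \<iota> using \<iota> by (rule place_hom)
    define v where "v = (\<lambda>p :: 'k alg_closure fps. to_ac (fps_to_fls p))"
    have "rhom v" unfolding v_def by (intro rhom_comp[OF rhom_fps_to_fls rhom_to_ac])
    then interpret v: rhom v .
    interpret VM: rhom "map_poly v" by (rule v.rhom_map_poly)
    have vinj: "v p = v q \<longleftrightarrow> p = q" for p q by (simp add: v_def)
    obtain r e where fac: "map_poly \<iota> f = map_poly v ((\<Prod>i\<in>{1..j}. [:- r i, 1:]) * e)"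
      and rinj: "inj_on r {1..j}" and r0: "\<And>i. i \<in> {1..j} \<Longrightarrow> r i $ 0 \<noteq> 0"
      and e: "lead_coeff e = 1" "degree e = n - j" "residue_poly e = monom 1 (n - j)"
        "irreducible (map_poly fps_to_fls e)"
      using local[OF j \<iota>] unfolding v_def by blast
    have ev: "poly (map_poly \<iota> f) y = (\<Prod>i\<in>{1..j}. y - v (r i)) * poly (map_poly v e) y" for y
      by (simp add: fac VM.prod poly_prod)
    define Y where "Y = (\<lambda>i. v (r i)) ` {1..j}"
    have "inj_on (\<lambda>i. v (r i)) {1..j}"
      using rinj unfolding inj_on_def vinj .
    hence cY: "card Y = j"
      unfolding Y_def by (simp add: card_image)
    have lift: "\<exists>x\<in>R. \<iota> x = y" if "poly (map_poly \<iota> f) y = 0" for y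
      using roots_lift[OF \<iota>.fhom_axioms f0 that] unfolding R_def by blast
    have Yroot: "poly (map_poly \<iota> f) y = 0" if "y \<in> Y" for y
      using that unfolding ev by (auto simp: Y_def)
    define J where "J = {x \<in> R. \<iota> x \<in> Y}"
    have "\<iota> ` J = Y" using lift Yroot unfolding J_def by blast
    hence "card J = j" using cY card_image[of \<iota> J] \<iota>.inj inj_on_subset by (metis subset_UNIV)
    moreover have "J \<subseteq> unram \<iota>" by (auto simp: J_def unram_def Y_def v_def)
    moreover have "map_poly v e = map_poly to_ac (map_poly fps_to_fls e)"
      by (rule poly_eqI) (simp add: v_def coeff_map_poly)
    moreover have "poly (map_poly v e) (\<iota> x) = 0" if "x \<in> R - J" for x
    proof -
      have "poly (map_poly \<iota> f) (\<iota> x) = 0" using that by (simp add: \<iota>.poly_map R_def)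
      moreover have "\<iota> x \<notin> Y" using that by (auto simp: J_def)
      hence "(\<Prod>i\<in>{1..j}. \<iota> x - v (r i)) \<noteq> 0" by (auto simp: Y_def prod_zero_iff)
      ultimately show ?thesis unfolding ev by simp
    qed
    \<comment> \<open>A root of \<open>e\<close> is not among the \<open>r i\<close>: the residue of
      \<open>e\<close> is a power of the variable, while the \<open>r i\<close> are units.\<close>
    moreover have "J \<noteq> R"
    proof
      assume "J = R"
      have "degree (map_poly v e) = degree e"
        by (rule degree_map_poly) (auto simp: v_def)
      hence "degree (map_poly v e) > 0" using e(2) j by simp
      then obtain y where y: "poly (map_poly v e) y = 0"
        using alg_closed_imp_poly_has_root by blast
      hence "poly (map_poly \<iota> f) y = 0" unfolding ev by simp
      then obtain x where "x \<in> R" "\<iota> x = y" using lift by blast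
      hence "y \<in> Y" using \<open>J = R\<close> by (auto simp: J_def)
      then obtain i where i: "i \<in> {1..j}" "y = v (r i)" by (auto simp: Y_def)
      hence "v (poly e (r i)) = v 0" using y by (simp add: v.poly_map)
      hence "poly e (r i) = 0" by (simp only: vinj)
      hence "poly (residue_poly e) (r i $ 0) = 0" using poly_nth_0[of e "r i"] by simp
      thus False using r0[OF i(1)] by (simp add: e(3) poly_monom)
    qed
    ultimately show ?thesis using e(4) unfolding J_def
      by (intro exI[of _ "{x \<in> R. \<iota> x \<in> Y}"] exI[of _ "map_poly fps_to_fls e"]) auto
  qed
  \<comment> \<open>For \<open>j = n - 1\<close> there are \<open>n - 1\<close> unramified roots and
    at least one more. Counting shows that \<open>f\<close> has only simple roots, whatever the
    characteristic.\<close>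
  have "n \<le> card R"
  proof -
    obtain \<iota> where "place (c (n - 1)) \<iota>" using place_exists by blast
    then obtain J where "J \<subset> R" "card J = n - 1" using place[of "n - 1" \<iota>] assms(2) by auto
    hence "n - 1 < card R" using psubset_card_mono[OF finR, of J] by simp
    thus ?thesis by linarith
  qed
  moreover have "card R \<le> n" unfolding R_def using card_poly_roots_bound[OF f0] df by simp
  ultimately have cardR: "card R = n" by simp
  have sep: "separable_element x" if "x \<in> R" for x
    using simple_root_if_card_roots[OF f0, of x] cardR df that separable_if_simple_root[of h x]
    unfolding R_def f_def by auto
  have conj: "\<exists>\<chi>. Khom \<chi> \<and> (\<forall>a\<in>F. \<chi> a = a) \<and> (\<forall>x\<in>R. \<chi> x = \<pi> x)"
    if F: "subfld F" "range to_ac \<subseteq> F" "\<And>c \<iota>. place c \<iota> \<Longrightarrow> eval_at c D \<noteq> 0 \<Longrightarrow> F \<subseteq> unram \<iota>"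
      and \<pi>: "inj_on \<pi> R" "\<pi> ` R \<subseteq> R" for F \<pi>
  proof -
    obtain xs where xs: "set xs = R" "distinct xs" using finite_distinct_list[OF finR] by blast
    have "\<exists>\<chi>. Khom \<chi> \<and> (\<forall>a\<in>F. \<chi> a = a) \<and> map \<chi> xs = map \<pi> xs"
    proof (rule list_conj_by_places[OF F(1,2) finR cardR KR])
      show "distinct xs" "distinct (map \<pi> xs)" "set xs \<subseteq> R" "set (map \<pi> xs) \<subseteq> R"
        "length xs = length (map \<pi> xs)"
        using xs \<pi> by (auto simp: distinct_map)
      fix j assume j: "j < n"
      obtain \<iota> where \<iota>: "place (c j) \<iota>" using place_exists by blast
      have "F \<subseteq> unram (\<lambda>x. \<iota> (\<psi> x))" if "Khom \<psi>" for \<psi>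
        using place_comp[OF \<iota>] that F(3) HD[OF j] unfolding Khom_def by blast
      thus "\<exists>c \<iota> J q. place c \<iota> \<and> J \<subseteq> R \<and> card J = j \<and> J \<subseteq> unram \<iota> \<and> irreducible q \<and>
        (\<forall>x\<in>R - J. poly (map_poly to_ac q) (\<iota> x) = 0) \<and> (\<forall>\<psi>. Khom \<psi> \<longrightarrow> F \<subseteq> unram (\<lambda>x. \<iota> (\<psi> x)))"
        using place[OF j \<iota>] \<iota> by blast
    qed
    then obtain \<chi> where "Khom \<chi>" "\<forall>a\<in>F. \<chi> a = a" "map \<chi> xs = map \<pi> xs" by blast
    moreover from this(3) have "\<forall>x\<in>set xs. \<chi> x = \<pi> x" by simp
    ultimately show ?thesis using xs(1) by blast
  qed
  have "symmetric_over D R"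
    unfolding symmetric_over_def using finR sep KR conj by simp
  thus ?thesis using cardR by blast
qed

section \<open>Separability of generated extensions\<close>

interpretation ac: vector_space "\<lambda>(a :: 'f::field) (x :: 'f alg_closure). to_ac a * x"
  by standard (simp_all add: algebra_simps)

lemma adj_in_subspace:
  fixes E :: "'f::field alg_closure set"
  assumes "ac.subspace V" "1 \<in> V" "\<And>x y. x \<in> V \<Longrightarrow> y \<in> V \<Longrightarrow> x * y \<in> V" "S \<subseteq> V"
  shows "adj S \<subseteq> V"
proof -
  have b: "range to_ac \<subseteq> V" using ac.subspace_scale[OF assms(1,2)] by auto
  have "subfld V"
    by (rule subfld_of_algebraic_ring[OF subfld_range[OF fhom_to_ac] b])
      (use assms ac.subspace_add[OF assms(1)] base_algebraic in auto)
  thus ?thesis using adj_least[OF _ b assms(4)] by blast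
qed

lemma subspace_subfld:
  fixes E :: "'f::field alg_closure set"
  assumes "subfld E" "range to_ac \<subseteq> E"
  shows "ac.subspace E"
  using assms by (auto simp: ac.subspace_def subfldD(1,3) intro!: subfldD(4)[OF assms(1)])

lemma span_subset_adj: "ac.span B \<subseteq> adj B"
  by (intro ac.span_minimal subset_adj subspace_subfld subfld_adj base_subset_adj)

lemma finite_dimension_spanned:
  fixes E :: "'f::field alg_closure set"
  assumes "ring.finite_dimension ac_ring base_field E"
  obtains B where "finite B" "B \<subseteq> E" "E \<subseteq> ac.span B"
proof -
  interpret R: field "ac_ring :: 'f alg_closure ring" by (rule ring_ac_ring)
  have le: "R.line_extension base_field v V = {to_ac a * v + e | a e. e \<in> V}" for v V
    by (auto simp: R.line_extension_def set_add_def set_mult_def r_coset_def ac_ring_simps)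
  have "\<exists>B. finite B \<and> B \<subseteq> E \<and> E \<subseteq> ac.span B \<and> 0 \<in> E"
    if "R.dimension n K E" "K = base_field" for n K and E :: "'f alg_closure set"
    using that
  proof (induction rule: R.dimension.induct)
    case (zero_dim K)
    show ?case by (intro exI[of _ "{}"]) (auto simp: ac_ring_simps)
  next
    case (Suc_dim v V n K)
    then obtain B where B: "finite B" "B \<subseteq> V" "V \<subseteq> ac.span B" "0 \<in> V" by blast
    have sub: "V \<subseteq> R.line_extension base_field v V"
    proof
      fix e assume "e \<in> V"
      hence "to_ac 0 * v + e \<in> R.line_extension base_field v V" unfolding le by blast
      thus "e \<in> R.line_extension base_field v V" by simp
    qed
    have "to_ac 1 * v + 0 \<in> R.line_extension base_field v V" unfolding le using B(4) by blast
    hence "v \<in> R.line_extension base_field v V" by simp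
    moreover have "R.line_extension base_field v V \<subseteq> ac.span (insert v B)"
    proof
      fix y assume "y \<in> R.line_extension base_field v V"
      then obtain a e where y: "y = to_ac a * v + e" "e \<in> V" unfolding le by blast
      have "e \<in> ac.span (insert v B)" using y(2) B(3) ac.span_mono[of B "insert v B"] by blast
      thus "y \<in> ac.span (insert v B)"
        unfolding y(1) using ac.span_add[OF ac.span_scale[OF ac.span_base[of v "insert v B"]], of e a] by simp
    qed
    ultimately show ?case
      using B sub Suc_dim.prems by (intro exI[of _ "insert v B"]) auto
  qed
  thus ?thesis using assms that unfolding R.finite_dimension_def by blast
qed

lemma adj_finite_dimension:
  fixes S :: "'f::field alg_closure set"
  assumes "finite S"
  shows "ring.finite_dimension ac_ring base_field (adj S)"
proof -
  interpret R: field "ac_ring :: 'f alg_closure ring" by (rule ring_ac_ring)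
  have K: "subfield base_field (ac_ring :: 'f alg_closure ring)"
    by (simp add: subfield_ac_ring_iff subfld_range fhom_to_ac)
  note sr = subfieldE(1)[OF K]
  obtain xs where xs: "set xs = S" using finite_list[OF assms] by blast
  have car: "set xs \<subseteq> carrier (ac_ring :: 'f alg_closure ring)" by (simp add: ac_ring_simps)
  have alg: "(R.algebraic over base_field) x" for x
  proof -
    obtain p :: "'f poly" where p: "p \<noteq> 0" "poly (map_poly to_ac p) x = 0"
      by (rule alg_closure_algebraic)
    define q where "q = rev (coeffs (map_poly to_ac p))"
    have mp: "map_poly to_ac p \<noteq> 0" using p(1) by (simp add: fhom.map_eq_0_iff[OF fhom_to_ac])
    show ?thesis unfolding over_def
    proof (rule R.algebraicI[of q, unfolded over_def])
      show "q \<noteq> []" using mp by (simp add: q_def)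
      have "set (coeffs (map_poly to_ac p)) \<subseteq> range to_ac"
        by (auto simp: coeffs_def coeff_map_poly)
      moreover have "hd q \<noteq> 0"
        using mp by (simp add: q_def hd_rev last_coeffs_eq_coeff_degree)
      ultimately show "q \<in> carrier (base_field[X]\<^bsub>ac_ring\<^esub>)"
        by (auto simp: univ_poly_def polynomial_def q_def ac_ring_simps)
      show "R.eval q x = \<zero>\<^bsub>ac_ring\<^esub>"
        using p(2) by (simp add: ac_ring_eval q_def ac_ring_simps)
    qed
  qed
  have "R.finite_extension base_field xs = adj S"
  proof
    show "R.finite_extension base_field xs \<subseteq> adj S"
      using R.finite_extension_subring_incl[of "adj S" base_field xs] subfld_adj[of S]
        subfield_ac_ring_iff[of "adj S"] subfieldE(1) base_subset_adj subset_adj xs by metis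
    have "subfield (R.finite_extension base_field xs) ac_ring"
      using R.finite_extension_is_subfield[OF K car] alg by blast
    thus "adj S \<subseteq> R.finite_extension base_field xs"
      using R.finite_extension_incl[OF subringE(1)[OF sr] car] R.finite_extension_mem[OF sr car] xs
      by (intro adj_least) (auto simp: subfield_ac_ring_iff)
  qed
  thus ?thesis using R.finite_extension_finite_dimension(1)[OF K car] alg by simp
qed

lemma finite_ext_adj: "finite S \<Longrightarrow> finite_ext (adj S)"
  by (auto simp: finite_ext_def extension_field_def subfield_ac_ring_iff subfld_adj base_subset_adj
      adj_finite_dimension dest: subsetD[OF base_subset_adj])

lemma finite_ext_generated:
  assumes "finite_ext L"
  obtains B where "finite B" "L = adj B" "B \<subseteq> L"
proof -
  have L: "subfld L" "range to_ac \<subseteq> L" "ring.finite_dimension ac_ring base_field L"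
    using assms by (auto simp: finite_ext_def extension_field_def subfield_ac_ring_iff)
  obtain B where B: "finite B" "B \<subseteq> L" "L \<subseteq> ac.span B"
    using finite_dimension_spanned[OF L(3)] by blast
  have "adj B = L" using B span_subset_adj[of B] adj_least[OF L(1,2) B(2)] by blast
  thus ?thesis using B that by blast
qed

text \<open>\<open>x\<close> is a root of \<open>X^p - x^p = (X - x)^p\<close>, so it has no other
  conjugate over the field obtained by adjoining \<open>x^p\<close>; being separable over
  \<open>F\<close>, it lies in that field.\<close>

lemma simple_root_mem_adj_power:
  fixes x :: "'f::field alg_closure"
  assumes "CHAR('f) > 0" and F: "subfld F" "range to_ac \<subseteq> F"
    and h: "h \<in> polys_over F" "poly h x = 0" "poly (pderiv h) x \<noteq> 0"
  shows "x \<in> adj (insert (x ^ CHAR('f)) F)"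
proof (rule mem_if_no_conj[OF subfld_adj])
  define p where "p = CHAR('f)"
  have F': "F \<subseteq> adj (insert (x ^ p) F)" and xp: "x ^ p \<in> adj (insert (x ^ p) F)"
    using subset_adj[of "insert (x ^ p) F"] by auto
  show "h \<in> polys_over (adj (insert (x ^ CHAR('f)) F))"
    using h(1) polys_over_mono[OF F'] unfolding p_def by blast
  fix y assume *: "\<And>g. g \<in> polys_over (adj (insert (x ^ CHAR('f)) F)) \<Longrightarrow> poly g x = 0 \<Longrightarrow> poly g y = 0"
  have "prime p" unfolding p_def using assms(1) by (rule prime_CHAR_semidom)
  have "monom 1 p - [:x ^ p:] \<in> polys_over (adj (insert (x ^ p) F))"
    by (intro polys_over_diff polys_over_monom polys_over_pCons polys_over_0 subfldD(2) subfld_adj xp)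
  hence "poly (monom 1 p - [:x ^ p:]) y = 0"
    using *[of "monom 1 p - [:x ^ p:]"] by (simp add: poly_monom p_def)
  hence "y ^ p = x ^ p" by (simp add: poly_monom)
  moreover have "((y - x) + x) ^ p = (y - x) ^ p + x ^ p"
    using \<open>prime p\<close> by (intro freshmans_dream) (simp_all add: p_def)
  ultimately have "(y - x) ^ p = 0" by simp
  thus "y = x" using \<open>prime p\<close> by simp
qed (use h in auto)

definition frob :: "'f::field alg_closure \<Rightarrow> 'f alg_closure" where
  "frob x = x ^ CHAR('f)"

context
  assumes char_pos: "CHAR('f::field) > 0"
begin

lemma frob_hom: "fhom (frob :: 'f alg_closure \<Rightarrow> _)"
proof (unfold fhom_def, standard)
  have pr: "prime CHAR('f)" using char_pos by (rule prime_CHAR_semidom)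
  fix x y :: "'f alg_closure"
  show "frob (x + y) = frob x + frob y"
    unfolding frob_def using pr by (intro freshmans_dream) simp_all
qed (simp_all add: frob_def power_mult_distrib)

text \<open>
  If \<open>E = K(E\<^sup>p)\<close>, then taking \<open>p\<close>-th powers of a basis of \<open>E\<close> over \<open>K\<close> yields a spanning set of
  the same size, so \<open>p\<close>-th powers of linearly independent elements are linearly independent.
\<close>

lemma independent_frob_image:
  fixes E :: "'f alg_closure set"
  assumes E: "subfld E" "range to_ac \<subseteq> E" "finite B0" "E \<subseteq> ac.span B0"
    and gen: "E \<subseteq> adj (frob ` E)" and C: "C \<subseteq> E" "ac.independent C"
  shows "ac.independent (frob ` C)"
proof -
  interpret frob: fhom "frob :: 'f alg_closure \<Rightarrow> _" by (rule frob_hom)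
  obtain B where B: "C \<subseteq> B" "B \<subseteq> E" "ac.independent B" "E \<subseteq> ac.span B"
    using ac.maximal_independent_subset_extend[OF C] by blast
  have fB: "finite B"
    using ac.independent_span_bound[OF E(3) B(3)] B(2) E(4) by blast
  have spE: "ac.span B = E"
    using B(2,4) ac.span_minimal[OF B(2) subspace_subfld[OF E(1,2)]] by blast
  define V where "V = ac.span (frob ` B)"
  have "frob x \<in> V" if "x \<in> ac.span B" for x
    using that
  proof (induction rule: ac.span_induct_alt)
    case base
    show ?case unfolding V_def using ac.span_zero by simp
  next
    case (step c x y)
    have "frob (to_ac c * x + y) = to_ac (c ^ CHAR('f)) * frob x + frob y"
      by (simp only: frob.add frob.mult) (simp add: frob_def)
    moreover have "to_ac (c ^ CHAR('f)) * frob x + frob y \<in> V"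
      using step ac.span_add[OF ac.span_scale[OF ac.span_base[of "frob x" "frob ` B"]], of "frob y"]
      unfolding V_def by blast
    ultimately show ?case by (simp only:)
  qed
  hence frobV: "frob ` E \<subseteq> V" using spE by auto
  \<comment> \<open>Products of \<open>p\<close>-th powers of basis elements are \<open>p\<close>-th
    powers of elements of \<open>E\<close>, and these lie in \<open>V\<close>. Being a ring of
    algebraic elements over the base field, \<open>V\<close> is then a field and contains
    \<open>E\<close>.\<close>
  have "x * y \<in> V" if "x \<in> V" "y \<in> V" for x y
    using that(1) unfolding V_def
  proof (induction rule: ac.span_induct_alt)
    case base
    show ?case using ac.span_zero by simp
  next
    case (step c b x)
    obtain b' where b': "b' \<in> B" "b = frob b'" using step by blast
    have "b * y \<in> ac.span (frob ` B)"
      using that(2) unfolding V_def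
    proof (induction rule: ac.span_induct_alt)
      case base
      show ?case using ac.span_zero by simp
    next
      case (step c d y)
      obtain d' where d': "d' \<in> B" "d = frob d'" using step by blast
      have "b * d = frob (b' * d')" by (simp add: b' d')
      moreover have "b' * d' \<in> E" using b' d' B(2) subfldD(4)[OF E(1)] by blast
      ultimately have "b * d \<in> ac.span (frob ` B)" using frobV unfolding V_def by blast
      hence "to_ac c * (b * d) + b * y \<in> ac.span (frob ` B)"
        using step by (intro ac.span_add ac.span_scale)
      thus ?case by (simp add: algebra_simps)
    qed
    hence "to_ac c * (b * y) + x * y \<in> ac.span (frob ` B)"
      using step by (intro ac.span_add ac.span_scale)
    thus ?case by (simp add: algebra_simps)
  qed
  moreover have "1 \<in> V" using frobV subfldD(2)[OF E(1)] frob.one by (metis image_subset_iff)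
  ultimately have "adj (frob ` E) \<subseteq> V"
    using frobV unfolding V_def by (intro adj_in_subspace ac.subspace_span)
  hence EV: "E \<subseteq> V" using gen by blast
  have sub: "frob ` B \<subseteq> E"
    using B(2) subfldD(9)[OF E(1)] by (auto simp: frob_def)
  \<comment> \<open>A basis of \<open>E\<close> among the \<open>p\<close>-th powers has as many
    elements as \<open>B\<close>, so it consists of all of them.\<close>
  obtain B' where B': "B' \<subseteq> frob ` B" "ac.independent B'" "frob ` B \<subseteq> ac.span B'"
    by (rule ac.maximal_independent_subset)
  have "V \<subseteq> ac.span B'" unfolding V_def using B'(3) by (simp add: ac.span_minimal)
  hence "card B' = ac.dim E"
    using B' sub EV by (intro ac.basis_card_eq_dim) auto
  also have "\<dots> = card B" using B by (intro ac.basis_card_eq_dim[symmetric]) auto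
  also have "\<dots> = card (frob ` B)"
    using frob.inj by (intro card_image[symmetric]) (auto intro: inj_on_subset)
  finally have "B' = frob ` B" using B'(1) fB by (intro card_subset_eq) auto
  thus ?thesis using B'(2) B(1) ac.independent_mono by blast
qed

text \<open>If the minimal polynomial \<open>m\<close> of \<open>x\<close> had derivative 0, it
  would be a polynomial in \<open>X^p\<close>, of degree \<open>p e\<close>. Then
  \<open>1, x, ..., x^e\<close> are independent, as \<open>e < p e\<close>, but \<open>m\<close> is
  a linear relation between their \<open>p\<close>-th powers.\<close>

lemma separable_if_frob_generates:
  fixes E :: "'f alg_closure set"
  assumes E: "subfld E" "range to_ac \<subseteq> E" "finite B0" "E \<subseteq> ac.span B0"
    and gen: "E \<subseteq> adj (frob ` E)" and x: "x \<in> E"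
  shows "separable_element x"
proof -
  interpret frob: fhom "frob :: 'f alg_closure \<Rightarrow> _" by (rule frob_hom)
  define p where "p = CHAR('f)"
  have pr: "prime p" unfolding p_def using char_pos by (rule prime_CHAR_semidom)
  obtain m :: "'f poly" where m: "irreducible m" "poly (map_poly to_ac m) x = 0"
    by (rule irreducible_annihilator_exists)
  have "m \<noteq> 0" using m(1) by auto
  have "pderiv m \<noteq> 0"
  proof
    assume pd: "pderiv m = 0"
    have cz: "coeff m i = 0" if "\<not> p dvd i" for i
    proof (cases i)
      case (Suc k)
      have "of_nat (Suc k) * coeff m (Suc k) = coeff (pderiv m) k" by (simp add: coeff_pderiv)
      hence "of_nat (Suc k) * coeff m (Suc k) = 0" by (simp add: pd)
      moreover have "of_nat (Suc k) \<noteq> (0 :: 'f)"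
        using that Suc unfolding p_def by (simp only: of_nat_eq_0_iff_char_dvd) simp
      ultimately show ?thesis using Suc by simp
    qed (use that in auto)
    have "lead_coeff m \<noteq> 0" using \<open>m \<noteq> 0\<close> by simp
    hence "p dvd degree m" using cz by blast
    then obtain e where e: "degree m = p * e" by blast
    have "degree m > 0"
    proof (rule ccontr)
      assume "\<not> degree m > 0"
      then obtain c where "m = [:c:]" by (metis degree_eq_zeroE gr0I)
      thus False using m(2) \<open>m \<noteq> 0\<close> by (simp add: map_poly_pCons)
    qed
    hence "e > 0" using e by (cases e) auto
    have p2: "p \<ge> 2" using pr by (rule prime_ge_2_nat)
    have elt: "e < degree m" using e p2 \<open>e > 0\<close> by simp
    have dep: "q = 0" if "poly (map_poly to_ac q) x = 0" "degree q \<le> e" for q :: "'f poly"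
    proof (rule ccontr)
      assume "q \<noteq> 0"
      have "m dvd q" using irreducible_dvd_if_common_root[OF fhom_to_ac m that(1)] .
      hence "degree m \<le> degree q" using \<open>q \<noteq> 0\<close> by (rule dvd_imp_degree_le)
      thus False using that(2) elt by simp
    qed
    have ev: "(\<Sum>i\<le>e. to_ac (u i) * x ^ i) = poly (map_poly to_ac (\<Sum>i\<le>e. monom (u i) i)) x"
      for u :: "nat \<Rightarrow> 'f"
      by (simp add: rhom.sum[OF rhom.rhom_map_poly[OF rhom_to_ac]] poly_sum map_poly_monom poly_monom)
    have cf: "coeff (\<Sum>i\<le>e. monom (u i) i) k = (if k \<le> e then u k else 0)" for u :: "nat \<Rightarrow> 'f" and k
      by (simp add: coeff_sum)
    have ind: "u k = 0" if "(\<Sum>i\<le>e. to_ac (u i) * x ^ i) = 0" "k \<le> e" for u k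
    proof -
      have "degree (\<Sum>i\<le>e. monom (u i) i) \<le> e"
        by (rule degree_le) (simp add: cf)
      hence "(\<Sum>i\<le>e. monom (u i) i) = 0" using dep that(1) unfolding ev by blast
      thus ?thesis using cf[of u k] that(2) by simp
    qed
    define g where "g = (\<lambda>i :: nat. x ^ i)"
    have gE: "g ` {..e} \<subseteq> E" using subfldD(9)[OF E(1) x] by (auto simp: g_def)
    have ginj: "inj_on g {..e}"
    proof (rule inj_onI, rule ccontr)
      fix a b assume ab: "a \<in> {..e}" "b \<in> {..e}" "g a = g b" "a \<noteq> b"
      define u :: "nat \<Rightarrow> 'f" where "u = (\<lambda>i. if i = a then 1 else if i = b then -1 else 0)"
      have "(\<Sum>i\<le>e. to_ac (u i) * x ^ i) = (\<Sum>i\<in>{a, b}. to_ac (u i) * x ^ i)"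
        using ab by (intro sum.mono_neutral_right) (auto simp: u_def)
      also have "\<dots> = 0" using ab by (simp add: u_def g_def)
      finally have "u a = 0" using ind ab by blast
      thus False by (simp add: u_def)
    qed
    have "ac.independent (g ` {..e})"
    proof
      assume "ac.dependent (g ` {..e})"
      then obtain u v where "v \<in> g ` {..e}" "u v \<noteq> 0" "(\<Sum>v\<in>g ` {..e}. to_ac (u v) * v) = 0"
        by (auto simp: ac.dependent_finite)
      moreover from this(3) have "(\<Sum>i\<le>e. to_ac (u (g i)) * x ^ i) = 0"
        using ginj by (simp add: sum.reindex g_def)
      ultimately show False using ind[of "\<lambda>i. u (g i)"] by auto
    qed
    hence indf: "ac.independent (frob ` g ` {..e})"
      by (rule independent_frob_image[OF E gen gE])
    define f where "f = (\<lambda>i. frob (g i))"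
    have finj: "inj_on f {..e}"
      unfolding f_def using ginj by (auto simp: inj_on_def)
    define u where "u = (\<lambda>v. coeff m (p * the_inv_into {..e} f v))"
    have "(\<Sum>v\<in>f ` {..e}. to_ac (u v) * v) = (\<Sum>i\<le>e. to_ac (coeff m (p * i)) * x ^ (p * i))"
      unfolding sum.reindex[OF finj] comp_def
    proof (rule sum.cong)
      fix i assume "i \<in> {..e}"
      thus "to_ac (u (f i)) * f i = to_ac (coeff m (p * i)) * x ^ (p * i)"
        using the_inv_into_f_f[OF finj]
        by (simp add: u_def) (simp add: f_def g_def frob_def p_def power_mult[symmetric] mult.commute)
    qed auto
    also have "\<dots> = (\<Sum>i\<in>(\<lambda>i. p * i) ` {..e}. to_ac (coeff m i) * x ^ i)"
      using p2 by (subst sum.reindex) (auto simp: inj_on_def)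
    also have "\<dots> = (\<Sum>i\<le>degree m. to_ac (coeff m i) * x ^ i)"
    proof (intro sum.mono_neutral_left ballI)
      fix i assume i: "i \<in> {..degree m} - (\<lambda>i. p * i) ` {..e}"
      have "\<not> p dvd i"
      proof
        assume "p dvd i"
        then obtain k where "i = p * k" by blast
        thus False using i e p2 by auto
      qed
      thus "to_ac (coeff m i) * x ^ i = 0" using cz by simp
    qed (use e in auto)
    also have "\<dots> = poly (map_poly to_ac m) x"
      by (simp add: poly_altdef fhom.degree_map[OF fhom_to_ac] coeff_map_poly)
    finally have "(\<Sum>v\<in>f ` {..e}. to_ac (u v) * v) = 0" using m(2) by simp
    moreover have "u (f e) \<noteq> 0"
      using \<open>lead_coeff m \<noteq> 0\<close> the_inv_into_f_f[OF finj, of e] e by (simp add: u_def)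
    ultimately have "ac.dependent (f ` {..e})" by (auto simp: ac.dependent_finite)
    thus False using indf by (simp add: f_def image_image)
  qed
  thus ?thesis using separable_elementI[OF m] by blast
qed

end

lemma separable_char_0:
  assumes "CHAR('f::field) = 0"
  shows "separable_element (x :: 'f alg_closure)"
proof -
  obtain m :: "'f poly" where m: "irreducible m" "poly (map_poly to_ac m) x = 0"
    by (rule irreducible_annihilator_exists)
  have "m \<noteq> 0" using m(1) by auto
  have "degree m \<noteq> 0"
  proof
    assume "degree m = 0"
    then obtain c where "m = [:c:]" by (metis degree_eq_zeroE)
    thus False using m(2) \<open>m \<noteq> 0\<close> by (simp add: map_poly_pCons)
  qed
  then obtain k where k: "degree m = Suc k" by (cases "degree m") auto
  have "coeff (pderiv m) k = of_nat (Suc k) * lead_coeff m" using k by (simp add: coeff_pderiv)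
  also have "\<dots> \<noteq> 0"
    using \<open>m \<noteq> 0\<close> of_nat_eq_0_iff_char_dvd[where ?'a = 'f, of "Suc k"] assms by simp
  finally have "pderiv m \<noteq> 0" by auto
  thus ?thesis using separable_elementI[OF m] by blast
qed

text \<open>\<open>z\<close> is known to be a simple root only over \<open>adj S\<close>, so no
  separable polynomial over the base field is at hand. Instead the field \<open>E\<close> is shown
  to be generated by its \<open>p\<close>-th powers: they generate first \<open>S\<close>, by
  separability over the base field, and then \<open>z\<close>.\<close>

lemma separable_adj_insert:
  fixes S :: "'f::field alg_closure set"
  assumes S: "finite S" "\<And>s. s \<in> S \<Longrightarrow> separable_element s"
    and h: "h \<in> polys_over (adj S)" "poly h z = 0" "poly (pderiv h) z \<noteq> 0"
    and x: "x \<in> adj (insert z S)"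
  shows "separable_element x"
proof (cases "CHAR('f) = 0")
  case False
  hence char: "CHAR('f) > 0" by simp
  define E where "E = adj (insert z S)"
  have SE: "adj S \<subseteq> E" "z \<in> E" "S \<subseteq> E"
    using adj_mono[of S "insert z S"] subset_adj[of "insert z S"] by (auto simp: E_def)
  let ?M = "adj (frob ` E)"
  have frobM: "y ^ CHAR('f) \<in> ?M" if "y \<in> E" for y
    using subset_adj[of "frob ` E"] that by (auto simp: frob_def)
  have "S \<subseteq> ?M"
  proof
    fix s assume s: "s \<in> S"
    obtain p where p: "poly (map_poly to_ac p) s = 0"
      "\<And>y. poly (map_poly to_ac p) y = 0 \<Longrightarrow> poly (pderiv (map_poly to_ac p)) y \<noteq> 0"
      using separable_elementE[OF S(2)[OF s]] by metis
    have "s \<in> adj (insert (s ^ CHAR('f)) (range to_ac))"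
      by (rule simple_root_mem_adj_power[OF char subfld_range[OF fhom_to_ac] subset_refl _ p(1) p(2)[OF p(1)]])
        (simp add: polys_over_def coeff_map_poly)
    moreover have "adj (insert (s ^ CHAR('f)) (range to_ac)) \<subseteq> ?M"
      by (intro adj_least subfld_adj base_subset_adj) (use frobM[of s] SE s base_subset_adj[of "frob ` E"] in auto)
    ultimately show "s \<in> ?M" by blast
  qed
  hence SM: "adj S \<subseteq> ?M" by (intro adj_least subfld_adj base_subset_adj)
  have "z \<in> adj (insert (z ^ CHAR('f)) (adj S))"
    by (rule simple_root_mem_adj_power[OF char subfld_adj base_subset_adj h])
  moreover have "adj (insert (z ^ CHAR('f)) (adj S)) \<subseteq> ?M"
    by (intro adj_least subfld_adj base_subset_adj) (use frobM[of z] SE SM in auto)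
  ultimately have "z \<in> ?M" by blast
  hence "insert z S \<subseteq> ?M" using \<open>S \<subseteq> ?M\<close> by blast
  from adj_least[OF subfld_adj base_subset_adj this] have gen: "E \<subseteq> ?M"
    by (simp only: E_def[symmetric])
  have "ring.finite_dimension ac_ring base_field E"
    unfolding E_def using S(1) by (intro adj_finite_dimension) simp
  then obtain B where B: "finite B" "E \<subseteq> ac.span B"
    by (rule finite_dimension_spanned)
  have E: "subfld E" "range to_ac \<subseteq> E" by (simp_all only: E_def subfld_adj base_subset_adj)
  have "x \<in> E" using x by (simp only: E_def)
  with char E B gen show ?thesis by (rule separable_if_frob_generates)
qed (rule separable_char_0)

lemma separable_adj:
  fixes S :: "'f::field alg_closure set"
  assumes "finite S" "\<And>s. s \<in> S \<Longrightarrow> separable_element s" "x \<in> adj S"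
  shows "separable_element x"
proof -
  \<comment> \<open>Adjoining \<open>z = 0\<close>, a simple root of \<open>X\<close>, changes
    nothing.\<close>
  have "[:0, 1:] \<in> polys_over (adj S)"
    by (intro polys_over_pCons polys_over_0 subfldD(1,2) subfld_adj)
  moreover have "x \<in> adj (insert 0 S)" using assms(3) adj_mono[of S "insert 0 S"] by blast
  ultimately show ?thesis
    using separable_adj_insert[OF assms(1,2), of "[:0, 1:]" 0 x] by (simp add: pderiv_pCons)
qed

section \<open>Isolating a conjugate\<close>

lemma infinite_poly: "infinite (UNIV :: 'a::field poly set)"
proof -
  have "inj (\<lambda>n. monom (1 :: 'a) n)"
    by (rule injI) (metis degree_monom_eq zero_neq_one)
  thus ?thesis using infinite_super[OF subset_UNIV range_inj_infinite] by blast
qed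

lemma infinite_fract_poly: "infinite (UNIV :: 'a::field poly fract set)"
proof
  assume "finite (UNIV :: 'a poly fract set)"
  hence "finite (range (to_fract :: 'a poly \<Rightarrow> _))" by (rule finite_subset[rotated]) auto
  moreover have "inj (to_fract :: 'a poly \<Rightarrow> _)" by (auto intro: injI)
  ultimately show False using infinite_poly finite_imageD by blast
qed

lemma finite_Khom_orbit: "finite {\<psi> x |\<psi>. Khom \<psi>}"
proof -
  obtain p where p: "p \<noteq> 0" "poly (map_poly to_ac p) x = 0" by (rule alg_closure_algebraic)
  have "finite {y. poly (map_poly to_ac p) y = 0}"
    using p(1) by (intro poly_roots_finite) (simp add: fhom.map_eq_0_iff[OF fhom_to_ac])
  moreover have "{\<psi> x |\<psi>. Khom \<psi>} \<subseteq> {y. poly (map_poly to_ac p) y = 0}"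
    using Khom_root p(2) by blast
  ultimately show ?thesis by (rule finite_subset[rotated])
qed

text \<open>\<open>\<theta>\<close> is the value at \<open>l\<close> of the polynomial whose
  coefficients are the elements of \<open>S\<close>. Its conjugates have coefficients in a finite
  set, so \<open>l\<close> in the infinite base field can avoid all coincidences between their
  values. Primitivity is expressed by conjugations, which is how it is applied.\<close>

lemma primitive_element:
  fixes S :: "'f::field alg_closure set"
  assumes "infinite (UNIV :: 'f set)" "finite S"
  obtains \<theta> where "\<theta> \<in> adj S"
    "\<And>\<phi> \<psi> s. Khom \<phi> \<Longrightarrow> Khom \<psi> \<Longrightarrow> \<phi> \<theta> = \<psi> \<theta> \<Longrightarrow> s \<in> S \<Longrightarrow> \<phi> s = \<psi> s"
proof -
  obtain ss where ss: "set ss = S" using finite_list[OF assms(2)] by blast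
  define C where "C = (\<Union>s\<in>S. {\<psi> s |\<psi>. Khom \<psi>})"
  define Q where "Q = Poly ` {xs. set xs \<subseteq> C \<and> length xs = length ss}"
  have "finite C" unfolding C_def using assms(2) finite_Khom_orbit by blast
  hence "finite Q" unfolding Q_def by (intro finite_imageI finite_lists_length_eq)
  define Z where "Z = (\<Union>(p, q)\<in>{(p, q). p \<in> Q \<and> q \<in> Q \<and> p \<noteq> q}. {x. poly (p - q) x = 0})"
  have "finite {(p, q). p \<in> Q \<and> q \<in> Q \<and> p \<noteq> q}"
    by (rule finite_subset[of _ "Q \<times> Q"]) (use \<open>finite Q\<close> in auto)
  moreover have "finite {x. poly (p - q) x = 0}" if "p \<noteq> q" for p q :: "'f alg_closure poly"
    using that by (intro poly_roots_finite) simp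
  ultimately have "finite Z" unfolding Z_def by (intro finite_UN_I) auto
  moreover have "infinite (range (to_ac :: 'f \<Rightarrow> _))"
    using assms(1) finite_imageD inj_to_ac by blast
  ultimately obtain l where l: "to_ac (l :: 'f) \<notin> Z"
    by (metis finite_subset image_subsetI)
  define \<theta> where "\<theta> = poly (Poly ss) (to_ac l)"
  have "\<theta> \<in> adj S"
    unfolding \<theta>_def
  proof (rule poly_in_subfld[OF subfld_adj])
    show "Poly ss \<in> polys_over (adj S)"
      using subset_adj[of S] ss subfldD(1)[OF subfld_adj, of S]
      by (auto simp: polys_over_def nth_default_def)
    show "to_ac l \<in> adj S" using base_subset_adj by blast
  qed
  moreover have "\<phi> s = \<psi> s" if h: "Khom \<phi>" "Khom \<psi>" "\<phi> \<theta> = \<psi> \<theta>" "s \<in> S" for \<phi> \<psi> s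
  proof -
    have ev: "\<psi> \<theta> = poly (Poly (map \<psi> ss)) (to_ac l)" and mem: "Poly (map \<psi> ss) \<in> Q"
      if "Khom \<psi>" for \<psi>
    proof -
      interpret fhom \<psi> using that by (rule KhomD)
      have "map_poly \<psi> (Poly xs) = Poly (map \<psi> xs)" for xs by (induction xs) auto
      thus "\<psi> \<theta> = poly (Poly (map \<psi> ss)) (to_ac l)"
        unfolding \<theta>_def by (simp add: KhomD(2)[OF that] flip: poly_map)
      show "Poly (map \<psi> ss) \<in> Q"
        unfolding Q_def C_def using ss that by (intro imageI) auto
    qed
    have "Poly (map \<phi> ss) = Poly (map \<psi> ss)"
    proof (rule ccontr)
      assume ne: "Poly (map \<phi> ss) \<noteq> Poly (map \<psi> ss)"
      have "poly (Poly (map \<phi> ss) - Poly (map \<psi> ss)) (to_ac l) = 0"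
        using h(3) by (simp add: ev[OF h(1)] ev[OF h(2)])
      hence "to_ac l \<in> Z"
        unfolding Z_def using ne mem[OF h(1)] mem[OF h(2)] by blast
      thus False using l by blast
    qed
    moreover obtain i where i: "i < length ss" "ss ! i = s" using h(4) ss by (metis in_set_conv_nth)
    ultimately have "coeff (Poly (map \<phi> ss)) i = coeff (Poly (map \<psi> ss)) i" by simp
    thus ?thesis using i by (simp add: nth_default_def)
  qed
  ultimately show ?thesis by (rule that)
qed

text \<open>With \<open>g = poly P r0\<close> and \<open>r = r0 + D' g w\<close>, divisibility of
  differences gives \<open>poly P r = g (1 + D' w t)\<close>. The second factor is 1 at the zeros of
  \<open>D\<close>, so a zero of it is a point of the required kind.\<close>

lemma norm_value_root:
  fixes P :: "'k::field poly poly"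
  assumes "degree P > 0" "D \<noteq> 0"
  obtains r c where "poly P r \<noteq> 0" "eval_at c (poly P r) = 0" "eval_at c D \<noteq> 0"
proof -
  have "P \<noteq> 0" using assms(1) by auto
  hence "finite {r. poly P r = 0}" by (rule poly_roots_finite)
  then obtain r0 where r0: "poly P r0 \<noteq> 0" using infinite_poly[where ?'a = 'k]
    by (metis (mono_tags, lifting) UNIV_eq_I mem_Collect_eq)
  define g where "g = poly P r0"
  \<comment> \<open>The factor \<open>T\<close> makes \<open>D'\<close> nonconstant, hence also
    \<open>1 + D' w t\<close> once \<open>w t \<noteq> 0\<close>.\<close>
  define D' where "D' = D * [:0, 1:]"
  have D': "D' \<noteq> 0" "degree D' > 0" using assms(2) by (auto simp: D'_def degree_mult_eq)
  define H where "H = pcompose P [:r0, D' * g:] - [:g:]"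
  have "degree (pcompose P [:r0, D' * g:]) > 0"
    using assms(1) r0 D'(1) by (simp add: degree_pcompose g_def)
  hence "H \<noteq> 0" by (auto simp: H_def)
  hence "finite {w. poly H w = 0}" by (rule poly_roots_finite)
  then obtain w where w: "poly H w \<noteq> 0" using infinite_poly[where ?'a = 'k]
    by (metis (mono_tags, lifting) UNIV_eq_I mem_Collect_eq)
  define r where "r = r0 + D' * g * w"
  have ne: "poly P r \<noteq> g" using w by (simp add: H_def poly_pcompose r_def mult.commute mult.left_commute)
  have "r - r0 dvd poly P r - poly P r0" by (rule dvd_poly_diff)
  then obtain t where "poly P r - g = D' * g * w * t" by (auto simp: r_def g_def)
  hence fac: "poly P r = g * (1 + D' * (w * t))" by (simp add: algebra_simps)
  define q where "q = 1 + D' * (w * t)"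
  have wt: "w * t \<noteq> 0" using ne fac by auto
  have "degree (D' * (w * t)) > 0" using D' wt by (subst degree_mult_eq) auto
  hence "degree q > 0" unfolding q_def by (subst degree_add_eq_right) auto
  then obtain c where c: "eval_at c q = 0" using eval_at_root_exists by blast
  interpret E: rhom "eval_at c" by (rule rhom_eval_at)
  show ?thesis
  proof (rule that)
    show "poly P r \<noteq> 0" using fac r0 \<open>degree q > 0\<close> by (auto simp: g_def q_def)
    show "eval_at c (poly P r) = 0" using c unfolding fac by (simp add: E.mult flip: q_def)
    show "eval_at c D \<noteq> 0"
    proof
      assume "eval_at c D = 0"
      hence "eval_at c q = 1" by (simp only: q_def D'_def E.add E.mult E.one) simp
      thus False using c by simp
    qed
  qed
qed

text \<open>\<open>N\<close> is to be \<open>poly P r\<close>, the norm of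
  \<open>\<theta> - r\<close> up to sign and leading coefficient. As a single conjugate vanishes at
  \<open>\<iota>\<close>, \<open>N\<close> has the same order \<open>m\<close> as
  \<open>\<theta> - r\<close>. The last clause makes everything a unit away from the zeros of
  \<open>D'\<close>.\<close>

definition isolating :: "'k::field poly fract alg_closure \<Rightarrow> 'k poly \<Rightarrow> 'k poly \<Rightarrow> 'k alg_closure \<Rightarrow>
    ('k poly fract alg_closure \<Rightarrow> 'k alg_closure fls alg_closure) \<Rightarrow> nat \<Rightarrow> 'k poly \<Rightarrow> bool" where
  "isolating \<theta> r N c \<iota> m D' \<longleftrightarrow> N \<noteq> 0 \<and> place c \<iota> \<and> m > 0 \<and> D' \<noteq> 0 \<and>
     subdegree (expand_at c N) = m \<and> eval_at c N = 0 \<and>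
     (\<forall>\<psi>. Khom \<psi> \<longrightarrow> (\<exists>u. \<iota> (\<psi> \<theta> - to_ac (to_fract r)) = to_ac (fps_to_fls u) \<and> u \<noteq> 0 \<and>
       subdegree u = (if \<psi> \<theta> = \<theta> then m else 0))) \<and>
     (\<forall>c' \<kappa> \<psi>. place c' \<kappa> \<longrightarrow> eval_at c' D' \<noteq> 0 \<longrightarrow> Khom \<psi> \<longrightarrow> eval_at c' N \<noteq> 0 \<and>
       (\<exists>u. \<kappa> (\<psi> \<theta> - to_ac (to_fract r)) = to_ac (fps_to_fls u) \<and> u $ 0 \<noteq> 0))"

text \<open>At a zero \<open>c\<close> of \<open>poly P r\<close>, the value \<open>r(c)\<close> is
  a simple root of the reduced polynomial, so a unique power series root \<open>u0\<close> reduces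
  to it. It belongs to some conjugate of \<open>\<theta>\<close>, and twisting the place makes this
  conjugate \<open>\<theta>\<close> itself.\<close>

lemma isolating_place:
  fixes \<theta> :: "'k::field poly fract alg_closure"
  assumes sep: "separable_element \<theta>" and "D \<noteq> 0"
  shows "\<exists>r N c \<iota> m D'. isolating \<theta> r N c \<iota> m D' \<and> eval_at c D \<noteq> 0"
proof -
  obtain P D0 where pair: "defining_pair \<theta> P D0" using separable_defining_pair[OF sep] by blast
  have D0: "D0 \<noteq> 0" and P0: "P \<noteq> 0"
    and roots: "\<And>y. poly (map_poly (\<lambda>a. to_ac (to_fract a)) P) y = 0 \<longleftrightarrow> (\<exists>\<psi>. Khom \<psi> \<and> y = \<psi> \<theta>)"
    using pair unfolding defining_pair_def by blast+
  have root\<theta>: "poly (map_poly (\<lambda>a. to_ac (to_fract a)) P) (\<psi> \<theta>) = 0" if "Khom \<psi>" for \<psi>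
    using roots that by blast
  have "degree P > 0"
  proof (rule ccontr)
    assume "\<not> degree P > 0"
    then obtain a where "P = [:a:]" by (metis degree_eq_zeroE gr0I)
    thus False using root\<theta>[OF Khom_id] P0 by (simp add: map_poly_pCons)
  qed
  moreover have "D * D0 \<noteq> 0" using assms(2) D0 by simp
  ultimately obtain r c where r: "poly P r \<noteq> 0" "eval_at c (poly P r) = 0" "eval_at c (D * D0) \<noteq> 0"
    by (rule norm_value_root)
  define N where "N = poly P r"
  have cD: "eval_at c D \<noteq> 0" "eval_at c D0 \<noteq> 0"
    using r(3) by (auto simp: rhom.mult[OF rhom_eval_at])
  have N: "N \<noteq> 0" "eval_at c N = 0" using r by (auto simp: N_def)
  obtain \<iota>1 where \<iota>1: "place c \<iota>1" using place_exists by blast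
  interpret E: rhom "expand_at c" by (rule rhom_expand_at)
  define Q where "Q = map_poly (expand_at c) P"
  define \<rho> where "\<rho> = expand_at c r"
  note Qprops = defining_pair_local[OF pair cD(2), folded Q_def]
  have Q\<rho>: "poly Q \<rho> = expand_at c N" by (simp add: Q_def \<rho>_def N_def E.poly_map)
  have "poly (residue_poly Q) (\<rho> $ 0) = 0"
    using N(2) by (simp flip: poly_nth_0 add: Q\<rho> expand_at_nth_0)
  then obtain u0 where u0: "poly Q u0 = 0" "u0 $ 0 = \<rho> $ 0"
    using hensel[of Q "\<rho> $ 0"] Qprops(3) by metis
  have simple: "poly (pderiv (residue_poly Q)) (u0 $ 0) \<noteq> 0"
    using Qprops(3)[of "u0 $ 0"] u0(1) by (metis fps_zero_nth poly_nth_0)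
  obtain y0 where y0: "poly (map_poly (\<lambda>a. to_ac (to_fract a)) P) y0 = 0" "\<iota>1 y0 = to_ac (fps_to_fls u0)"
    using Qprops(5)[OF \<iota>1 u0(1)] by blast
  obtain \<psi>0 where "Khom \<psi>0" "y0 = \<psi>0 \<theta>"
    using y0(1) unfolding roots by blast
  hence \<psi>0: "Khom \<psi>0" "\<iota>1 (\<psi>0 \<theta>) = to_ac (fps_to_fls u0)"
    using y0(2) by simp_all
  define \<iota> where "\<iota> = (\<lambda>x. \<iota>1 (\<psi>0 x))"
  have \<iota>: "place c \<iota>" unfolding \<iota>_def using place_comp[OF \<iota>1] \<psi>0(1) by (simp add: KhomD)
  interpret \<iota>: fhom \<iota> using \<iota> by (rule place_hom)
  define m where "m = subdegree (u0 - \<rho>)"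
  have nroot: "u \<noteq> \<rho>" if "poly Q u = 0" for u
    using that Q\<rho> N(1) by auto
  have "m > 0"
    using nroot[OF u0(1)] u0(2) unfolding m_def by (simp add: subdegree_pos_iff)
  have subN: "subdegree (expand_at c N) = m"
  proof -
    \<comment> \<open>The cofactor of the root \<open>u0\<close> is a unit at \<open>\<rho>\<close>,
      because there it has the same constant term as the derivative of \<open>Q\<close> at
      \<open>u0\<close>.\<close>
    obtain G where G: "Q = [:- u0, 1:] * G" using u0(1) by (auto simp: poly_eq_0_iff_dvd)
    have "poly (pderiv Q) u0 = poly G u0"
      by (simp add: G pderiv_mult pderiv_pCons del: mult_pCons_left)
    hence "poly (residue_poly G) (u0 $ 0) \<noteq> 0"
      using simple by (metis poly_nth_0 pderiv_residue_poly)
    hence "poly G \<rho> $ 0 \<noteq> 0" by (simp add: poly_nth_0 u0(2))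
    hence "poly G \<rho> \<noteq> 0" "subdegree (poly G \<rho>) = 0" by (auto simp: subdegree_eq_0_iff)
    moreover have "expand_at c N = (\<rho> - u0) * poly G \<rho>"
      by (simp flip: Q\<rho> add: G del: mult_pCons_left)
    moreover have "\<rho> - u0 \<noteq> 0" using nroot[OF u0(1)] by simp
    ultimately have "subdegree (expand_at c N) = subdegree (\<rho> - u0)" by simp
    thus ?thesis by (simp add: m_def subdegree_minus_commute)
  qed
  have "isolating \<theta> r N c \<iota> m (D0 * N)"
    unfolding isolating_def
  proof (intro conjI[of "N \<noteq> 0"] conjI[of "place c \<iota>"] conjI[of "m > 0"] conjI[of "D0 * N \<noteq> 0"]
      conjI[of "subdegree (expand_at c N) = m"] conjI[of "eval_at c N = 0"] conjI[of "\<forall>\<psi>. _ \<psi>"] allI impI)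
    show "D0 * N \<noteq> 0" using D0 N by simp
    show "\<exists>u. \<iota> (\<psi> \<theta> - to_ac (to_fract r)) = to_ac (fps_to_fls u) \<and> u \<noteq> 0 \<and>
       subdegree u = (if \<psi> \<theta> = \<theta> then m else 0)" if \<psi>: "Khom \<psi>" for \<psi>
    proof -
      obtain u where u: "\<iota> (\<psi> \<theta>) = to_ac (fps_to_fls u)" "poly Q u = 0"
        using Qprops(4)[OF \<iota> root\<theta>[OF \<psi>]] by blast
      have "\<iota> (\<psi> \<theta> - to_ac (to_fract r)) = to_ac (fps_to_fls (u - \<rho>))"
        by (simp add: u place_poly[OF \<iota>] \<rho>_def)
      moreover have "u - \<rho> \<noteq> 0" using nroot[OF u(2)] by simp
      moreover have "subdegree (u - \<rho>) = (if \<psi> \<theta> = \<theta> then m else 0)"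
      proof (cases "\<psi> \<theta> = \<theta>")
        case True
        hence "to_ac (fps_to_fls u) = to_ac (fps_to_fls u0)"
          using u(1) \<psi>0(2) by (simp add: \<iota>_def)
        hence "u = u0" by (simp only: to_ac_eq_iff fps_to_fls_eq_iff)
        thus ?thesis using True by (simp add: m_def)
      next
        case False
        have "u \<noteq> u0"
        proof
          assume "u = u0"
          hence "\<iota> (\<psi> \<theta>) = \<iota> \<theta>" using u(1) \<psi>0(2) by (simp add: \<iota>_def)
          thus False using False by simp
        qed
        hence "u $ 0 \<noteq> \<rho> $ 0"
          using hensel_unique[OF u0(1) u(2) _ simple] u0(2) by metis
        thus ?thesis using False by (simp add: subdegree_eq_0_iff)
      qed
      ultimately show ?thesis by blast
    qed
    fix c' :: "'k alg_closure" and \<kappa> :: "'k poly fract alg_closure \<Rightarrow> 'k alg_closure fls alg_closure"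
      and \<psi> :: "'k poly fract alg_closure \<Rightarrow> 'k poly fract alg_closure"
    assume \<kappa>: "place c' \<kappa>" "eval_at c' (D0 * N) \<noteq> 0" and \<psi>: "Khom \<psi>"
    have c': "eval_at c' D0 \<noteq> 0" "eval_at c' N \<noteq> 0"
      using \<kappa>(2) by (auto simp: rhom.mult[OF rhom_eval_at])
    interpret \<kappa>: fhom \<kappa> using \<kappa>(1) by (rule place_hom)
    interpret E': rhom "expand_at c'" by (rule rhom_expand_at)
    obtain u where u: "\<kappa> (\<psi> \<theta>) = to_ac (fps_to_fls u)" "poly (map_poly (expand_at c') P) u = 0"
      using defining_pair_local(4)[OF pair c'(1) \<kappa>(1) root\<theta>[OF \<psi>]] by blast
    have "(u - expand_at c' r) $ 0 \<noteq> 0"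
    proof
      assume "(u - expand_at c' r) $ 0 = 0"
      hence "poly (map_poly (expand_at c') P) u $ 0 = poly (map_poly (expand_at c') P) (expand_at c' r) $ 0"
        by (simp add: poly_nth_0)
      also have "\<dots> = eval_at c' N" by (simp add: E'.poly_map N_def expand_at_nth_0)
      finally show False using u(2) c'(2) by simp
    qed
    moreover have "\<kappa> (\<psi> \<theta> - to_ac (to_fract r)) = to_ac (fps_to_fls (u - expand_at c' r))"
      by (simp add: u place_poly[OF \<kappa>(1)])
    ultimately show "eval_at c' N \<noteq> 0 \<and>
       (\<exists>u. \<kappa> (\<psi> \<theta> - to_ac (to_fract r)) = to_ac (fps_to_fls u) \<and> u $ 0 \<noteq> 0)"
      using c'(2) by blast
  qed (use N \<iota> subN \<open>m > 0\<close> in auto)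
  thus ?thesis using cD(1) by blast
qed

section \<open>Destroying automorphisms\<close>

text \<open>At a zero of \<open>s\<close> it reduces to \<open>Z - 1\<close>, whose simple root
  lifts; at a pole, division by \<open>s\<close> leads to the irreducible polynomial of
  \<open>dumas_fps\<close>.\<close>

definition trinomial :: "nat \<Rightarrow> 'a::comm_ring_1 \<Rightarrow> 'a poly" where
  "trinomial d s = monom s d + [:- 1, 1:]"

lemma poly_trinomial: "poly (trinomial d s) z = s * z ^ d + z - 1"
  by (simp add: trinomial_def poly_monom)

lemma map_poly_trinomial:
  assumes "rhom f"
  shows "map_poly f (trinomial d s) = trinomial d (f s)"
proof -
  interpret rhom f by fact
  show ?thesis
    by (rule poly_eqI) (auto simp: trinomial_def coeff_pCons split: nat.splits)
qed

lemma trinomial_nonzero: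
  assumes "d > 0"
  shows "trinomial d (s :: 'a::idom) \<noteq> 0"
proof
  assume "trinomial d s = 0"
  hence "poly (trinomial d s) 0 = 0" by simp
  thus False using assms by (simp add: poly_trinomial power_0_left)
qed

lemma residue_trinomial: "s $ 0 = 0 \<Longrightarrow> residue_poly (trinomial d s) = [:- 1, 1:]" for s :: "'a::idom fps"
  by (simp add: map_poly_trinomial[OF rhom_fps_nth_0]) (simp add: trinomial_def)

lemma trinomial_fps_root:
  fixes s :: "'a::field fps"
  assumes "s $ 0 = 0"
  obtains u where "poly (trinomial d s) u = 0" "u $ 0 = 1"
  using hensel[of "trinomial d s" 1] residue_trinomial[OF assms, of d] by (auto simp: pderiv_pCons)

text \<open>A root with a pole of order \<open>e\<close> would satisfy \<open>1 - d e = - e\<close>,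
  that is \<open>(d - 1) e = 1\<close>, which \<open>d \<ge> 3\<close> excludes. So all Laurent
  series roots are power series with constant term 1, and Hensel's lemma leaves only one.\<close>

lemma trinomial_fls_root_unique:
  fixes s :: "'a::field fps"
  assumes s: "subdegree s = 1" and "d \<ge> 3"
    and "poly (trinomial d s) u = 0" "u $ 0 = 1" and \<zeta>: "poly (trinomial d (fps_to_fls s)) \<zeta> = 0"
  shows "\<zeta> = fps_to_fls u"
proof -
  have s0: "s \<noteq> 0" using s by force
  have s00: "s $ 0 = 0" by (rule nth_less_subdegree_zero) (simp add: s)
  define S where "S = fps_to_fls s"
  have S: "S \<noteq> 0" "fls_subdegree S = 1" using s s0 by (auto simp: S_def fls_subdegree_fls_to_fps)
  have eq: "S * \<zeta> ^ d = 1 - \<zeta>" using \<zeta> by (simp add: poly_trinomial S_def algebra_simps)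
  have "\<zeta> \<noteq> 0" using eq assms(2) by (auto simp: power_0_left)
  hence sub: "fls_subdegree (S * \<zeta> ^ d) = 1 + int d * fls_subdegree \<zeta>"
    using S by (simp add: fls_subdegree_pow)
  have nonneg: "fls_subdegree \<zeta> \<ge> 0"
  proof (rule ccontr)
    assume neg: "\<not> fls_subdegree \<zeta> \<ge> 0"
    hence "fls_subdegree (1 - \<zeta>) = fls_subdegree \<zeta>"
      using \<open>\<zeta> \<noteq> 0\<close> by (intro fls_subdegree_diff_eq2) auto
    hence "1 + int d * fls_subdegree \<zeta> = fls_subdegree \<zeta>" using sub eq by simp
    hence "(1 - int d) * fls_subdegree \<zeta> = 1" by (simp add: algebra_simps)
    hence "1 - int d dvd 1" by (metis dvd_triv_left)
    thus False using assms(2) by simp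
  qed
  then obtain v where v: "\<zeta> = fps_to_fls v" using fps_to_fls_regpart by metis
  have "fps_to_fls (poly (trinomial d s) v) = fps_to_fls 0"
    using \<zeta> by (simp add: v poly_trinomial fls_times_fps_to_fls fps_to_fls_power)
  hence root: "poly (trinomial d s) v = 0" by (simp only: fps_to_fls_eq_iff)
  hence "v $ 0 = 1" using poly_nth_0[of "trinomial d s" v] s00 by (simp add: residue_trinomial)
  hence "u = v"
    using hensel_unique[of "trinomial d s" u v] assms(3,4) root s00
    by (simp add: residue_trinomial pderiv_pCons)
  thus ?thesis by (simp add: v)
qed

text \<open>\<open>q\<close> depends on \<open>w\<close> and \<open>d\<close> only. It is stated for
  all \<open>f\<close> and \<open>s\<close> because \<open>s\<close> itself lies in the larger
  field, where its inverse is known to be the image of a power series.\<close>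

lemma trinomial_pole_irreducible:
  fixes w :: "'a::field fps"
  assumes "d \<ge> 2" "subdegree w = m" "m > 0" "coprime d m"
  shows "\<exists>q :: 'a fls poly. irreducible q \<and> degree q = d \<and>
     (\<forall>(f :: 'a fls \<Rightarrow> 'b::field) s \<zeta>. fhom f \<longrightarrow> s * f (fps_to_fls w) = 1 \<longrightarrow>
       poly (trinomial d s) \<zeta> = 0 \<longrightarrow> poly (map_poly f q) \<zeta> = 0)"
proof -
  define q where "q = map_poly fps_to_fls (monom 1 d + monom w 1 - [:w:])"
  have cq: "coeff q n = (if n = d then 1 else 0) + (if n = 1 then fps_to_fls w else 0) -
      (if n = 0 then fps_to_fls w else 0)" for n
    by (auto simp: q_def rhom.coeff_map[OF rhom_fps_to_fls] coeff_pCons split: nat.splits)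
  have "irreducible q" unfolding q_def by (rule dumas_fps[OF assms])
  moreover have "degree q = d"
  proof (rule antisym)
    show "degree q \<le> d" by (rule degree_le) (use assms in \<open>auto simp: cq\<close>)
    show "d \<le> degree q" by (rule le_degree) (use assms in \<open>auto simp: cq\<close>)
  qed
  moreover have "poly (map_poly f q) \<zeta> = 0"
    if f: "fhom f" and s: "s * f (fps_to_fls w) = 1" and z: "poly (trinomial d s) \<zeta> = 0"
    for f :: "'a fls \<Rightarrow> 'b" and s \<zeta>
  proof -
    interpret fhom f by fact
    define W where "W = f (fps_to_fls w)"
    have "map_poly f q = monom 1 d + monom W 1 - [:W:]"
      by (rule poly_eqI) (auto simp: cq W_def coeff_pCons split: nat.splits)
    hence "poly (map_poly f q) \<zeta> = \<zeta> ^ d + W * \<zeta> - W" by (simp add: poly_monom)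
    also have "\<dots> = (s * W) * \<zeta> ^ d + W * \<zeta> - W" using s by (simp add: W_def)
    also have "\<dots> = W * poly (trinomial d s) \<zeta>" by (simp add: poly_trinomial algebra_simps)
    finally show ?thesis using z by simp
  qed
  ultimately show ?thesis by blast
qed

section \<open>Automorphisms of subfields as restricted conjugations\<close>

lemma Khom_inverse:
  assumes "Khom \<psi>"
  obtains \<psi>' where "Khom \<psi>'" "\<And>x. \<psi>' (\<psi> x) = x" "\<And>x. \<psi> (\<psi>' x) = x"
proof -
  interpret fhom \<psi> using assms by (rule KhomD)
  have surj: "surj \<psi>" using Khom_surj[OF assms] by (metis surjI)
  define \<psi>' where "\<psi>' = inv_into UNIV \<psi>"
  have 1: "\<psi> (\<psi>' x) = x" for x unfolding \<psi>'_def by (rule surj_f_inv_f[OF surj])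
  have 2: "\<psi>' (\<psi> x) = x" for x unfolding \<psi>'_def by (rule inv_into_f_f[OF inj UNIV_I])
  have "Khom \<psi>'"
    unfolding Khom_def fhom_def rhom_def
  proof (intro conjI allI)
    show "\<psi>' 1 = 1" using 2[of 1] by simp
    show "\<psi>' (x + y) = \<psi>' x + \<psi>' y" for x y using 2[of "\<psi>' x + \<psi>' y"] by (simp add: 1)
    show "\<psi>' (x * y) = \<psi>' x * \<psi>' y" for x y using 2[of "\<psi>' x * \<psi>' y"] by (simp add: 1)
    show "\<psi>' (to_ac a) = to_ac a" for a using 2[of "to_ac a"] KhomD(2)[OF assms] by simp
  qed
  thus ?thesis using that 1 2 by blast
qed

lemma field_aut_iff:
  fixes E :: "'f::field alg_closure set"
  assumes E: "subfld E" "range to_ac \<subseteq> E"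
  shows "\<sigma> \<in> field_aut E \<longleftrightarrow> \<sigma> \<in> extensional E \<and> bij_betw \<sigma> E E \<and> hom_on E \<sigma> \<and> (\<forall>a. \<sigma> (to_ac a) = to_ac a)"
  using subfldD(2)[OF E(1)]
  by (auto simp: field_aut_def ring_iso_def ring_hom_def ac_ring_simps hom_on_def bij_betw_def)

lemma field_aut_extend:
  fixes E :: "'f::field alg_closure set"
  assumes E: "subfld E" "range to_ac \<subseteq> E" and "\<sigma> \<in> field_aut E"
  obtains \<psi> where "Khom \<psi>" "\<And>a. a \<in> E \<Longrightarrow> \<psi> a = \<sigma> a"
proof -
  have \<sigma>: "hom_on E \<sigma>" "\<And>a. \<sigma> (to_ac a) = to_ac a" using assms(3) field_aut_iff[OF E] by auto
  obtain \<psi> where "fhom \<psi>" "\<And>a. a \<in> E \<Longrightarrow> \<psi> a = \<sigma> a"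
    using hom_extend[OF E(1) \<sigma>(1) over_base_algebraic[OF E(2)]] by metis
  moreover from this have "Khom \<psi>"
    unfolding Khom_def using \<sigma>(2) range_subsetD[OF E(2)] by simp
  ultimately show ?thesis using that by blast
qed

lemma restrict_field_aut:
  fixes E :: "'f::field alg_closure set"
  assumes E: "subfld E" "range to_ac \<subseteq> E" and \<psi>: "Khom \<psi>" "\<psi> ` E = E"
  shows "restrict \<psi> E \<in> field_aut E"
proof -
  interpret fhom \<psi> using \<psi>(1) by (rule KhomD)
  have "bij_betw (restrict \<psi> E) E E"
    using \<psi>(2) inj by (auto simp: bij_betw_def inj_on_def)
  moreover have "hom_on E (restrict \<psi> E)"
    using subfldD(2-4)[OF E(1)] by (auto simp: hom_on_def)
  moreover have "restrict \<psi> E (to_ac a) = to_ac a" for a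
    using range_subsetD[OF E(2)] KhomD(2)[OF \<psi>(1)] by simp
  ultimately show ?thesis by (simp add: field_aut_iff[OF E])
qed

lemma trinomial_root_hom:
  assumes "rhom f" "poly (trinomial d s) z = 0"
  shows "poly (trinomial d (f s)) (f z) = 0"
proof -
  interpret rhom f by fact
  show ?thesis
    using poly_map[of "trinomial d s" z] assms(2) by (simp add: map_poly_trinomial[OF assms(1)])
qed

lemma fps_quotient:
  fixes f g :: "'a::field fps"
  assumes "f \<noteq> 0" "g \<noteq> 0" "subdegree f \<le> subdegree g"
  obtains h where "g = f * h" "h \<noteq> 0" "subdegree h = subdegree g - subdegree f"
proof -
  have "f dvd g" using assms by (simp add: fps_dvd_iff)
  then obtain h where h: "g = f * h" by blast
  moreover have "h \<noteq> 0" using h assms by auto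
  moreover have "subdegree h = subdegree g - subdegree f" using h assms \<open>h \<noteq> 0\<close> by simp
  ultimately show ?thesis by (rule that)
qed

lemma subdegree_prod_nonzero:
  fixes f :: "'i \<Rightarrow> 'a::field fps"
  assumes "\<And>i. i \<in> A \<Longrightarrow> f i \<noteq> 0"
  shows "subdegree (prod f A) = (\<Sum>i\<in>A. subdegree (f i))"
  using assms by (induction A rule: infinite_finite_induct) auto

text \<open>
  Given an action of \<open>G\<close> on the normal extension \<open>adj S\<close> by the restrictions of \<open>\<phi> g\<close>, all other
  automorphisms are destroyed by adjoining a root \<open>z\<close> of \<open>s Z\<^sup>d + Z - 1\<close>, where \<open>s\<close> is
  \<open>G\<close>-invariant and has a pole at a place at which the other conjugates of \<open>s\<close> vanish.
\<close>

definition rigidifies :: "('g, 'm) monoid_scheme \<Rightarrow> 'f::field alg_closure set \<Rightarrow>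
    ('g \<Rightarrow> 'f alg_closure \<Rightarrow> 'f alg_closure) \<Rightarrow> 'f alg_closure set \<Rightarrow> 'f alg_closure \<Rightarrow>
    ('g \<Rightarrow> 'f alg_closure \<Rightarrow> 'f alg_closure) \<Rightarrow> bool" where
  "rigidifies G S \<phi> C z \<Phi> \<longleftrightarrow>
     (\<forall>x\<in>adj (insert z S). separable_element x) \<and>
     (\<forall>g\<in>carrier G. Khom (\<Phi> g) \<and> (\<forall>y\<in>adj S. \<Phi> g y = \<phi> g y) \<and> \<Phi> g z = z) \<and>
     (\<forall>\<psi>. Khom \<psi> \<longrightarrow> \<psi> ` adj (insert z S) = adj (insert z S) \<longrightarrow>
       (\<exists>g\<in>carrier G. \<forall>y\<in>insert z S. \<psi> y = \<Phi> g y)) \<and>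
     (\<forall>\<psi> \<chi>. Khom \<psi> \<longrightarrow> Khom \<chi> \<longrightarrow> (\<forall>s\<in>S. \<chi> s = \<psi> s) \<longrightarrow>
       (\<exists>\<chi>'. Khom \<chi>' \<and> (\<forall>a\<in>S \<union> C. \<chi>' a = a) \<and> \<chi> (\<chi>' z) = \<psi> z))"

theorem rigidification:
  fixes G :: "('g, 'm) monoid_scheme" and S :: "'k::field poly fract alg_closure set"
  assumes G: "group G" "finite (carrier G)"
    and S: "finite S" "\<And>s. s \<in> S \<Longrightarrow> separable_element s"
    and normal: "\<And>\<psi> s. Khom \<psi> \<Longrightarrow> s \<in> S \<Longrightarrow> \<psi> s \<in> adj S"
    and \<phi>: "\<And>g. g \<in> carrier G \<Longrightarrow> Khom (\<phi> g)"
    and action: "\<And>g h y. g \<in> carrier G \<Longrightarrow> h \<in> carrier G \<Longrightarrow> y \<in> adj S \<Longrightarrow>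
       \<phi> (g \<otimes>\<^bsub>G\<^esub> h) y = \<phi> g (\<phi> h y)"
    and faithful: "\<And>g h. g \<in> carrier G \<Longrightarrow> h \<in> carrier G \<Longrightarrow> (\<And>s. s \<in> S \<Longrightarrow> \<phi> g s = \<phi> h s) \<Longrightarrow> g = h"
  shows "\<exists>z \<Phi>. rigidifies G S \<phi> constant_closure z \<Phi>"
proof -
  interpret G: group G by fact
  define E where "E = adj S"
  have E: "subfld E" "range to_ac \<subseteq> E" "S \<subseteq> E"
    unfolding E_def by (rule subfld_adj base_subset_adj subset_adj)+
  have KE: "\<psi> y \<in> E" if "Khom \<psi>" "y \<in> E" for \<psi> y
    using Khom_adj_into[OF that(1) subfld_adj base_subset_adj normal[OF that(1)]] that(2)
    unfolding E_def by blast
  have eqE: "\<psi> y = \<psi>' y" if "Khom \<psi>" "Khom \<psi>'" "\<And>s. s \<in> S \<Longrightarrow> \<psi> s = \<psi>' s" "y \<in> E" for \<psi> \<psi>' y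
    using Khom_eq_on_adj[OF that(1,2,3)] that(4) unfolding E_def by blast
  \<comment> \<open>The unit acts by an idempotent and injective map, which is the identity on
    \<open>E\<close>.\<close>
  have \<phi>1: "\<phi> \<one>\<^bsub>G\<^esub> y = y" if "y \<in> E" for y
  proof -
    interpret fhom "\<phi> \<one>\<^bsub>G\<^esub>" using \<phi>[of "\<one>\<^bsub>G\<^esub>"] by (simp add: KhomD)
    have "\<phi> \<one>\<^bsub>G\<^esub> (\<phi> \<one>\<^bsub>G\<^esub> y) = \<phi> \<one>\<^bsub>G\<^esub> y"
      using action[OF G.one_closed G.one_closed] that by (simp add: E_def)
    thus ?thesis by (simp only: eq_iff)
  qed
  obtain \<theta> where \<theta>: "\<theta> \<in> E"
    "\<And>\<psi> \<psi>' s. Khom \<psi> \<Longrightarrow> Khom \<psi>' \<Longrightarrow> \<psi> \<theta> = \<psi>' \<theta> \<Longrightarrow> s \<in> S \<Longrightarrow> \<psi> s = \<psi>' s"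
    using primitive_element[OF infinite_fract_poly S(1)] unfolding E_def by blast
  have sep\<theta>: "separable_element \<theta>"
    using separable_adj[OF S] \<theta>(1) unfolding E_def by blast
  obtain D :: "'k poly" where D: "D \<noteq> 0"
    "\<And>c \<iota>. place c \<iota> \<Longrightarrow> eval_at c D \<noteq> 0 \<Longrightarrow> E \<subseteq> unram \<iota>"
    using finite_separable_unram[OF S] unfolding E_def by blast
  obtain r N c \<iota> m D' where I: "isolating \<theta> r N c \<iota> m D'" and cD: "eval_at c D \<noteq> 0"
    using isolating_place[OF sep\<theta> D(1)] by blast
  have N: "N \<noteq> 0" and \<iota>: "place c \<iota>" and m: "m > 0"
    and D': "D' \<noteq> 0" and Nm: "subdegree (expand_at c N) = m" and cN: "eval_at c N = 0"
    and iso: "\<And>\<psi>. Khom \<psi> \<Longrightarrow> \<exists>u. \<iota> (\<psi> \<theta> - to_ac (to_fract r)) = to_ac (fps_to_fls u) \<and> u \<noteq> 0 \<and>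
       subdegree u = (if \<psi> \<theta> = \<theta> then m else 0)"
    and other: "\<And>c' \<kappa> \<psi>. place c' \<kappa> \<Longrightarrow> eval_at c' D' \<noteq> 0 \<Longrightarrow> Khom \<psi> \<Longrightarrow> eval_at c' N \<noteq> 0 \<and>
       (\<exists>u. \<kappa> (\<psi> \<theta> - to_ac (to_fract r)) = to_ac (fps_to_fls u) \<and> u $ 0 \<noteq> 0)"
    using I unfolding isolating_def by blast+
  have "D * D' * N \<noteq> 0" using D D' N by simp
  \<comment> \<open>Avoiding the zeros of \<open>D * D' * N\<close> makes \<open>c1\<close> an
    unramified point at which \<open>N\<close> and the conjugates of \<open>\<theta> - r\<close> are
    units; it also makes \<open>p\<close> a unit at \<open>c\<close>, because \<open>N\<close>
    vanishes there.\<close>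
  then obtain p c1 where p: "p \<noteq> 0" "eval_at c1 p = 0" "eval_at c1 (pderiv p) \<noteq> 0"
    "\<And>c'. eval_at c' (D * D' * N) = 0 \<Longrightarrow> eval_at c' p \<noteq> 0"
    using simple_zero_avoiding by blast
  obtain \<kappa> where \<kappa>: "place c1 \<kappa>" using place_exists by blast
  interpret \<iota>: fhom \<iota> using \<iota> by (rule place_hom)
  interpret \<kappa>: fhom \<kappa> using \<kappa> by (rule place_hom)
  have ev: "eval_at c' (a * b) = eval_at c' a * eval_at c' b" for c' :: "'k alg_closure" and a b
    by (rule rhom.mult[OF rhom_eval_at])
  have cp: "eval_at c p \<noteq> 0" using p(4)[of c] cN by (simp add: ev)
  have c1: "eval_at c1 D \<noteq> 0" "eval_at c1 D' \<noteq> 0" "eval_at c1 N \<noteq> 0"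
    using p(2) p(4)[of c1] by (auto simp: ev)
  define v where "v = (\<lambda>u :: 'k alg_closure fps. to_ac (fps_to_fls u))"
  have "rhom v" unfolding v_def by (rule rhom_comp[OF rhom_fps_to_fls rhom_to_ac])
  then interpret v: rhom v .
  have v0: "v u = 0 \<longleftrightarrow> u = 0" for u by (simp add: v_def)
  define \<Theta> where "\<Theta> = to_ac (to_fract r)"
  define pN where "pN = to_ac (to_fract p) * to_ac (to_fract N)"
  define Y where "Y = (\<Prod>g\<in>carrier G. \<phi> g \<theta> - \<Theta>)"
  define s where "s = pN / Y\<^sup>2"
  define d where "d = 2 * m + 1"
  have d: "d \<ge> 3" "coprime d m"
  proof -
    show "d \<ge> 3" using m by (simp add: d_def)
    show "coprime d m"
    proof (rule coprimeI)
      fix k assume "k dvd d" "k dvd m"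
      hence "k dvd 2 * m + 1" "k dvd 2 * m" by (simp_all add: d_def)
      thus "k dvd 1" using dvd_add_right_iff by blast
    qed
  qed
  have sE: "s \<in> E"
    unfolding s_def pN_def Y_def \<Theta>_def
    using KE[OF \<phi> \<theta>(1)] range_subsetD[OF E(2)]
    by (intro subfldD(4,8,9)[OF E(1)] subfld_prod[OF E(1)] subfldD(7)[OF E(1)]) auto
  have \<psi>s: "\<psi> s = pN / (\<Prod>g\<in>carrier G. \<psi> (\<phi> g \<theta>) - \<Theta>)\<^sup>2" if "Khom \<psi>" for \<psi>
  proof -
    interpret fhom \<psi> using that by (rule KhomD)
    show ?thesis
      by (simp add: s_def pN_def Y_def \<Theta>_def prod KhomD(2)[OF that])
  qed
  have \<phi>s: "\<phi> h s = s" if h: "h \<in> carrier G" for h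
  proof -
    have "(\<Prod>g\<in>carrier G. \<phi> h (\<phi> g \<theta>) - \<Theta>) = (\<Prod>g\<in>carrier G. \<phi> (h \<otimes>\<^bsub>G\<^esub> g) \<theta> - \<Theta>)"
      using action[OF h] \<theta>(1) by (intro prod.cong) (auto simp: E_def)
    also have "\<dots> = Y"
      unfolding Y_def using h
      by (intro prod.reindex_bij_witness[of _ "\<lambda>g. inv\<^bsub>G\<^esub> h \<otimes>\<^bsub>G\<^esub> g" "\<lambda>g. h \<otimes>\<^bsub>G\<^esub> g"])
        (auto simp: G.inv_solve_left' G.m_assoc[symmetric])
    finally have "\<phi> h s = pN / Y\<^sup>2" using \<psi>s[OF \<phi>[OF h]] by (simp only:)
    thus ?thesis by (simp only: s_def)
  qed

  have norm: "\<exists>U. \<iota> (\<Prod>g\<in>carrier G. \<psi> (\<phi> g \<theta>) - \<Theta>) = v U \<and> U \<noteq> 0 \<and>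
      subdegree U = (\<Sum>g\<in>carrier G. if \<psi> (\<phi> g \<theta>) = \<theta> then m else 0)" if \<psi>: "Khom \<psi>" for \<psi>
  proof -
    have "\<forall>g\<in>carrier G. \<exists>u. \<iota> (\<psi> (\<phi> g \<theta>) - \<Theta>) = v u \<and> u \<noteq> 0 \<and>
        subdegree u = (if \<psi> (\<phi> g \<theta>) = \<theta> then m else 0)"
      using iso[OF Khom_comp[OF \<phi> \<psi>]] unfolding v_def \<Theta>_def by blast
    then obtain u where u: "\<forall>g\<in>carrier G. \<iota> (\<psi> (\<phi> g \<theta>) - \<Theta>) = v (u g) \<and> u g \<noteq> 0 \<and>
        subdegree (u g) = (if \<psi> (\<phi> g \<theta>) = \<theta> then m else 0)" by (rule bchoice[THEN exE])
    have "\<iota> (\<Prod>g\<in>carrier G. \<psi> (\<phi> g \<theta>) - \<Theta>) = v (\<Prod>g\<in>carrier G. u g)"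
      unfolding \<iota>.prod v.prod using u by (intro prod.cong) auto
    moreover have "(\<Prod>g\<in>carrier G. u g) \<noteq> 0" using u G(2) by simp
    moreover have "subdegree (\<Prod>g\<in>carrier G. u g) =
        (\<Sum>g\<in>carrier G. if \<psi> (\<phi> g \<theta>) = \<theta> then m else 0)"
      using u by (subst subdegree_prod_nonzero) auto
    ultimately show ?thesis by blast
  qed
  define p' where "p' = expand_at c p * expand_at c N"
  have \<iota>pN: "\<iota> pN = v p'" by (simp add: pN_def p'_def v_def place_poly[OF \<iota>] fls_times_fps_to_fls)
  have p'0: "p' \<noteq> 0" using p(1) N by (simp add: p'_def)
  have "subdegree (expand_at c p) = 0"
    using cp by (simp add: subdegree_eq_0_iff expand_at_nth_0)
  hence p'm: "subdegree p' = m" using Nm p(1) N by (simp add: p'_def)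

  \<comment> \<open>By faithfulness exactly one factor of the conjugated \<open>Y\<close> vanishes
    at \<open>\<iota>\<close>, so its square has order \<open>2 m\<close> against order
    \<open>m\<close> of the numerator; \<open>w\<close> is the inverse of the image of
    \<open>\<psi> s\<close>.\<close>
  have pole: "\<exists>w. \<iota> (\<psi> s) * v w = 1 \<and> subdegree w = m"
    if \<psi>: "Khom \<psi>" and g0: "g0 \<in> carrier G" "\<psi> (\<phi> g0 \<theta>) = \<theta>" for \<psi> g0
  proof -
    have only: "g = g0" if "g \<in> carrier G" "\<psi> (\<phi> g \<theta>) = \<theta>" for g
    proof (rule faithful[OF that(1) g0(1)])
      fix a assume "a \<in> S"
      hence "\<psi> (\<phi> g a) = \<psi> (\<phi> g0 a)"
        using \<theta>(2)[OF Khom_comp[OF \<phi>[OF that(1)] \<psi>] Khom_comp[OF \<phi>[OF g0(1)] \<psi>]] that(2) g0(2)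
        by simp
      thus "\<phi> g a = \<phi> g0 a" by (simp only: fhom.eq_iff[OF KhomD(1)[OF \<psi>]])
    qed
    have "(\<Sum>g\<in>carrier G. if \<psi> (\<phi> g \<theta>) = \<theta> then m else 0) = (\<Sum>g\<in>carrier G. if g = g0 then m else 0)"
    proof (rule sum.cong)
      fix g assume "g \<in> carrier G"
      hence "\<psi> (\<phi> g \<theta>) = \<theta> \<longleftrightarrow> g = g0" using only g0(2) by blast
      thus "(if \<psi> (\<phi> g \<theta>) = \<theta> then m else 0) = (if g = g0 then m else 0)" by simp
    qed simp
    also have "\<dots> = m" using G(2) g0(1) by simp
    finally obtain U where U: "\<iota> (\<Prod>g\<in>carrier G. \<psi> (\<phi> g \<theta>) - \<Theta>) = v U" "U \<noteq> 0" "subdegree U = m"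
      using norm[OF \<psi>] by auto
    have "U\<^sup>2 \<noteq> 0" "subdegree p' \<le> subdegree (U\<^sup>2)"
      using U p'm by (auto simp: subdegree_power)
    then obtain w where w: "U\<^sup>2 = p' * w" "subdegree w = subdegree (U\<^sup>2) - subdegree p'"
      using fps_quotient[OF p'0] by blast
    have "v (U\<^sup>2) = v p' * v w" by (simp only: w(1) v.mult)
    moreover have "v (U\<^sup>2) \<noteq> 0" using U(2) by (simp only: v0) simp
    moreover have "\<iota> (\<psi> s) = v p' / v (U\<^sup>2)" by (simp add: \<psi>s[OF \<psi>] \<iota>pN U(1))
    ultimately have "\<iota> (\<psi> s) * v w = 1" by (metis divide_self times_divide_eq_left)
    moreover have "subdegree w = m" using w(2) p'm U(3) by (simp add: subdegree_power)
    ultimately show ?thesis by blast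
  qed
  have zero: "\<exists>t. \<iota> (\<psi> s) = v t \<and> t $ 0 = 0"
    if \<psi>: "Khom \<psi>" and none: "\<And>g. g \<in> carrier G \<Longrightarrow> \<psi> (\<phi> g \<theta>) \<noteq> \<theta>" for \<psi>
  proof -
    have "(\<Sum>g\<in>carrier G. if \<psi> (\<phi> g \<theta>) = \<theta> then m else 0) = 0"
      using none by (intro sum.neutral) auto
    then obtain U where U: "\<iota> (\<Prod>g\<in>carrier G. \<psi> (\<phi> g \<theta>) - \<Theta>) = v U" "U \<noteq> 0" "subdegree U = 0"
      using norm[OF \<psi>] by auto
    have "U\<^sup>2 \<noteq> 0" "subdegree (U\<^sup>2) \<le> subdegree p'"
      using U by (auto simp: subdegree_power)
    then obtain t where t: "p' = U\<^sup>2 * t" "t \<noteq> 0" "subdegree t = subdegree p' - subdegree (U\<^sup>2)"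
      using fps_quotient[OF _ p'0] by blast
    have "v p' = v (U\<^sup>2) * v t" by (simp only: t(1) v.mult)
    moreover have "v (U\<^sup>2) \<noteq> 0" using U(2) by (simp only: v0) simp
    moreover have "\<iota> (\<psi> s) = v p' / v (U\<^sup>2)" by (simp add: \<psi>s[OF \<psi>] \<iota>pN U(1))
    ultimately have "\<iota> (\<psi> s) = v t" by (metis nonzero_mult_div_cancel_left)
    moreover have "subdegree t = m" using t(3) p'm U(3) by (simp add: subdegree_power)
    hence "t $ 0 = 0" using m by (intro nth_less_subdegree_zero) simp
    ultimately show ?thesis by blast
  qed
  \<comment> \<open>At \<open>c1\<close> both \<open>N\<close> and all factors of \<open>Y\<close>
    are units, so \<open>s\<close> has the simple zero of \<open>p\<close>.\<close>
  have simple: "\<exists>t. \<kappa> s = v t \<and> subdegree t = 1"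
  proof -
    have "\<forall>g\<in>carrier G. \<exists>u. \<kappa> (\<phi> g \<theta> - \<Theta>) = v u \<and> u $ 0 \<noteq> 0"
      using other[OF \<kappa> c1(2) \<phi>] unfolding v_def \<Theta>_def by blast
    then obtain u where u: "\<forall>g\<in>carrier G. \<kappa> (\<phi> g \<theta> - \<Theta>) = v (u g) \<and> u g $ 0 \<noteq> 0"
      by (rule bchoice[THEN exE])
    define U where "U = (\<Prod>g\<in>carrier G. u g)"
    have U: "\<kappa> Y = v U"
      unfolding Y_def U_def \<kappa>.prod v.prod using u by (intro prod.cong) auto
    have "U $ 0 = (\<Prod>g\<in>carrier G. u g $ 0)"
      unfolding U_def by (rule rhom.prod[OF rhom_fps_nth_0])
    hence "U $ 0 \<noteq> 0" using u G(2) by simp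
    hence U0: "U \<noteq> 0" "subdegree U = 0" by (auto simp: subdegree_eq_0_iff)
    define q' where "q' = expand_at c1 p * expand_at c1 N"
    have "\<kappa> pN = v q'" by (simp add: pN_def q'_def v_def place_poly[OF \<kappa>] fls_times_fps_to_fls)
    have q'0: "q' \<noteq> 0" using p(1) N by (simp add: q'_def)
    have "subdegree (expand_at c1 p) = 1"
      by (rule subdegreeI) (use p(2,3) in \<open>auto simp: expand_at_nth_0 expand_at_nth_1[unfolded One_nat_def]\<close>)
    moreover have "subdegree (expand_at c1 N) = 0"
      using c1(3) by (simp add: subdegree_eq_0_iff expand_at_nth_0)
    ultimately have q'1: "subdegree q' = 1" using p(1) N by (simp add: q'_def)
    have "U\<^sup>2 \<noteq> 0" "subdegree (U\<^sup>2) \<le> subdegree q'" using U0 by (auto simp: subdegree_power)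
    then obtain t where t: "q' = U\<^sup>2 * t" "subdegree t = subdegree q' - subdegree (U\<^sup>2)"
      using fps_quotient[OF _ q'0] by blast
    have "v q' = v (U\<^sup>2) * v t" by (simp only: t(1) v.mult)
    moreover have "v (U\<^sup>2) \<noteq> 0" using U0(1) by (simp only: v0) simp
    moreover have "\<kappa> s = v q' / v (U\<^sup>2)" by (simp add: s_def \<open>\<kappa> pN = v q'\<close> U)
    ultimately have "\<kappa> s = v t" by (metis nonzero_mult_div_cancel_left)
    moreover have "subdegree t = 1" using t(2) q'1 U0(2) by (simp add: subdegree_power)
    ultimately show ?thesis by blast
  qed

  obtain t where t: "\<kappa> s = v t" "subdegree t = 1" using simple by blast
  have t0: "t $ 0 = 0" by (rule nth_less_subdegree_zero) (simp add: t)
  obtain u where u: "poly (trinomial d t) u = 0" "u $ 0 = 1"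
    by (rule trinomial_fps_root[OF t0])
  have "poly (map_poly \<kappa> (trinomial d s)) (v u) = 0"
    using trinomial_root_hom[OF \<open>rhom v\<close> u(1)] by (simp add: map_poly_trinomial[OF \<kappa>.rhom_axioms] t(1))
  moreover have tri0: "trinomial d s' \<noteq> 0" for s' :: "'k poly fract alg_closure"
    by (rule trinomial_nonzero) (use d in simp)
  ultimately obtain z where z: "poly (trinomial d s) z = 0" "v u = \<kappa> z"
    using roots_lift[OF \<kappa>.fhom_axioms] by metis
  define E' where "E' = adj (insert z S)"
  have E': "subfld E'" "range to_ac \<subseteq> E'" "E \<subseteq> E'" "z \<in> E'"
    unfolding E'_def E_def using subset_adj[of "insert z S"]
    by (auto intro: subfld_adj subsetD[OF base_subset_adj] subsetD[OF adj_mono[of S]])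
  have "\<kappa> z \<in> range to_ac" using z(2) unfolding v_def by (metis rangeI)
  hence "insert z S \<subseteq> unram \<kappa>" using D(2)[OF \<kappa> c1(1)] E(3) by (auto simp: unram_def)
  hence E'un: "E' \<subseteq> unram \<kappa>"
    unfolding E'_def by (intro adj_least subfld_unram[OF \<kappa>] base_subset_unram[OF \<kappa>])
  have unique: "y = z" if y: "y \<in> E'" "poly (trinomial d s) y = 0" for y
  proof -
    obtain \<zeta> where \<zeta>: "\<kappa> y = to_ac \<zeta>" using E'un y(1) by (auto simp: unram_def)
    have "poly (trinomial d (\<kappa> s)) (\<kappa> y) = 0"
      by (rule trinomial_root_hom[OF \<kappa>.rhom_axioms y(2)])
    hence "poly (map_poly to_ac (trinomial d (fps_to_fls t))) (to_ac \<zeta>) = 0"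
      by (simp add: t(1) v_def \<zeta> map_poly_trinomial[OF rhom_to_ac])
    hence "poly (trinomial d (fps_to_fls t)) \<zeta> = 0"
      by (simp add: rhom.poly_map[OF rhom_to_ac])
    hence "\<zeta> = fps_to_fls u"
      by (rule trinomial_fls_root_unique[OF t(2) d(1) u])
    hence "\<kappa> y = \<kappa> z" using \<zeta> z(2) by (simp add: v_def)
    thus ?thesis by simp
  qed
  \<comment> \<open>The residue of the trinomial at \<open>\<kappa>\<close> is \<open>Z - 1\<close>
    with derivative 1; this gives separability of \<open>z\<close> over \<open>E\<close> in every
    characteristic.\<close>
  have simple_root: "poly (pderiv (trinomial d s)) z \<noteq> 0"
  proof
    assume "poly (pderiv (trinomial d s)) z = 0"
    hence "poly (map_poly \<kappa> (pderiv (trinomial d s))) (\<kappa> z) = 0" unfolding \<kappa>.poly_map by simp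
    hence "poly (map_poly v (pderiv (trinomial d t))) (v u) = 0"
      by (simp add: \<kappa>.map_pderiv v.map_pderiv map_poly_trinomial[OF \<kappa>.rhom_axioms]
          map_poly_trinomial[OF \<open>rhom v\<close>] t(1) z(2))
    hence "poly (pderiv (trinomial d t)) u = 0" unfolding v.poly_map by (simp add: v0)
    hence "poly (pderiv (residue_poly (trinomial d t))) 1 = 0"
      using poly_nth_0[of "pderiv (trinomial d t)" u] u(2) by (simp add: pderiv_residue_poly)
    thus False by (simp add: residue_trinomial[OF t0] pderiv_pCons)
  qed

  obtain w where w: "\<iota> s * v w = 1" "subdegree w = m"
    using pole[OF Khom_id, of "\<one>\<^bsub>G\<^esub>"] \<phi>1[OF \<theta>(1)] by auto
  have "d \<ge> 2" using d by simp
  then obtain q :: "'k alg_closure fls poly" where q: "irreducible q" "degree q = d"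
    and q': "\<forall>(f :: 'k alg_closure fls \<Rightarrow> 'k alg_closure fls alg_closure) s \<zeta>. fhom f \<longrightarrow>
       s * f (fps_to_fls w) = 1 \<longrightarrow> poly (trinomial d s) \<zeta> = 0 \<longrightarrow> poly (map_poly f q) \<zeta> = 0"
    using trinomial_pole_irreducible[OF _ w(2) m d(2)] by blast
  have qroot: "poly (map_poly to_ac q) (\<iota> y) = 0" if "poly (trinomial d s) y = 0" for y
    using q' fhom_to_ac trinomial_root_hom[OF \<iota>.rhom_axioms that] w(1) unfolding v_def by blast
  have noroot: "y \<notin> unram \<iota>" if y: "poly (trinomial d s) y = 0" for y
  proof
    assume "y \<in> unram \<iota>"
    then obtain \<zeta> where \<zeta>: "\<iota> y = to_ac \<zeta>" by (auto simp: unram_def)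
    have "poly (map_poly to_ac [:- \<zeta>, 1:]) (\<iota> y) = 0" by (simp add: \<zeta> map_poly_pCons)
    hence "q dvd [:- \<zeta>, 1:]"
      by (rule irreducible_dvd_if_common_root[OF fhom_to_ac q(1) qroot[OF y]])
    hence "degree q \<le> degree [:- \<zeta>, 1:]" by (rule dvd_imp_degree_le) simp
    thus False using q(2) d by simp
  qed
  have conj: "\<exists>\<chi>. Khom \<chi> \<and> (\<forall>a\<in>S \<union> constant_closure. \<chi> a = a) \<and> \<chi> y = y'"
    if y: "poly (trinomial d s) y = 0" "poly (trinomial d s) y' = 0" for y y'
  proof -
    have "adj (S \<union> constant_closure) \<subseteq> unram \<iota>"
      using D(2)[OF \<iota> cD] E(3) constant_closure_unram[OF \<iota>]
      by (intro adj_least subfld_unram[OF \<iota>] base_subset_unram[OF \<iota>]) auto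
    then obtain \<chi> where \<chi>: "Khom \<chi>" "\<And>a. a \<in> adj (S \<union> constant_closure) \<Longrightarrow> \<chi> a = a" "\<chi> y = y'"
      using place_conj[OF \<iota> subfld_adj base_subset_adj _ q(1) qroot[OF y(1)] qroot[OF y(2)]] by metis
    thus ?thesis using subset_adj[of "S \<union> constant_closure"] by blast
  qed
  have fixE: "\<chi> y = y" if "Khom \<chi>" "\<And>a. a \<in> S \<Longrightarrow> \<chi> a = a" "y \<in> E" for \<chi> y
    using eqE[OF that(1) Khom_id] that(2,3) by blast

  \<comment> \<open>As \<open>s\<close> is invariant, \<open>\<phi> g z\<close> is a root of the
    same trinomial; a conjugation over \<open>E\<close> brings it back to \<open>z\<close>.\<close>
  have "\<exists>\<Phi>. Khom \<Phi> \<and> (\<forall>y\<in>E. \<Phi> y = \<phi> g y) \<and> \<Phi> z = z" if g: "g \<in> carrier G" for g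
  proof -
    have "poly (trinomial d (\<phi> g s)) (\<phi> g z) = 0"
      using trinomial_root_hom[OF fhom.axioms(1)[OF KhomD(1)[OF \<phi>[OF g]]] z(1)] .
    hence "poly (trinomial d s) (\<phi> g z) = 0" by (simp add: \<phi>s[OF g])
    then obtain \<chi> where \<chi>: "Khom \<chi>" "\<forall>a\<in>S \<union> constant_closure. \<chi> a = a" "\<chi> (\<phi> g z) = z"
      using conj z(1) by blast
    have "\<chi> (\<phi> g y) = \<phi> g y" if "y \<in> E" for y
      using fixE[OF \<chi>(1)] \<chi>(2) KE[OF \<phi>[OF g] that] by blast
    thus ?thesis
      using Khom_comp[OF \<phi>[OF g] \<chi>(1)] \<chi>(3) by (intro exI[of _ "\<lambda>x. \<chi> (\<phi> g x)"]) auto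
  qed
  then obtain \<Phi> where \<Phi>: "\<And>g. g \<in> carrier G \<Longrightarrow> Khom (\<Phi> g) \<and> (\<forall>y\<in>E. \<Phi> g y = \<phi> g y) \<and> \<Phi> g z = z"
    by metis

  \<comment> \<open>Otherwise \<open>\<iota> (\<psi> s)\<close> is a power series without constant
    term and the trinomial of \<open>\<psi> s\<close> has a power series root. If
    \<open>\<psi>\<close> is modified by a conjugation \<open>\<chi>\<close> over \<open>E\<close>
    that sends \<open>z\<close> to the preimage of this root, the image of \<open>E'\<close> becomes
    unramified at \<open>\<iota>\<close>. But \<open>E'\<close> contains the preimage of
    \<open>z\<close> under \<open>\<psi>\<close>, and this is mapped to a root of the trinomial of
    \<open>s\<close>, which is not in \<open>unram \<iota>\<close>.\<close>
  have rigid: "\<exists>g\<in>carrier G. \<psi> (\<phi> g \<theta>) = \<theta>" if \<psi>: "Khom \<psi>" "\<psi> ` E' = E'" for \<psi>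
  proof (rule ccontr)
    assume "\<not> ?thesis"
    then obtain t' where t': "\<iota> (\<psi> s) = v t'" "t' $ 0 = 0" using zero[OF \<psi>(1)] by blast
    obtain u' where u': "poly (trinomial d t') u' = 0" by (rule trinomial_fps_root[OF t'(2)])
    have "poly (map_poly \<iota> (trinomial d (\<psi> s))) (v u') = 0"
      using trinomial_root_hom[OF \<open>rhom v\<close> u'] by (simp add: map_poly_trinomial[OF \<iota>.rhom_axioms] t'(1))
    then obtain z'' where z'': "poly (trinomial d (\<psi> s)) z'' = 0" "v u' = \<iota> z''"
      using roots_lift[OF \<iota>.fhom_axioms tri0] by metis
    obtain \<psi>' where \<psi>': "Khom \<psi>'" "\<And>x. \<psi>' (\<psi> x) = x" "\<And>x. \<psi> (\<psi>' x) = x"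
      using Khom_inverse[OF \<psi>(1)] by blast
    have hom: "rhom \<psi>" "rhom \<psi>'" using \<psi>(1) \<psi>'(1) by (auto dest: KhomD simp: fhom_def)
    have "poly (trinomial d s) (\<psi>' z'') = 0"
      using trinomial_root_hom[OF hom(2) z''(1)] by (simp add: \<psi>'(2))
    then obtain \<chi> where \<chi>: "Khom \<chi>" "\<forall>a\<in>S \<union> constant_closure. \<chi> a = a" "\<chi> z = \<psi>' z''"
      using conj[OF z(1)] by blast
    have hom\<chi>: "rhom \<chi>" using \<chi>(1) by (auto dest: KhomD simp: fhom_def)
    have "Khom (\<lambda>x. \<psi> (\<chi> x))" using Khom_comp[OF \<chi>(1) \<psi>(1)] .
    have into: "\<psi> (\<chi> y) \<in> unram \<iota>" if "y \<in> E'" for y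
    proof (rule Khom_adj_into[OF \<open>Khom (\<lambda>x. \<psi> (\<chi> x))\<close> subfld_unram[OF \<iota>] base_subset_unram[OF \<iota>]])
      show "y \<in> adj (insert z S)" using that by (simp add: E'_def)
      fix a assume "a \<in> insert z S"
      thus "\<psi> (\<chi> a) \<in> unram \<iota>"
      proof
        assume "a = z"
        hence "\<iota> (\<psi> (\<chi> a)) = v u'" using \<chi>(3) \<psi>'(3) z''(2) by simp
        thus ?thesis by (simp add: unram_def v_def)
      next
        assume "a \<in> S"
        hence "\<psi> (\<chi> a) \<in> E" using \<chi>(2) KE[OF \<psi>(1)] E(3) by auto
        thus ?thesis using D(2)[OF \<iota> cD] by blast
      qed
    qed
    have "z \<in> \<psi> ` E'" using \<psi>(2) E'(4) by simp
    hence "\<psi>' z \<in> E'" using \<psi>'(2) by auto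
    moreover have "\<chi> (\<psi>' s) = \<psi>' s"
      using fixE[OF \<chi>(1)] \<chi>(2) KE[OF \<psi>'(1) sE] by blast
    hence "poly (trinomial d s) (\<psi> (\<chi> (\<psi>' z))) = 0"
      using trinomial_root_hom[OF hom(1) trinomial_root_hom[OF hom\<chi> trinomial_root_hom[OF hom(2) z(1)]]]
      by (simp add: \<psi>'(3))
    ultimately show False using noroot into by blast
  qed

  have "separable_element x" if "x \<in> adj (insert z S)" for x
    proof (rule separable_adj_insert[OF S _ z(1) simple_root that])
      show "trinomial d s \<in> polys_over (adj S)"
        unfolding trinomial_def using sE unfolding E_def
        by (intro polys_over_add polys_over_monom polys_over_pCons polys_over_0 subfldD(1,2,5) subfld_adj)
    qed
  moreover have "\<forall>g\<in>carrier G. Khom (\<Phi> g) \<and> (\<forall>y\<in>adj S. \<Phi> g y = \<phi> g y) \<and> \<Phi> g z = z"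
    using \<Phi> by (simp add: E_def)
  moreover have "\<exists>g\<in>carrier G. \<forall>y\<in>insert z S. \<psi> y = \<Phi> g y"
      if \<psi>: "Khom \<psi>" "\<psi> ` adj (insert z S) = adj (insert z S)" for \<psi>
    proof -
      obtain g where g: "g \<in> carrier G" "\<psi> (\<phi> g \<theta>) = \<theta>"
        using rigid[OF \<psi>(1)] \<psi>(2) unfolding E'_def by blast
      have "\<psi> (\<phi> g a) = a" if "a \<in> S" for a
        using \<theta>(2)[OF Khom_comp[OF \<phi>[OF g(1)] \<psi>(1)] Khom_id g(2) that] .
      hence id: "\<psi> (\<phi> g y) = y" if "y \<in> E" for y
        using fixE[OF Khom_comp[OF \<phi>[OF g(1)] \<psi>(1)]] that by blast
      define h where "h = inv\<^bsub>G\<^esub> g"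
      have h: "h \<in> carrier G" using g by (simp add: h_def)
      have \<psi>h: "\<psi> y = \<phi> h y" if "y \<in> E" for y
      proof -
        have "\<phi> g (\<phi> h y) = \<phi> (g \<otimes>\<^bsub>G\<^esub> h) y" using action[OF g(1) h] that by (simp add: E_def)
        also have "\<dots> = y" using \<phi>1[OF that] g(1) by (simp add: h_def)
        finally show ?thesis using id[OF KE[OF \<phi>[OF h] that]] by simp
      qed
      have "poly (trinomial d (\<psi> s)) (\<psi> z) = 0"
        using trinomial_root_hom[OF fhom.axioms(1)[OF KhomD(1)[OF \<psi>(1)]] z(1)] .
      hence "poly (trinomial d s) (\<psi> z) = 0" using \<psi>h[OF sE] \<phi>s[OF h] by simp
      moreover have "\<psi> z \<in> E'" using \<psi>(2) E'(4) unfolding E'_def by blast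
      ultimately have "\<psi> z = z" using unique by blast
      thus ?thesis using \<psi>h \<Phi>[OF h] h E(3) by (intro bexI[of _ h]) auto
    qed
  \<comment> \<open>Applying the inverse of \<open>\<chi>\<close> to \<open>\<psi> z\<close> yields
    a root of the trinomial of \<open>s\<close>, as \<open>\<psi>\<close> and \<open>\<chi>\<close>
    agree on \<open>E\<close>; so \<open>z\<close> can be moved there with the constants fixed. In
    this form irreducibility over the constants is handed on.\<close>
  moreover have "\<exists>\<chi>'. Khom \<chi>' \<and> (\<forall>a\<in>S \<union> constant_closure. \<chi>' a = a) \<and> \<chi> (\<chi>' z) = \<psi> z"
    if \<psi>: "Khom \<psi>" and \<chi>: "Khom \<chi>" and eq: "\<And>s. s \<in> S \<Longrightarrow> \<chi> s = \<psi> s" for \<psi> \<chi>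
  proof -
    obtain \<chi>1 where \<chi>1: "Khom \<chi>1" "\<And>x. \<chi>1 (\<chi> x) = x" "\<And>x. \<chi> (\<chi>1 x) = x"
      using Khom_inverse[OF \<chi>] by blast
    have "poly (trinomial d (\<chi>1 (\<psi> s))) (\<chi>1 (\<psi> z)) = 0"
      using trinomial_root_hom[OF _ trinomial_root_hom[OF _ z(1)]] \<chi>1(1) \<psi>
      by (meson KhomD(1) fhom.axioms(1))
    moreover have "\<chi>1 (\<psi> s) = s" using eqE[OF \<chi> \<psi> eq sE] \<chi>1(2) by metis
    ultimately obtain \<chi>' where "Khom \<chi>'" "\<forall>a\<in>S \<union> constant_closure. \<chi>' a = a" "\<chi>' z = \<chi>1 (\<psi> z)"
      using conj[OF z(1)] by auto
    thus ?thesis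
      using \<chi>1(3) by (intro exI[of _ \<chi>']) auto
  qed
  ultimately have "rigidifies G S \<phi> constant_closure z \<Phi>"
    unfolding rigidifies_def by simp
  thus ?thesis by blast
qed

section \<open>Realization of the automorphism group\<close>

lemma normal_ext_Khom:
  assumes L: "normal_ext L" "separable_element a" "a \<in> L" and \<psi>: "Khom \<psi>"
  shows "\<psi> a \<in> L"
proof -
  obtain p where "irreducible p" "poly (map_poly to_ac p) a = 0"
    using L(2) by (auto simp: separable_element_def)
  thus ?thesis using L(1,3) Khom_root[OF \<psi>] unfolding normal_ext_def by blast
qed

lemma FieldAut_carrier [simp]: "carrier (FieldAut E) = field_aut E"
  by (simp add: FieldAut_def)

lemma FieldAut_mult:
  fixes E :: "'f::field alg_closure set"
  assumes "subfld E" "range to_ac \<subseteq> E" "\<sigma> \<in> field_aut E" "\<tau> \<in> field_aut E"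
  shows "\<sigma> \<otimes>\<^bsub>FieldAut E\<^esub> \<tau> = compose E \<sigma> \<tau>"
proof -
  have "\<sigma> \<in> Bij E" "\<tau> \<in> Bij E" using assms(3,4) by (auto simp: field_aut_iff[OF assms(1,2)] Bij_def)
  thus ?thesis by (simp add: FieldAut_def BijGroup_def)
qed

text \<open>The isomorphism is built from \<open>G\<close> to the automorphism group:
  \<open>\<gamma> g\<close> restricts the map \<open>\<Phi> g\<close> that acts on \<open>L\<close>
  as \<open>\<alpha> g\<close>, on \<open>R\<close> as translation by \<open>g\<close> and on
  \<open>z\<close> trivially. Its inverse is \<open>\<beta>\<close>, and compatibility with
  \<open>\<alpha>\<close> is built in.\<close>

lemma automorphism_group_realization:
  fixes G :: "('g, 'm) monoid_scheme"
    and L :: "'k::field poly fract alg_closure set"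
  assumes G: "group G" "finite (carrier G)" and "finite_ext L" "galois_ext L"
    and \<alpha>: "\<alpha> \<in> hom G (FieldAut L)"
  shows "\<exists>(E :: 'k poly fract alg_closure set) \<beta>.
           finite_ext E \<and> separable_ext E \<and> L \<subseteq> E \<and>
           E \<inter> constant_closure = L \<inter> constant_closure \<and>
           \<beta> \<in> iso (FieldAut E) G \<and>
           (\<forall>\<sigma>\<in>carrier (FieldAut E). \<alpha> (\<beta> \<sigma>) = restrict \<sigma> L)"
proof -
  interpret G: group G by fact
  obtain B where B: "finite B" "L = adj B" "B \<subseteq> L" using finite_ext_generated[OF assms(3)] .
  have L: "subfld L" "range to_ac \<subseteq> L" unfolding B(2) by (rule subfld_adj base_subset_adj)+
  have sepL: "separable_element a" if "a \<in> L" for a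
    using assms(4) that by (simp add: galois_ext_def separable_ext_def)
  have normL: "\<psi> a \<in> L" if "Khom \<psi>" "a \<in> L" for \<psi> a
    using normal_ext_Khom[OF _ sepL] assms(4) that by (simp add: galois_ext_def)
  obtain D :: "'k poly" where D: "D \<noteq> 0" "\<And>c \<iota>. place c \<iota> \<Longrightarrow> eval_at c D \<noteq> 0 \<Longrightarrow> L \<subseteq> unram \<iota>"
    using finite_separable_unram[OF B(1)] sepL B(3) unfolding B(2) by blast
  have card: "card (carrier G) > 0" using G(2) G.one_closed by (auto simp: card_gt_0_iff)
  obtain R where Rcard: "card R = card (carrier G)" and "symmetric_over D R"
    using symmetric_extension[OF D(1) card] by blast
  hence R: "finite R" "\<And>x. x \<in> R \<Longrightarrow> separable_element x" "\<And>\<psi>. Khom \<psi> \<Longrightarrow> \<psi> ` R \<subseteq> R"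
    and Rsym: "\<And>F \<pi>. subfld F \<Longrightarrow> range to_ac \<subseteq> F \<Longrightarrow>
       (\<And>c \<iota>. place c \<iota> \<Longrightarrow> eval_at c D \<noteq> 0 \<Longrightarrow> F \<subseteq> unram \<iota>) \<Longrightarrow> inj_on \<pi> R \<Longrightarrow> \<pi> ` R \<subseteq> R \<Longrightarrow>
       \<exists>\<chi>. Khom \<chi> \<and> (\<forall>a\<in>F. \<chi> a = a) \<and> (\<forall>x\<in>R. \<chi> x = \<pi> x)"
    unfolding symmetric_over_def by simp_all
  obtain x where x: "bij_betw x (carrier G) R"
    using finite_same_card_bij[OF G(2) R(1)] Rcard by auto
  have xR: "x u \<in> R" if "u \<in> carrier G" for u using x that by (auto simp: bij_betw_def)
  have xinj: "x u = x u' \<longleftrightarrow> u = u'" if "u \<in> carrier G" "u' \<in> carrier G" for u u'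
    using x that by (auto simp: bij_betw_def inj_on_def)
  have Ronto: "\<exists>u\<in>carrier G. y = x u" if "y \<in> R" for y using x that by (auto simp: bij_betw_def)
  have KR: "\<psi> y \<in> R" if "Khom \<psi>" "y \<in> R" for \<psi> y using R(3) that by blast
  have \<alpha>G: "\<alpha> g \<in> field_aut L" if "g \<in> carrier G" for g
    using \<alpha> that by (auto simp: hom_def)

  have "\<exists>\<phi>. Khom \<phi> \<and> (\<forall>a\<in>L. \<phi> a = \<alpha> g a) \<and> (\<forall>u\<in>carrier G. \<phi> (x u) = x (g \<otimes>\<^bsub>G\<^esub> u))"
    if g: "g \<in> carrier G" for g
  proof -
    obtain \<psi> where \<psi>: "Khom \<psi>" "\<And>a. a \<in> L \<Longrightarrow> \<psi> a = \<alpha> g a"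
      using field_aut_extend[OF L \<alpha>G[OF g]] by blast
    obtain \<psi>' where \<psi>': "Khom \<psi>'" "\<And>x. \<psi>' (\<psi> x) = x" "\<And>x. \<psi> (\<psi>' x) = x"
      using Khom_inverse[OF \<psi>(1)] by blast
    \<comment> \<open>An extension \<open>\<psi>\<close> of \<open>\<alpha> g\<close> permutes
      \<open>R\<close> in some way; \<open>\<pi>\<close> is the permutation that turns it into
      translation by \<open>g\<close>, and \<open>Rsym\<close> realizes \<open>\<pi>\<close> over
      \<open>L\<close>.\<close>
    define \<pi> where "\<pi> = (\<lambda>y. x (g \<otimes>\<^bsub>G\<^esub> inv_into (carrier G) x (\<psi>' y)))"
    have \<pi>: "\<pi> (\<psi> (x u)) = x (g \<otimes>\<^bsub>G\<^esub> u)" if "u \<in> carrier G" for u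
      using that x by (simp add: \<pi>_def \<psi>'(2) bij_betw_def inv_into_f_f)
    have R\<psi>: "\<exists>u\<in>carrier G. y = \<psi> (x u)" if "y \<in> R" for y
      using Ronto[OF KR[OF \<psi>'(1) that]] \<psi>'(3) by metis
    have \<pi>inj: "inj_on \<pi> R"
    proof (rule inj_onI)
      fix y y' assume y: "y \<in> R" "y' \<in> R" "\<pi> y = \<pi> y'"
      obtain u u' where u: "u \<in> carrier G" "y = \<psi> (x u)" "u' \<in> carrier G" "y' = \<psi> (x u')"
        using R\<psi>[OF y(1)] R\<psi>[OF y(2)] by blast
      hence "x (g \<otimes>\<^bsub>G\<^esub> u) = x (g \<otimes>\<^bsub>G\<^esub> u')" using y(3) by (simp add: \<pi>)
      hence "u = u'" using u g by (simp add: xinj)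
      thus "y = y'" using u by simp
    qed
    have \<pi>sub: "\<pi> ` R \<subseteq> R"
      using R\<psi> \<pi> xR g by (metis G.m_closed image_subsetI)
    have "\<exists>\<chi>. Khom \<chi> \<and> (\<forall>a\<in>L. \<chi> a = a) \<and> (\<forall>y\<in>R. \<chi> y = \<pi> y)"
      by (rule Rsym[OF L D(2) \<pi>inj \<pi>sub])
    then obtain \<chi> where \<chi>: "Khom \<chi>" "\<forall>a\<in>L. \<chi> a = a" "\<forall>y\<in>R. \<chi> y = \<pi> y"
      by blast
    have "\<chi> (\<psi> a) = \<alpha> g a" if "a \<in> L" for a
      using \<chi>(2) \<psi>(2) normL[OF \<psi>(1) that] that by simp
    moreover have "\<chi> (\<psi> (x u)) = x (g \<otimes>\<^bsub>G\<^esub> u)" if "u \<in> carrier G" for u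
      using \<chi>(3) KR[OF \<psi>(1) xR[OF that]] \<pi>[OF that] by simp
    ultimately show ?thesis
      using Khom_comp[OF \<psi>(1) \<chi>(1)] by (intro exI[of _ "\<lambda>a. \<chi> (\<psi> a)"]) auto
  qed
  then obtain \<phi> where \<phi>': "\<And>g. g \<in> carrier G \<Longrightarrow> Khom (\<phi> g) \<and> (\<forall>a\<in>L. \<phi> g a = \<alpha> g a) \<and>
      (\<forall>u\<in>carrier G. \<phi> g (x u) = x (g \<otimes>\<^bsub>G\<^esub> u))" by metis
  have \<phi>: "Khom (\<phi> g)" and \<phi>L: "\<And>a. a \<in> L \<Longrightarrow> \<phi> g a = \<alpha> g a"
    and \<phi>x: "\<And>u. u \<in> carrier G \<Longrightarrow> \<phi> g (x u) = x (g \<otimes>\<^bsub>G\<^esub> u)" if "g \<in> carrier G" for g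
    using \<phi>'[OF that] by auto

  define S where "S = B \<union> R"
  have S: "finite S" "\<And>s. s \<in> S \<Longrightarrow> separable_element s"
    using B R(1,2) sepL by (auto simp: S_def)
  have LS: "L \<subseteq> adj S" "R \<subseteq> adj S"
    unfolding B(2) using adj_mono[of B S] subset_adj[of S] by (auto simp: S_def)
  have normal: "\<psi> s \<in> adj S" if "Khom \<psi>" "s \<in> S" for \<psi> s
    using that normL[OF that(1)] KR[OF that(1)] B(3) LS by (auto simp: S_def)
  have action: "\<phi> (g \<otimes>\<^bsub>G\<^esub> h) y = \<phi> g (\<phi> h y)"
    if gh: "g \<in> carrier G" "h \<in> carrier G" and y: "y \<in> adj S" for g h y
  proof (rule Khom_eq_on_adj[OF \<phi> Khom_comp[OF \<phi> \<phi>] _ y])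
    show "g \<otimes>\<^bsub>G\<^esub> h \<in> carrier G" "g \<in> carrier G" "h \<in> carrier G" using gh by auto
    fix s assume "s \<in> S"
    then consider "s \<in> L" | "s \<in> R" using B(3) by (auto simp: S_def)
    thus "\<phi> (g \<otimes>\<^bsub>G\<^esub> h) s = \<phi> g (\<phi> h s)"
    proof cases
      case 1
      have "\<alpha> (g \<otimes>\<^bsub>G\<^esub> h) = compose L (\<alpha> g) (\<alpha> h)"
        using \<alpha> gh FieldAut_mult[OF L \<alpha>G[OF gh(1)] \<alpha>G[OF gh(2)]] by (simp add: hom_def)
      thus ?thesis using 1 gh normL[OF \<phi>[OF gh(2)] 1] by (simp add: \<phi>L compose_def)
    next
      case 2
      then obtain u where "u \<in> carrier G" "s = x u" using Ronto by blast
      thus ?thesis using gh by (simp add: \<phi>x G.m_assoc)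
    qed
  qed
  have faithful: "g = h" if gh: "g \<in> carrier G" "h \<in> carrier G" and eq: "\<And>s. s \<in> S \<Longrightarrow> \<phi> g s = \<phi> h s" for g h
  proof -
    \<comment> \<open>Translations are told apart by the image of the unit.\<close>
    have "\<phi> g (x \<one>\<^bsub>G\<^esub>) = \<phi> h (x \<one>\<^bsub>G\<^esub>)" using eq xR[OF G.one_closed] by (simp add: S_def)
    thus ?thesis using gh by (simp add: \<phi>x xinj)
  qed
  have "\<exists>z \<Phi>. rigidifies G S \<phi> constant_closure z \<Phi>"
  proof (rule rigidification[of G S \<phi>, OF G S(1)])
    show "g = h" if "g \<in> carrier G" "h \<in> carrier G" "\<And>s. s \<in> S \<Longrightarrow> \<phi> g s = \<phi> h s" for g h
      using faithful that by blast
  qed (fact S(2) normal \<phi> action)+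
  then obtain z \<Phi> where "rigidifies G S \<phi> constant_closure z \<Phi>" by blast
  hence sep: "\<And>x. x \<in> adj (insert z S) \<Longrightarrow> separable_element x" and
    \<Phi>: "\<And>g. g \<in> carrier G \<Longrightarrow> Khom (\<Phi> g)"
    "\<And>g y. g \<in> carrier G \<Longrightarrow> y \<in> adj S \<Longrightarrow> \<Phi> g y = \<phi> g y"
    "\<And>g. g \<in> carrier G \<Longrightarrow> \<Phi> g z = z" and
    rigid: "\<And>\<psi>. Khom \<psi> \<Longrightarrow> \<psi> ` adj (insert z S) = adj (insert z S) \<Longrightarrow>
       \<exists>g\<in>carrier G. \<forall>y\<in>insert z S. \<psi> y = \<Phi> g y" and
    lift: "\<And>\<psi> \<chi>. Khom \<psi> \<Longrightarrow> Khom \<chi> \<Longrightarrow> (\<And>s. s \<in> S \<Longrightarrow> \<chi> s = \<psi> s) \<Longrightarrow>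
       \<exists>\<chi>'. Khom \<chi>' \<and> (\<forall>a\<in>S \<union> constant_closure. \<chi>' a = a) \<and> \<chi> (\<chi>' z) = \<psi> z"
    unfolding rigidifies_def by (simp_all del: insert_iff ball_simps)
  define E where "E = adj (insert z S)"
  have E: "subfld E" "range to_ac \<subseteq> E" unfolding E_def by (rule subfld_adj base_subset_adj)+
  have SE: "adj S \<subseteq> E" "z \<in> E"
    using adj_mono[of S "insert z S"] subset_adj[of "insert z S"] by (auto simp: E_def)
  have LE: "L \<subseteq> E" using LS(1) SE(1) by blast
  have KE: "\<psi> y = \<psi>' y" if "Khom \<psi>" "Khom \<psi>'" "\<forall>s\<in>insert z S. \<psi> s = \<psi>' s" "y \<in> E" for \<psi> \<psi>' y
    using Khom_eq_on_adj[of \<psi> \<psi>' "insert z S" y] that unfolding E_def by blast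

  \<comment> \<open>A conjugation \<open>\<psi>\<close> over \<open>L\<close> agrees on
    \<open>S\<close> with some \<open>\<chi>\<close> that also fixes the constants, because all
    permutations of \<open>R\<close> are induced over \<open>L\<close> and the constants; the image
    of \<open>z\<close> is adjusted by \<open>\<chi>'\<close>, which fixes the constants too. So
    \<open>\<psi>\<close> fixes \<open>a\<close>, and a separable element fixed by all such
    \<open>\<psi>\<close> lies in \<open>L\<close>.\<close>
  have const: "a \<in> L" if a: "a \<in> E" "a \<in> constant_closure" for a
  proof (rule Khom_fixed_imp_mem[OF L])
    show "separable_element a" using sep a(1) by (simp add: E_def)
    fix \<psi> assume \<psi>: "Khom \<psi>" "\<And>a. a \<in> L \<Longrightarrow> \<psi> a = a"
    have "\<exists>\<chi>. Khom \<chi> \<and> (\<forall>a\<in>adj (L \<union> constant_closure). \<chi> a = a) \<and> (\<forall>y\<in>R. \<chi> y = \<psi> y)"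
    proof (rule Rsym[OF subfld_adj base_subset_adj])
      show "adj (L \<union> constant_closure) \<subseteq> unram \<iota>" if "place c \<iota>" "eval_at c D \<noteq> 0" for c \<iota>
        using D(2)[OF that] constant_closure_unram[OF that(1)]
        by (intro adj_least subfld_unram[OF that(1)] base_subset_unram[OF that(1)]) auto
      show "inj_on \<psi> R" using fhom.inj[OF KhomD(1)[OF \<psi>(1)]] by (rule inj_on_subset) auto
      show "\<psi> ` R \<subseteq> R" using R(3)[OF \<psi>(1)] .
    qed
    then obtain \<chi> where \<chi>: "Khom \<chi>" "\<forall>a\<in>adj (L \<union> constant_closure). \<chi> a = a" "\<forall>y\<in>R. \<chi> y = \<psi> y"
      by blast
    have \<chi>fix: "\<chi> b = b" if "b \<in> L \<union> constant_closure" for b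
      using \<chi>(2) subset_adj[of "L \<union> constant_closure"] that by blast
    have \<chi>S: "\<chi> s = \<psi> s" if "s \<in> S" for s
      using that \<chi>fix \<psi>(2) \<chi>(3) B(3) by (auto simp: S_def)
    then obtain \<chi>' where \<chi>': "Khom \<chi>'" "\<forall>a\<in>S \<union> constant_closure. \<chi>' a = a" "\<chi> (\<chi>' z) = \<psi> z"
      using lift[OF \<psi>(1) \<chi>(1)] by blast
    have "\<psi> a = \<chi> (\<chi>' a)"
      using \<chi>' \<chi>S by (intro KE[OF \<psi>(1) Khom_comp[OF \<chi>'(1) \<chi>(1)] _ a(1)]) auto
    thus "\<psi> a = a" using \<chi>'(2) \<chi>fix a(2) by simp
  qed

  have \<Phi>mult: "\<Phi> (g \<otimes>\<^bsub>G\<^esub> h) y = \<Phi> g (\<Phi> h y)"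
    if gh: "g \<in> carrier G" "h \<in> carrier G" and y: "y \<in> E" for g h y
  proof (rule KE[OF \<Phi>(1) Khom_comp[OF \<Phi>(1) \<Phi>(1)] _ y])
    show "g \<otimes>\<^bsub>G\<^esub> h \<in> carrier G" "g \<in> carrier G" "h \<in> carrier G" using gh by auto
    show "\<forall>s\<in>insert z S. \<Phi> (g \<otimes>\<^bsub>G\<^esub> h) s = \<Phi> g (\<Phi> h s)"
    proof
      fix s assume "s \<in> insert z S"
      then consider "s = z" | "s \<in> S" by blast
      thus "\<Phi> (g \<otimes>\<^bsub>G\<^esub> h) s = \<Phi> g (\<Phi> h s)"
      proof cases
        case 2
        hence "s \<in> adj S" "\<phi> h s \<in> adj S" using subset_adj normal[OF \<phi>[OF gh(2)]] by auto
        thus ?thesis using gh by (simp add: \<Phi>(2) action)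
      qed (use gh \<Phi>(3) in simp)
    qed
  qed
  have \<Phi>E: "\<Phi> g y \<in> E" if g: "g \<in> carrier G" and y: "y \<in> E" for g y
  proof (rule Khom_adj_into[OF \<Phi>(1)[OF g] E _ y[unfolded E_def]])
    fix s assume "s \<in> insert z S"
    thus "\<Phi> g s \<in> E"
    proof
      assume s: "s \<in> S"
      hence "s \<in> adj S" using subset_adj by blast
      hence "\<Phi> g s = \<phi> g s" by (rule \<Phi>(2)[OF g])
      thus ?thesis using normal[OF \<phi>[OF g] s] SE(1) by auto
    qed (use \<Phi>(3)[OF g] SE(2) in simp)
  qed
  have \<Phi>1: "\<Phi> \<one>\<^bsub>G\<^esub> y = y" if "y \<in> E" for y
  proof -
    have "\<Phi> \<one>\<^bsub>G\<^esub> (\<Phi> \<one>\<^bsub>G\<^esub> y) = \<Phi> \<one>\<^bsub>G\<^esub> y"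
      using \<Phi>mult[OF G.one_closed G.one_closed that] by simp
    thus ?thesis by (simp only: fhom.eq_iff[OF KhomD(1)[OF \<Phi>(1)[OF G.one_closed]]])
  qed
  have \<Phi>im: "\<Phi> g ` E = E" if g: "g \<in> carrier G" for g
  proof
    show "E \<subseteq> \<Phi> g ` E"
    proof
      fix y assume y: "y \<in> E"
      have "\<Phi> g (\<Phi> (inv\<^bsub>G\<^esub> g) y) = y"
        using \<Phi>mult[OF g G.inv_closed[OF g] y] \<Phi>1[OF y] g by simp
      thus "y \<in> \<Phi> g ` E" using \<Phi>E[OF G.inv_closed[OF g] y] by (metis image_eqI)
    qed
  qed (use \<Phi>E[OF g] in blast)
  define \<gamma> where "\<gamma> = (\<lambda>g. restrict (\<Phi> g) E)"
  have \<gamma>E: "\<gamma> g \<in> field_aut E" if "g \<in> carrier G" for g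
    unfolding \<gamma>_def by (rule restrict_field_aut[OF E \<Phi>(1)[OF that] \<Phi>im[OF that]])
  have \<gamma>inj: "inj_on \<gamma> (carrier G)"
  proof (rule inj_onI)
    fix g h assume gh: "g \<in> carrier G" "h \<in> carrier G" "\<gamma> g = \<gamma> h"
    show "g = h"
    proof (rule faithful[OF gh(1,2)])
      fix s assume "s \<in> S"
      hence s: "s \<in> adj S" "s \<in> E" using subset_adj SE by blast+
      have "\<gamma> g s = \<gamma> h s" using gh(3) by simp
      thus "\<phi> g s = \<phi> h s" using s gh by (simp add: \<gamma>_def \<Phi>(2))
    qed
  qed
  have \<gamma>surj: "\<exists>g\<in>carrier G. \<sigma> = \<gamma> g" if \<sigma>: "\<sigma> \<in> field_aut E" for \<sigma>
  proof -
    obtain \<psi> where \<psi>: "Khom \<psi>" "\<And>a. a \<in> E \<Longrightarrow> \<psi> a = \<sigma> a" using field_aut_extend[OF E \<sigma>] by blast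
    have ext: "\<sigma> \<in> extensional E" "\<sigma> ` E = E"
      using \<sigma> by (auto simp: field_aut_iff[OF E] bij_betw_def)
    have "\<psi> ` E = \<sigma> ` E" using \<psi>(2) by (rule image_cong[OF refl])
    hence "\<psi> ` E = E" using ext(2) by simp
    then obtain g where g: "g \<in> carrier G" "\<forall>y\<in>insert z S. \<psi> y = \<Phi> g y"
      using rigid[OF \<psi>(1)] unfolding E_def by blast
    have "\<sigma> = \<gamma> g"
    proof (rule extensionalityI[OF ext(1)])
      show "\<gamma> g \<in> extensional E" by (simp add: \<gamma>_def)
      show "\<sigma> y = \<gamma> g y" if "y \<in> E" for y
        using KE[OF \<psi>(1) \<Phi>(1)[OF g(1)] g(2) that] \<psi>(2)[OF that] that by (simp add: \<gamma>_def)
    qed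
    thus ?thesis using g(1) by blast
  qed
  have \<gamma>iso: "\<gamma> \<in> iso G (FieldAut E)"
  proof (rule isoI)
    show "\<gamma> \<in> hom G (FieldAut E)"
    proof (rule homI)
      fix g h assume gh: "g \<in> carrier G" "h \<in> carrier G"
      show "\<gamma> (g \<otimes>\<^bsub>G\<^esub> h) = \<gamma> g \<otimes>\<^bsub>FieldAut E\<^esub> \<gamma> h"
        unfolding FieldAut_mult[OF E \<gamma>E[OF gh(1)] \<gamma>E[OF gh(2)]]
        using \<Phi>mult[OF gh] \<Phi>E[OF gh(2)] by (auto simp: \<gamma>_def compose_def restrict_def)
    qed (simp add: \<gamma>E)
    show "bij_betw \<gamma> (carrier G) (carrier (FieldAut E))"
      using \<gamma>inj \<gamma>E \<gamma>surj by (auto simp: bij_betw_def)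
  qed
  define \<beta> where "\<beta> = inv_into (carrier G) \<gamma>"
  have "\<beta> \<in> iso (FieldAut E) G" unfolding \<beta>_def by (rule G.iso_set_sym[OF \<gamma>iso])
  moreover have "\<alpha> (\<beta> \<sigma>) = restrict \<sigma> L" if \<sigma>: "\<sigma> \<in> carrier (FieldAut E)" for \<sigma>
  proof -
    obtain g where g: "g \<in> carrier G" "\<sigma> = \<gamma> g" using \<gamma>surj \<sigma> by auto
    have \<beta>g: "\<beta> \<sigma> = g" unfolding \<beta>_def g(2) by (rule inv_into_f_f[OF \<gamma>inj g(1)])
    have "\<alpha> g = restrict (\<gamma> g) L"
    proof (rule extensionalityI)
      show "\<alpha> g \<in> extensional L" using \<alpha>G[OF g(1)] by (simp add: field_aut_iff[OF L])
      fix a assume a: "a \<in> L"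
      hence "a \<in> adj S" "a \<in> E" using LS(1) LE by auto
      thus "\<alpha> g a = restrict (\<gamma> g) L a" using a g(1) by (simp add: \<gamma>_def \<Phi>(2) \<phi>L)
    qed simp
    thus ?thesis using \<beta>g g(2) by simp
  qed
  moreover have "finite_ext E" unfolding E_def using S(1) by (intro finite_ext_adj) simp
  moreover from this have "separable_ext E"
    using sep by (simp add: separable_ext_def finite_ext_def E_def)
  moreover have "E \<inter> constant_closure = L \<inter> constant_closure" using const LE by blast
  ultimately show ?thesis using LE by blast
qed

theorem theorem1p2:
  fixes G :: "('g, 'm) monoid_scheme"
    and L :: "'k::field poly fract alg_closure set"
    and \<alpha> :: "'g \<Rightarrow> ('k poly fract alg_closure \<Rightarrow> 'k poly fract alg_closure)"
    and \<alpha>' :: "('k poly fract alg_closure \<Rightarrow> 'k poly fract alg_closure) \<Rightarrow> 'g"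
  assumes "group G" and "finite (carrier G)"
    and "finite_ext L" and "galois_ext L"
    and "\<alpha> \<in> epi G (FieldAut L)"
    and "\<alpha>' \<in> mon (FieldAut L) G"
    and "\<forall>\<sigma>\<in>carrier (FieldAut L). \<alpha> (\<alpha>' \<sigma>) = \<sigma>"
  shows "\<exists>(E :: 'k poly fract alg_closure set) \<beta>.
           finite_ext E \<and> separable_ext E \<and> L \<subseteq> E \<and>
           E \<inter> constant_closure = L \<inter> constant_closure \<and>
           \<beta> \<in> iso (FieldAut E) G \<and>
           (\<forall>\<sigma>\<in>carrier (FieldAut E). \<alpha> (\<beta> \<sigma>) = restrict \<sigma> L)"
  using automorphism_group_realization[OF assms(1-4)] assms(5) by (auto simp: epi_def)

end
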